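(* The map $\mathtt{dec}_Z$ from $(\mathrm{ZZ})\cup(\mathrm{PZZ})\subset\mathrm{FC}(\tilde C_n)$ to the set of $\mathcal Z$-diagrams in $\mathbb D(\tilde C_n)$ is surjective.
   Context: Let $n\ge 2$. $\tilde C_n$ is the Coxeter group with generators $\tilde s_1,\dots,\tilde s_{n+1}$ whose Coxeter graph is the path $\tilde s_1-\cdots-\tilde s_{n+1}$, the edges $\{\tilde s_1,\tilde s_2\}$, $\{\tilde s_n,\tilde s_{n+1}\}$ having label $4$ and the others label $3$; $A_{n+1}$ has generators $s_1,\dots,s_{n+1}$ and Coxeter graph the path with all labels $3$. $\mathrm{FC}(\cdot)$ is the set of fully commutative elements (any two reduced expressions are related by commutation relations only). The heap $H(w)$ of a FC element $w$ with reduced expression $s_{a_1}\cdots s_{a_l}$ is the poset on $\{1,\dots,l\}$ generated by $i\prec j$ if $i<j$ and $s_{a_i},s_{a_j}$ do not commute, with $i$ labeled $s_{a_i}$; it is drawn from top to bottom ($i$ above $j$ if $i\prec j$). FAMILIES. $\tilde w\in(\mathrm{ZZ})$ if $\tilde w$ has a reduced expression which is a finite factor of the infinite word $(\tilde s_1\tilde s_2\cdots\tilde s_n\tilde s_{n+1}\tilde s_n\cdots\tilde s_2)^\infty$ and some $\tilde s_i$, $2\le i\le n$, occurs at least three times. $\tilde w\in(\mathrm{PZZ})$ if $\tilde w$ has a reduced expression which is a finite factor of the same infinite word, contains the factors $\tilde s_2\tilde s_1\tilde s_2$ and $\tilde s_n\tilde s_{n+1}\tilde s_n$, and in which every $\tilde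 s_i$, $2\le i\le n$, occurs fewer than three times. DIAGRAMS. The standard $(n+2)$-box has nodes $1,\dots,n+2$ on the north face and $1',\dots,(n+2)'$ on the south face, left to right. A pseudo diagram is an isotopy class of finitely many disjoint curves (edges) in the box, joining the nodes in pairs or closed (loops); an edge is propagating if it joins the two faces; $\mathbf a(d)$ is the number of non-propagating edges on the north face. The product $d'd$ places $d'$ on top of $d$. The simple diagram $d_i$ has edges $(i,i+1)$, $(i',(i+1)')$ and all other edges vertical $(j,j')$. Modulo removing a loop with a factor $\delta$, for $w=s_{i_1}\cdots s_{i_k}\in\mathrm{FC}(A_{n+1})$ put $d_w=d_{i_1}\cdots d_{i_k}$; $w\mapsto d_w$ is a bijection onto loop-free diagrams. For $\tilde w=\tilde s_{i_1}\cdots\tilde s_{i_k}\in\mathrm{FC}(\tilde C_n)$ the element $\tau(\tilde w)\in\mathrm{FC}(A_{n+1})$ is defined by $d_{i_1}\cdots d_{i_k}=\delta^{\alpha}d_{\tau(\tilde w)}$, $\alpha\ge0$. For $\tilde w\in(\mathrm{ZZ})\cup(\mathrm{PZZ})$ one has $\mathbf a(d_{\tau(\tilde w)})=1$. DECORATED DIAGRAMS. Edges may carry finite words in the decorations $\bullet,\blacktriangle$ (black), $\circ,\vartriangle$ (white), read from north to south on propagating edges and from the left node to the right node on the others; no decorations are allowed if $\mathbf a(d)=0$; all decorated edges must be simultaneously deformable so as to take black decorations to the left wall and white ones to the right wall without crossing other edges. The word on an edge is a single block, except on propagating edges when $\mathbf a(d)=1$: there words are split into blocks whose relative vertical positions are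 part of the data; decorations on propagating edges lie below those on the north non-propagating edge and above those on the south one; no decoration on another propagating edge lies in the vertical range of a block; adjacent blocks are conjoined whenever this is compatible with these rules. Diagrams are taken up to isotopy preserving relative vertical positions of blocks. They are multiplied by concatenation, over $\mathbb Z[\delta]$, modulo the following relations for adjacent decorations in a block: $\bullet\bullet=\blacktriangle$, $\bullet\blacktriangle=\blacktriangle\bullet=2\bullet$, $\circ\circ=\vartriangle$, $\circ\vartriangle=\vartriangle\circ=2\circ$; and a loop that is undecorated, or carries only one $\blacktriangle$, or only one $\vartriangle$, equals $\delta$. $\mathbb D(\tilde C_n)$ is the subalgebra generated by $\tilde d_1,\dots,\tilde d_{n+1}$, where $\tilde d_i=d_i$ for $2\le i\le n$, $\tilde d_1$ is $d_1$ with one $\bullet$ on each of $(1,2)$, $(1',2')$, and $\tilde d_{n+1}$ is $d_{n+1}$ with one $\circ$ on each of $(n+1,n+2)$, $((n+1)',(n+2)')$. ADMISSIBLE DIAGRAMS WITH $\mathbf a(d)=1$ (the only ones relevant here). A decorated diagram $d$ with $\mathbf a(d)=1$, in which no relation applies, is admissible if it has no loops other than loops decorated by exactly one $\blacktriangle$ and one $\vartriangle$ and its western end is one of: (a) an edge $(1,1')$ carrying a (possibly empty) sequence of blocks each equal to a single $\blacktriangle$; (b) edges $(1,2)$, $(1',2')$ with one $\bullet$ each and the edge $(3,3')$ undecorated or with a single $\blacktriangle$, and then no other decoration occurs on $d$; (c) the edge $(1,2)$ with one $\bullet$ and a propagating edge $(3,1')$ carrying a $\bullet$ followed by a (possibly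 empty) sequence of blocks $\blacktriangle$; (d) the edge $(1',2')$ with one $\bullet$ and a propagating edge $(1,3')$ carrying a (possibly empty) sequence of blocks $\blacktriangle$ followed by a $\bullet$; (e) edges $(1,2)$, $(1',2')$ with one $\bullet$ each and the edge $(3,3')$ carrying a $\bullet$, a (possibly empty) sequence of blocks $\blacktriangle$, and a $\bullet$. The upper (resp. lower) $\bullet$ on the propagating edge in (c),(e) (resp. (d),(e)) has the highest (resp. lowest) vertical position of all decorations on propagating edges. The eastern end satisfies the mirror-image conditions with white decorations, and no other $\bullet$ or $\circ$ occurs on $d$. A $\mathcal Z$-diagram is an admissible diagram $d$ with $\mathbf a(d)=1$ having at least one $\blacktriangle$ on the first (leftmost) propagating edge and at least one $\vartriangle$ on the last propagating edge. $\mathtt{dec}_Z$. Let $\tilde w\in(\mathrm{ZZ})\cup(\mathrm{PZZ})$, with first letter $\tilde s_i$ and last letter $\tilde s_j$. Start from $d_{\tau(\tilde w)}$. Add a $\blacktriangle$ (resp. $\vartriangle$) on the first (resp. last) propagating edge, from the left, for each occurrence of $\tilde s_1$ (resp. $\tilde s_{n+1}$) in $H(\tilde w)$. If $\tilde s_i=\tilde s_1$ (resp. $\tilde s_{n+1}$), replace the highest $\blacktriangle$ on the first (resp. highest $\vartriangle$ on the last) propagating edge by a $\bullet$ (resp. $\circ$) and add a $\bullet$ to the edge $(1,2)$ (resp. a $\circ$ to $(n+1,n+2)$). If $\tilde s_j=\tilde s_1$ (resp. $\tilde s_{n+1}$), replace the lowest $\blacktriangle$ on the first (resp. lowest $\vartriangle$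 on the last) propagating edge by a $\bullet$ (resp. $\circ$) and add a $\bullet$ to the edge $(1',2')$ (resp. a $\circ$ to $((n+1)',(n+2)')$). Give the black and white decorations on propagating edges vertical positions compatible with the relative order of the corresponding nodes labeled $\tilde s_1$ and $\tilde s_{n+1}$ in $H(\tilde w)$. The result is $\mathtt{dec}_Z(\tilde w)$. *)

theory Defs
  imports
    "HOL-Library.Multiset"
    "HOL-Library.Poly_Mapping"
    "HOL-Computational_Algebra.Polynomial"
begin

section \<open>Coxeter groups and fully commutative elements\<close>

text \<open>
  A Coxeter group is given by its generating set \<open>S\<close> and its Coxeter matrix \<open>m\<close> (all entries
  finite here). Its elements are the classes of words in \<open>S\<close> modulo \<open>(s t)\<^sup>m\<^sup>(\<^sup>s\<^sup>,\<^sup>t\<^sup>) = 1\<close>,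
  with \<open>m s s = 1\<close>; so the members of a class are precisely the expressions of that element.
\<close>

inductive cox_eq :: "nat set \<Rightarrow> (nat \<Rightarrow> nat \<Rightarrow> nat) \<Rightarrow> nat list \<Rightarrow> nat list \<Rightarrow> bool"
  for S m where
  refl: "cox_eq S m u u"
| sym: "cox_eq S m u v \<Longrightarrow> cox_eq S m v u"
| trans: "cox_eq S m u v \<Longrightarrow> cox_eq S m v w \<Longrightarrow> cox_eq S m u w"
| rel: "s \<in> S \<Longrightarrow> t \<in> S \<Longrightarrow> u \<in> lists S \<Longrightarrow> v \<in> lists S \<Longrightarrow>
    cox_eq S m (u @ concat (replicate (m s t) [s, t]) @ v) (u @ v)"

definition cox_group :: "nat set \<Rightarrow> (nat \<Rightarrow> nat \<Rightarrow> nat) \<Rightarrow> nat list set set" where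
  "cox_group S m = lists S // {(u, v). u \<in> lists S \<and> v \<in> lists S \<and> cox_eq S m u v}"

definition reduced_expr :: "nat list set \<Rightarrow> nat list \<Rightarrow> bool" where
  "reduced_expr w u \<longleftrightarrow> u \<in> w \<and> (\<forall>v\<in>w. length u \<le> length v)"

inductive commutation :: "(nat \<Rightarrow> nat \<Rightarrow> nat) \<Rightarrow> nat list \<Rightarrow> nat list \<Rightarrow> bool" for m where
  "m s t = 2 \<Longrightarrow> commutation m (u @ [s, t] @ v) (u @ [t, s] @ v)"

definition FC :: "nat set \<Rightarrow> (nat \<Rightarrow> nat \<Rightarrow> nat) \<Rightarrow> nat list set set" where
  "FC S m = {w \<in> cox_group S m.
     \<forall>u v. reduced_expr w u \<and> reduced_expr w v \<longrightarrow> (commutation m)\<^sup>*\<^sup>* u v}"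

definition m_A :: "nat \<Rightarrow> nat \<Rightarrow> nat" where
  "m_A i j = (if i = j then 1 else if j = i + 1 \<or> i = j + 1 then 3 else 2)"

definition m_C :: "nat \<Rightarrow> nat \<Rightarrow> nat \<Rightarrow> nat" where
  "m_C n i j =
    (if i = j then 1
     else if j = i + 1 \<or> i = j + 1 then (if {i, j} = {1, 2} \<or> {i, j} = {n, n + 1} then 4 else 3)
     else 2)"

definition FC_A :: "nat \<Rightarrow> nat list set set" where
  "FC_A n = FC {1..n+1} m_A"

definition FC_C :: "nat \<Rightarrow> nat list set set" where
  "FC_C n = FC {1..n+1} (m_C n)"

text \<open>
  For a fully commutative element the constructions below do not depend on the reduced expression;
  the elements of \<open>(ZZ)\<close> and \<open>(PZZ)\<close> have in fact only one.
\<close>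

definition red_expr :: "nat list set \<Rightarrow> nat list" where
  "red_expr w = (SOME u. reduced_expr w u)"

text \<open>Strict order of the heap of a reduced expression; heap nodes are 0-based positions.\<close>

definition heap :: "(nat \<Rightarrow> nat \<Rightarrow> nat) \<Rightarrow> nat list \<Rightarrow> (nat \<times> nat) set" where
  "heap m u = {(i, j). i < j \<and> j < length u \<and> m (u ! i) (u ! j) \<ge> 3}\<^sup>+"

subsection \<open>The zigzag families\<close>

definition zz_period :: "nat \<Rightarrow> nat list" where
  "zz_period n = [1..<n+2] @ rev [2..<n+1]"

definition zz_factor :: "nat \<Rightarrow> nat list \<Rightarrow> bool" where
  "zz_factor n u \<longleftrightarrow>
    (\<exists>k l. u = map (\<lambda>r. zz_period n ! (r mod length (zz_period n))) [k..<k + l])"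

definition ZZ :: "nat \<Rightarrow> nat list set set" where
  "ZZ n = {w \<in> FC_C n. \<exists>u. reduced_expr w u \<and> zz_factor n u \<and>
     (\<exists>i\<in>{2..n}. count_list u i \<ge> 3)}"

definition PZZ :: "nat \<Rightarrow> nat list set set" where
  "PZZ n = {w \<in> FC_C n. \<exists>u. reduced_expr w u \<and> zz_factor n u \<and>
     (\<exists>p q. u = p @ [2, 1, 2] @ q) \<and> (\<exists>p q. u = p @ [n, n + 1, n] @ q) \<and>
     (\<forall>i\<in>{2..n}. count_list u i < 3)}"

section \<open>Decorated diagrams\<close>

datatype node = North nat | South nat

fun idx :: "node \<Rightarrow> nat" where
  "idx (North i) = i"
| "idx (South i) = i"

fun is_north :: "node \<Rightarrow> bool" where
  "is_north (North i) = True"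
| "is_north (South i) = False"

text \<open>
  An edge is stored as the pair of its end points in the order in which its decorations are read:
  from north to south if it is propagating, from left to right otherwise.
\<close>

type_synonym edge = "node \<times> node"

definition precedes :: "node \<Rightarrow> node \<Rightarrow> bool" where
  "precedes p q \<longleftrightarrow> is_north p \<and> \<not> is_north q \<or> is_north p = is_north q \<and> idx p < idx q"

definition propagating :: "edge \<Rightarrow> bool" where
  "propagating e \<longleftrightarrow> is_north (fst e) \<noteq> is_north (snd e)"

text \<open>Black: \<open>Bul\<close>, \<open>BTri\<close>; white: \<open>Circ\<close>, \<open>WTri\<close>.\<close>

datatype dec = Bul | BTri | Circ | WTri

definition black :: "dec \<Rightarrow> bool" where
  "black c \<longleftrightarrow> c = Bul \<or> c = BTri"

text \<open>
  Isotopy classes of diagrams, encoded combinatorially. \<open>block d e\<close> is the word on an edge whose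
  decorations form a single block. If \<open>a d = 1\<close>, the decorations on propagating edges are instead
  recorded by \<open>vert d\<close>, the list of all of them from top to bottom, each with the edge carrying it.
  The blocks are then the maximal runs in \<open>vert d\<close> of decorations on one and the same edge: a
  decoration on another edge splits a word into blocks, and otherwise adjacent blocks are conjoined.
  \<open>loops d\<close> collects the words on the loops (each read from some starting point in some
  direction, see \<open>loop_iso\<close>); undecorated loops have the empty word. The position of a loop relative
  to the edges is not recorded.
\<close>

record ddiag =
  edges :: "edge set"
  block :: "edge \<Rightarrow> dec list"
  vert :: "(edge \<times> dec) list"
  loops :: "dec list multiset"

definition aval_edges :: "edge set \<Rightarrow> nat" where
  "aval_edges E = card {e \<in> E. is_north (fst e) \<and> is_north (snd e)}"

definition aval :: "ddiag \<Rightarrow> nat" where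
  "aval d = aval_edges (edges d)"

definition word :: "ddiag \<Rightarrow> edge \<Rightarrow> dec list" where
  "word d e = block d e @ map snd (filter (\<lambda>x. fst x = e) (vert d))"

text \<open>The propagating edges, from left to right.\<close>

definition prop_list :: "edge set \<Rightarrow> edge list" where
  "prop_list E = map (\<lambda>i. (North i, THE q. (North i, q) \<in> E))
     (sorted_list_of_set {i. \<exists>j. (North i, South j) \<in> E})"

definition first_prop :: "ddiag \<Rightarrow> edge" where
  "first_prop d = hd (prop_list (edges d))"

definition last_prop :: "ddiag \<Rightarrow> edge" where
  "last_prop d = last (prop_list (edges d))"

subsection \<open>Well-formedness\<close>

text \<open>
  Positions of the nodes on the boundary of the box, cut open at the left wall, respectively at the
  right wall (and then run through in the opposite direction).
\<close>

fun pos_left :: "nat \<Rightarrow> node \<Rightarrow> nat" where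
  "pos_left n (North i) = i"
| "pos_left n (South i) = 2 * (n + 2) + 1 - i"

fun pos_right :: "nat \<Rightarrow> node \<Rightarrow> nat" where
  "pos_right n (North i) = n + 3 - i"
| "pos_right n (South i) = n + 2 + i"

definition lo :: "(node \<Rightarrow> nat) \<Rightarrow> edge \<Rightarrow> nat" where
  "lo pos e = min (pos (fst e)) (pos (snd e))"

definition hi :: "(node \<Rightarrow> nat) \<Rightarrow> edge \<Rightarrow> nat" where
  "hi pos e = max (pos (fst e)) (pos (snd e))"

definition nodes :: "nat \<Rightarrow> node set" where
  "nodes n = North ` {1..n+2} \<union> South ` {1..n+2}"

definition planar_matching :: "nat \<Rightarrow> edge set \<Rightarrow> bool" where
  "planar_matching n E \<longleftrightarrow>
     (\<forall>(p, q)\<in>E. p \<in> nodes n \<and> q \<in> nodes n \<and> precedes p q) \<and>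
     (\<forall>p\<in>nodes n. \<exists>!e. e \<in> E \<and> (p = fst e \<or> p = snd e)) \<and>
     (\<forall>e\<in>E. \<forall>f\<in>E. \<not> (lo (pos_left n) e < lo (pos_left n) f \<and>
        lo (pos_left n) f < hi (pos_left n) e \<and> hi (pos_left n) e < hi (pos_left n) f))"

text \<open>
  With \<open>pos\<close> the positions seen from a wall: no edge separates \<open>e\<close> from that wall.
\<close>

definition exposed :: "(node \<Rightarrow> nat) \<Rightarrow> edge set \<Rightarrow> edge \<Rightarrow> bool" where
  "exposed pos E e \<longleftrightarrow> \<not> (\<exists>f\<in>E. lo pos f < lo pos e \<and> hi pos e < hi pos f)"

text \<open>
  Simultaneous deformability of the decorated edges to the walls. Besides exposure of each decorated
  edge, a white decoration on a non-propagating edge must not lie to the left of a black one on the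
  same face: bringing it to the right wall would cut off the latter from the left wall. This, and the
  condition on loops carrying both colours, only matters if there are no propagating edges.
\<close>

definition black_then_white :: "dec list \<Rightarrow> bool" where
  "black_then_white w \<longleftrightarrow> (\<exists>u v. w = u @ v \<and> (\<forall>c\<in>set u. black c) \<and> (\<forall>c\<in>set v. \<not> black c))"

definition deformable :: "nat \<Rightarrow> ddiag \<Rightarrow> bool" where
  "deformable n d \<longleftrightarrow>
     (\<forall>e\<in>edges d. \<forall>c\<in>set (word d e).
        exposed (if black c then pos_left n else pos_right n) (edges d) e) \<and>
     (\<forall>e\<in>edges d. \<not> propagating e \<longrightarrow> black_then_white (word d e)) \<and>
     (\<forall>e\<in>edges d. \<forall>f\<in>edges d. \<not> propagating e \<and> \<not> propagating f \<and>
        is_north (fst e) = is_north (fst f) \<and> idx (fst e) < idx (fst f) \<longrightarrow>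
        \<not> ((\<exists>c\<in>set (word d e). \<not> black c) \<and> (\<exists>c\<in>set (word d f). black c))) \<and>
     (\<forall>w\<in>#loops d. (\<exists>k. black_then_white (rotate k w)) \<and>
        ((\<exists>c\<in>set w. black c) \<and> (\<exists>c\<in>set w. \<not> black c) \<longrightarrow> (\<forall>e\<in>edges d. \<not> propagating e)))"

definition decorated :: "nat \<Rightarrow> ddiag \<Rightarrow> bool" where
  "decorated n d \<longleftrightarrow>
     planar_matching n (edges d) \<and>
     (\<forall>e. block d e \<noteq> [] \<longrightarrow> e \<in> edges d) \<and>
     (aval d = 0 \<longrightarrow> (\<forall>e. block d e = []) \<and> (\<forall>w\<in>#loops d. w = [])) \<and>
     (if aval d = 1
      then (\<forall>e. propagating e \<longrightarrow> block d e = []) \<and>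
           (\<forall>(e, c)\<in>set (vert d). e \<in> edges d \<and> propagating e)
      else vert d = []) \<and>
     deformable n d"

subsection \<open>Concatenation\<close>

text \<open>
  A step \<open>(b, p, q)\<close> runs along an edge of the upper (\<open>b = True\<close>) or lower diagram from \<open>p\<close> to \<open>q\<close>,
  with or against the reading direction. The \<open>i\<close>-th south node of the upper diagram \<open>x\<close> is glued to
  the \<open>i\<close>-th north node of the lower diagram \<open>y\<close>.
\<close>

type_synonym step = "bool \<times> node \<times> node"

definition trav :: "ddiag \<Rightarrow> edge \<Rightarrow> dec list" where
  "trav d e = (if e \<in> edges d then word d e else rev (word d (snd e, fst e)))"

fun linked :: "step \<Rightarrow> step \<Rightarrow> bool" where
  "linked (b, p, q) (b', p', q') \<longleftrightarrow>
     b \<and> \<not> b' \<and> (\<exists>i. q = South i \<and> p' = North i) \<or>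
     \<not> b \<and> b' \<and> (\<exists>i. q = North i \<and> p' = South i)"

definition walk :: "ddiag \<Rightarrow> ddiag \<Rightarrow> step list \<Rightarrow> bool" where
  "walk x y ws \<longleftrightarrow> ws \<noteq> [] \<and> successively linked ws \<and>
     (\<forall>(b, p, q)\<in>set ws. let E = edges (if b then x else y) in (p, q) \<in> E \<or> (q, p) \<in> E)"

definition walk_word :: "ddiag \<Rightarrow> ddiag \<Rightarrow> step list \<Rightarrow> dec list" where
  "walk_word x y ws = concat (map (\<lambda>(b, e). trav (if b then x else y) e) ws)"

definition start_of :: "step list \<Rightarrow> node" where
  "start_of ws = fst (snd (hd ws))"

definition end_of :: "step list \<Rightarrow> node" where
  "end_of ws = snd (snd (last ws))"

text \<open>Walks between two nodes on the faces of the product, in reading direction.\<close>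

definition strand :: "ddiag \<Rightarrow> ddiag \<Rightarrow> step list \<Rightarrow> bool" where
  "strand x y ws \<longleftrightarrow> walk x y ws \<and>
     fst (hd ws) = is_north (start_of ws) \<and> fst (last ws) = is_north (end_of ws) \<and>
     precedes (start_of ws) (end_of ws)"

definition cat_edges :: "ddiag \<Rightarrow> ddiag \<Rightarrow> edge set" where
  "cat_edges x y = {(start_of ws, end_of ws) | ws. strand x y ws}"

definition strand_of :: "ddiag \<Rightarrow> ddiag \<Rightarrow> edge \<Rightarrow> step list" where
  "strand_of x y e = (THE ws. strand x y ws \<and> (start_of ws, end_of ws) = e)"

text \<open>
  New loops. Each one is represented once: it starts at its leftmost glued node and runs into the
  upper diagram.
\<close>

definition new_loops :: "ddiag \<Rightarrow> ddiag \<Rightarrow> step list set" where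
  "new_loops x y = {ws. walk x y ws \<and> linked (last ws) (hd ws) \<and> distinct ws \<and> fst (hd ws) \<and>
     (\<forall>(b, p, q)\<in>set ws. idx (start_of ws) \<le> idx p)}"

text \<open>
  Vertical list of the product if it still has \<open>a = 1\<close>: the decorations on propagating edges of
  \<open>x\<close>, then those stemming from the south non-propagating edge of \<open>x\<close> and the north one of \<open>y\<close> (they
  lie in at most one propagating edge of the product), then those on propagating edges of \<open>y\<close>.
\<close>

definition host :: "ddiag \<Rightarrow> ddiag \<Rightarrow> bool \<Rightarrow> edge \<Rightarrow> edge" where
  "host x y b f = (THE e. e \<in> cat_edges x y \<and> (b, f) \<in> set (strand_of x y e))"

definition cat_vert :: "ddiag \<Rightarrow> ddiag \<Rightarrow> (edge \<times> dec) list" where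
  "cat_vert x y =
     map (\<lambda>(f, c). (host x y True f, c)) (vert x) @
     concat (map (\<lambda>e. map (Pair e)
         (walk_word x y (filter (\<lambda>(b, f). \<not> propagating f) (strand_of x y e))))
       (prop_list (cat_edges x y))) @
     map (\<lambda>(f, c). (host x y False f, c)) (vert y)"

definition cat :: "ddiag \<Rightarrow> ddiag \<Rightarrow> ddiag" where
  "cat x y =
     (let E = cat_edges x y; one = (aval_edges E = 1) in
      \<lparr>edges = E,
       block = (\<lambda>e. if e \<in> E \<and> \<not> (one \<and> propagating e) then walk_word x y (strand_of x y e) else []),
       vert = (if one then cat_vert x y else []),
       loops = loops x + loops y + image_mset (walk_word x y) (mset_set (new_loops x y))\<rparr>)"

subsection \<open>Simple diagrams\<close>

definition ident :: "nat \<Rightarrow> ddiag" where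
  "ident n = \<lparr>edges = {(North j, South j) | j. j \<in> {1..n+2}},
     block = (\<lambda>e. []), vert = [], loops = {#}\<rparr>"

definition simple :: "nat \<Rightarrow> nat \<Rightarrow> ddiag" where
  "simple n i = \<lparr>edges = {(North i, North (i+1)), (South i, South (i+1))} \<union>
       {(North j, South j) | j. j \<in> {1..n+2} - {i, i+1}},
     block = (\<lambda>e. []), vert = [], loops = {#}\<rparr>"

definition dsimple :: "nat \<Rightarrow> nat \<Rightarrow> ddiag" where
  "dsimple n i = (simple n i)\<lparr>block := (\<lambda>e.
     if e \<in> {(North i, North (i+1)), (South i, South (i+1))}
     then if i = 1 then [Bul] else if i = n + 1 then [Circ] else []
     else [])\<rparr>"

section \<open>The algebra generated by the decorated simple diagrams\<close>

fun fuse :: "dec \<Rightarrow> dec \<Rightarrow> (int \<times> dec) option" where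
  "fuse Bul Bul = Some (1, BTri)"
| "fuse Bul BTri = Some (2, Bul)"
| "fuse BTri Bul = Some (2, Bul)"
| "fuse Circ Circ = Some (1, WTri)"
| "fuse Circ WTri = Some (2, Circ)"
| "fuse WTri Circ = Some (2, Circ)"
| "fuse _ _ = None"

text \<open>\<open>drel d p d'\<close>: a defining relation applies to \<open>d\<close>, reading \<open>d = p d'\<close>; \<open>[:0, 1:]\<close> is \<open>\<delta>\<close>.\<close>

inductive drel :: "ddiag \<Rightarrow> int poly \<Rightarrow> ddiag \<Rightarrow> bool" where
  block: "fuse a b = Some (k, c) \<Longrightarrow> block d e = u @ [a, b] @ v \<Longrightarrow>
    drel d [:k:] (d\<lparr>block := (block d)(e := u @ [c] @ v)\<rparr>)"
| vert: "fuse a b = Some (k, c) \<Longrightarrow> vert d = u @ [(e, a), (e, b)] @ v \<Longrightarrow>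
    drel d [:k:] (d\<lparr>vert := u @ [(e, c)] @ v\<rparr>)"
| loop: "fuse a b = Some (k, c) \<Longrightarrow> loops d = add_mset w L \<Longrightarrow> rotate j w = [a, b] @ v \<Longrightarrow>
    drel d [:k:] (d\<lparr>loops := add_mset (c # v) L\<rparr>)"
| remove: "loops d = add_mset w L \<Longrightarrow> w \<in> {[], [BTri], [WTri]} \<Longrightarrow>
    drel d [:0, 1:] (d\<lparr>loops := L\<rparr>)"

text \<open>Changing the starting point or the direction in which a loop is read gives the same diagram.\<close>

inductive loop_iso :: "ddiag \<Rightarrow> ddiag \<Rightarrow> bool" where
  "loops d = add_mset w L \<Longrightarrow> w' = rotate j w \<or> w' = rev w \<Longrightarrow>
    loop_iso d (d\<lparr>loops := add_mset w' L\<rparr>)"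

text \<open>Formal \<open>\<int>[\<delta>]\<close>-linear combinations of diagrams, with concatenation extended bilinearly.\<close>

type_synonym comb = "ddiag \<Rightarrow>\<^sub>0 int poly"

definition cmult :: "comb \<Rightarrow> comb \<Rightarrow> comb" where
  "cmult x y = (\<Sum>a\<in>Poly_Mapping.keys x. \<Sum>b\<in>Poly_Mapping.keys y.
     Poly_Mapping.single (cat a b) (Poly_Mapping.lookup x a * Poly_Mapping.lookup y b))"

text \<open>The submodule of combinations which are zero in the quotient by the relations.\<close>

inductive_set null_combs :: "nat \<Rightarrow> comb set" for n where
  zero: "0 \<in> null_combs n"
| rel: "x \<in> null_combs n \<Longrightarrow> decorated n d \<Longrightarrow> drel d p d' \<Longrightarrow>
    x + (Poly_Mapping.single d r - Poly_Mapping.single d' (r * p)) \<in> null_combs n"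
| iso: "x \<in> null_combs n \<Longrightarrow> decorated n d \<Longrightarrow> loop_iso d d' \<Longrightarrow>
    x + (Poly_Mapping.single d r - Poly_Mapping.single d' r) \<in> null_combs n"

text \<open>
  The combinations whose class modulo the relations lies in the algebra \<open>\<bbbD>\<close> generated by the
  decorated simple diagrams, that is, the preimage of \<open>\<bbbD>\<close> in the module of formal combinations.
\<close>

inductive_set D_alg :: "nat \<Rightarrow> comb set" for n where
  one: "Poly_Mapping.single (ident n) 1 \<in> D_alg n"
| gen: "i \<in> {1..n+1} \<Longrightarrow> Poly_Mapping.single (dsimple n i) 1 \<in> D_alg n"
| add: "x \<in> D_alg n \<Longrightarrow> y \<in> D_alg n \<Longrightarrow> x + y \<in> D_alg n"
| scale: "x \<in> D_alg n \<Longrightarrow> Poly_Mapping.map ((*) r) x \<in> D_alg n"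
| mult: "x \<in> D_alg n \<Longrightarrow> y \<in> D_alg n \<Longrightarrow> cmult x y \<in> D_alg n"
| cong: "x \<in> D_alg n \<Longrightarrow> x - y \<in> null_combs n \<Longrightarrow> y \<in> D_alg n"

definition in_D :: "nat \<Rightarrow> ddiag \<Rightarrow> bool" where
  "in_D n d \<longleftrightarrow> Poly_Mapping.single d 1 \<in> D_alg n"

section \<open>Admissible diagrams with \<open>a = 1\<close> and Z-diagrams\<close>

fun runs :: "(edge \<times> dec) list \<Rightarrow> (edge \<times> dec list) list" where
  "runs [] = []"
| "runs ((e, c) # xs) =
    (case runs xs of
       [] \<Rightarrow> [(e, [c])]
     | (e', w) # bs \<Rightarrow> if e = e' then (e, c # w) # bs else (e, [c]) # (e', w) # bs)"

definition prop_blocks :: "ddiag \<Rightarrow> edge \<Rightarrow> dec list list" where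
  "prop_blocks d e = map snd (filter (\<lambda>x. fst x = e) (runs (vert d)))"

text \<open>The multiset of all decorations occurring on a diagram.\<close>

definition decs :: "ddiag \<Rightarrow> dec multiset" where
  "decs d = (\<Sum>e\<in>edges d. mset (block d e)) + mset (map snd (vert d)) + (\<Sum>w\<in>#loops d. mset w)"

text \<open>
  The five possible shapes (a)--(e) of one end of an admissible diagram. For the western end
  \<open>en = (1,2)\<close>, \<open>es = (1',2')\<close>, \<open>i = 1\<close>, \<open>k = 3\<close>; the eastern end is its mirror image. The last clause
  of each shape says that no further decoration \<open>dot\<close> (in (b): no further decoration at all) occurs.
\<close>

definition end_shape :: "ddiag \<Rightarrow> edge \<Rightarrow> edge \<Rightarrow> nat \<Rightarrow> nat \<Rightarrow> dec \<Rightarrow> dec \<Rightarrow> bool" where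
  "end_shape d en es i k dot tri \<longleftrightarrow>
     ((North i, South i) \<in> edges d \<and>
      (\<exists>r. prop_blocks d (North i, South i) = replicate r [tri]) \<and>
      count (decs d) dot = 0)
   \<or> (en \<in> edges d \<and> block d en = [dot] \<and> es \<in> edges d \<and> block d es = [dot] \<and>
      (North k, South k) \<in> edges d \<and>
      (prop_blocks d (North k, South k) = [] \<and> decs d = {#dot, dot#} \<or>
       prop_blocks d (North k, South k) = [[tri]] \<and> decs d = {#dot, dot, tri#}))
   \<or> (en \<in> edges d \<and> block d en = [dot] \<and> (North k, South i) \<in> edges d \<and>
      (\<exists>r. prop_blocks d (North k, South i) = [dot] # replicate r [tri]) \<and>
      hd (vert d) = ((North k, South i), dot) \<and>
      count (decs d) dot = 2)
   \<or> (es \<in> edges d \<and> block d es = [dot] \<and> (North i, South k) \<in> edges d \<and>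
      (\<exists>r. prop_blocks d (North i, South k) = replicate r [tri] @ [[dot]]) \<and>
      last (vert d) = ((North i, South k), dot) \<and>
      count (decs d) dot = 2)
   \<or> (en \<in> edges d \<and> block d en = [dot] \<and> es \<in> edges d \<and> block d es = [dot] \<and>
      (North k, South k) \<in> edges d \<and>
      (\<exists>r. prop_blocks d (North k, South k) = [dot] # replicate r [tri] @ [[dot]]) \<and>
      hd (vert d) = ((North k, South k), dot) \<and> last (vert d) = ((North k, South k), dot) \<and>
      count (decs d) dot = 4)"

definition admissible1 :: "nat \<Rightarrow> ddiag \<Rightarrow> bool" where
  "admissible1 n d \<longleftrightarrow>
     decorated n d \<and> aval d = 1 \<and> (\<nexists>p d'. drel d p d') \<and>
     (\<forall>w\<in>#loops d. w = [BTri, WTri] \<or> w = [WTri, BTri]) \<and>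
     end_shape d (North 1, North 2) (South 1, South 2) 1 3 Bul BTri \<and>
     end_shape d (North (n+1), North (n+2)) (South (n+1), South (n+2)) (n+2) n Circ WTri"

definition Z_diagram :: "nat \<Rightarrow> ddiag \<Rightarrow> bool" where
  "Z_diagram n d \<longleftrightarrow> admissible1 n d \<and>
     (first_prop d, BTri) \<in> set (vert d) \<and> (last_prop d, WTri) \<in> set (vert d)"

section \<open>The map \<open>dec\<^sub>Z\<close>\<close>

definition diag_prod :: "nat \<Rightarrow> nat list \<Rightarrow> ddiag" where
  "diag_prod n u = foldr cat (map (simple n) u) (ident n)"

definition diag_A :: "nat \<Rightarrow> nat list set \<Rightarrow> ddiag" where
  "diag_A n x = diag_prod n (red_expr x)"

text \<open>The factor \<open>\<delta>\<^sup>\<alpha>\<close> corresponds to \<open>\<alpha>\<close> undecorated loops.\<close>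

definition tau :: "nat \<Rightarrow> nat list set \<Rightarrow> nat list set" where
  "tau n w = (SOME x. x \<in> FC_A n \<and>
     (\<exists>\<alpha>. diag_prod n (red_expr w) =
       (diag_A n x)\<lparr>loops := loops (diag_A n x) + replicate_mset \<alpha> []\<rparr>))"

fun replace_first :: "'a \<Rightarrow> 'a \<Rightarrow> 'a list \<Rightarrow> 'a list" where
  "replace_first x y [] = []"
| "replace_first x y (z # zs) = (if z = x then y # zs else z # replace_first x y zs)"

definition replace_last :: "'a \<Rightarrow> 'a \<Rightarrow> 'a list \<Rightarrow> 'a list" where
  "replace_last x y zs = rev (replace_first x y (rev zs))"

definition add_dec :: "edge \<Rightarrow> dec \<Rightarrow> ddiag \<Rightarrow> ddiag" where
  "add_dec e c d = d\<lparr>block := (block d)(e := block d e @ [c])\<rparr>"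

text \<open>Adjustments at the top for the first letter \<open>s\<close>, and at the bottom for the last letter \<open>s\<close>.\<close>

definition adjust_top :: "nat \<Rightarrow> nat \<Rightarrow> ddiag \<Rightarrow> ddiag" where
  "adjust_top n s d =
     (if s = 1 then
        add_dec (North 1, North 2) Bul
          (d\<lparr>vert := replace_first (first_prop d, BTri) (first_prop d, Bul) (vert d)\<rparr>)
      else if s = n + 1 then
        add_dec (North (n+1), North (n+2)) Circ
          (d\<lparr>vert := replace_first (last_prop d, WTri) (last_prop d, Circ) (vert d)\<rparr>)
      else d)"

definition adjust_bottom :: "nat \<Rightarrow> nat \<Rightarrow> ddiag \<Rightarrow> ddiag" where
  "adjust_bottom n s d =
     (if s = 1 then
        add_dec (South 1, South 2) Bul
          (d\<lparr>vert := replace_last (first_prop d, BTri) (first_prop d, Bul) (vert d)\<rparr>)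
      else if s = n + 1 then
        add_dec (South (n+1), South (n+2)) Circ
          (d\<lparr>vert := replace_last (last_prop d, WTri) (last_prop d, Circ) (vert d)\<rparr>)
      else d)"

text \<open>The heap nodes labelled by the first or last generator, from top to bottom.\<close>

definition end_nodes :: "nat \<Rightarrow> nat list \<Rightarrow> nat list" where
  "end_nodes n u = (THE ks. set ks = {k. k < length u \<and> u ! k \<in> {1, n+1}} \<and>
     sorted_wrt (\<lambda>i j. (i, j) \<in> heap (m_C n) u) ks)"

definition dec_Z :: "nat \<Rightarrow> nat list set \<Rightarrow> ddiag" where
  "dec_Z n w =
     (let u = red_expr w; d = diag_A n (tau n w);
          d' = d\<lparr>vert := map (\<lambda>k. if u ! k = 1 then (first_prop d, BTri) else (last_prop d, WTri))
                            (end_nodes n u)\<rparr>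
      in adjust_bottom n (last u) (adjust_top n (hd u) d'))"

end

theory Submission
  imports Defs
begin

text \<open>
  Label the edges of a line periodically by the letters of the infinite zigzag word and let every
  generator swap the two ends of each edge carrying its label. This is an action of the Coxeter group,
  and a zigzag word of length \<open>l\<close> moves a suitable point by \<open>l\<close>. A letter moves a point by at most one
  step, so any other expression of the same element is longer: a zigzag word is the only reduced
  expression of its element, which is therefore fully commutative. The same argument on a path
  handles the words \<open>i, i \<plusminus> 1, \<dots>, k\<close> in type \<open>A\<close>.

  Concatenating simple diagrams along a word whose neighbouring letters are adjacent never produces
  a loop, and gives the diagram with a single cup on each face, whose positions are the first and the
  last letter. Doing the same with the decorated simple diagrams, each inner \<open>1\<close> leaves two adjacent
  \<open>\<bullet>\<close> on the first propagating edge, which fuse to \<open>\<triangle>\<close> with coefficient 1, and likewise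
  for \<open>n + 1\<close>; so \<open>dec\<^sub>Z\<close> of the word is, modulo the relations, a monomial in the generators.

  Conversely a Z-diagram is determined by the positions of its two cups and the alternating sequence
  of black and white decorations on its outer propagating edges. This sequence tells which walls a
  zigzag word has to hit, the cups tell where it has to start and stop.
\<close>

section \<open>Unique reduced expressions\<close>

text \<open>Three choices are built into the map: \<open>red_expr\<close> and \<open>tau\<close>
  pick by \<open>SOME\<close>, \<open>end_nodes\<close> by \<open>THE\<close>. On zigzag words none
  of them matters: the reduced expression is unique, every candidate for \<open>tau\<close> has the
  same diagram because the product creates no loop, and the heap is a chain. (ZZ) and (PZZ) then
  merge into one family, the zigzag words with both wall letters \<open>1\<close> and
  \<open>n + 1\<close> strictly inside. An inner wall letter gives a triangle, an end one a dot, so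
  this matches the demand of a Z-diagram for a triangle of each colour. The obstacle is
  concatenation, which is defined through all walks in two glued diagrams. It is therefore computed
  only for a generator placed on top, with an adjacent cup or the identity below, and every diagram
  that occurs is kept in the normal form \<open>cup_diag\<close>. Relations may be applied to
  well-formed diagrams only, so the intermediate products have to be shown planar and
  deformable.\<close>

definition cross :: "(int \<Rightarrow> nat) \<Rightarrow> nat \<Rightarrow> int \<Rightarrow> int" where
  "cross lab s x = (if lab x = s then x + 1 else if lab (x - 1) = s then x - 1 else x)"

lemma cross_le: "cross lab s x \<le> x + 1"
  by (auto simp: cross_def)

lemma fold_cross_le: "fold (cross lab) v x \<le> x + int (length v)"
proof (induction v arbitrary: x)
  case (Cons s v)
  have "fold (cross lab) (s # v) x \<le> cross lab s x + int (length v)" using Cons by simp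
  also have "\<dots> \<le> x + 1 + int (length v)" using cross_le[of lab s x] by simp
  finally show ?case by simp
qed simp

lemma cross_up: "cross lab s x = x + 1 \<Longrightarrow> s = lab x"
  by (auto simp: cross_def split: if_splits)

text \<open>A displacement equal to the length leaves no slack: every letter moves the point up by
  one, hence is the label of the edge crossed, \<open>lab x\<close> being the label of the edge from
  \<open>x\<close> to \<open>x + 1\<close>.\<close>

lemma fold_cross_eq:
  "fold (cross lab) v x = x + int (length v) \<Longrightarrow> v = map (\<lambda>r. lab (x + int r)) [0..<length v]"
proof (induction v arbitrary: x)
  case (Cons s v)
  have le: "x + 1 + int (length v) \<le> cross lab s x + int (length v)"
    using Cons.prems fold_cross_le[of lab v "cross lab s x"] by simp
  hence up: "cross lab s x = x + 1" using cross_le[of lab s x] by simp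
  hence s: "s = lab x" by (rule cross_up)
  have "v = map (\<lambda>r. lab (x + 1 + int r)) [0..<length v]"
    using Cons.prems up by (intro Cons.IH) simp
  hence "v = map (\<lambda>r. lab (x + int r)) (map Suc [0..<length v])"
    by (simp add: o_def algebra_simps)
  thus ?case using s upt_conv_Cons[of 0 "Suc (length v)"] by (simp add: map_Suc_upt)
qed simp

lemma fold_cross_labels:
  "fold (cross lab) (map (\<lambda>r. lab (x + int r)) [0..<l]) x = x + int l"
  by (induction l) (auto simp: cross_def)

text \<open>
  The last condition, the Coxeter relations for \<open>cross\<close>, holds if the edges of the line with label
  \<open>s\<close> or \<open>t\<close> form paths with \<open>m s t - 1\<close> edges; this is how it is verified below.
\<close>

definition coxeter_labelling :: "nat set \<Rightarrow> (nat \<Rightarrow> nat \<Rightarrow> nat) \<Rightarrow> (int \<Rightarrow> nat) \<Rightarrow> bool" where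
  "coxeter_labelling S m lab \<longleftrightarrow>
     (\<forall>x. lab x \<in> S \<longrightarrow> lab (x + 1) \<noteq> lab x) \<and>
     (\<forall>s\<in>S. \<forall>t\<in>S. fold (cross lab) (concat (replicate (m s t) [s, t])) = id)"

text \<open>Only the defining relation needs an argument; congruence is built into
  \<open>rel\<close> by the context \<open>u\<close>, \<open>v\<close>.\<close>

lemma cox_eq_fold_cross:
  assumes "coxeter_labelling S m lab" "cox_eq S m u v"
  shows "fold (cross lab) u = fold (cross lab) v"
  using assms(2)
proof induction
  case (rel s t u v)
  thus ?case using assms(1) by (simp add: coxeter_labelling_def)
qed auto

definition cox_class :: "nat set \<Rightarrow> (nat \<Rightarrow> nat \<Rightarrow> nat) \<Rightarrow> nat list \<Rightarrow> nat list set" where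
  "cox_class S m u = {v \<in> lists S. cox_eq S m u v}"

lemma cox_group_eq: "cox_group S m = cox_class S m ` lists S"
  by (auto simp: cox_group_def cox_class_def quotient_def Image_def)

lemma cox_group_eq_class:
  assumes "w \<in> cox_group S m" "u \<in> w"
  shows "w = cox_class S m u" "u \<in> lists S"
  using assms by (auto simp: cox_group_eq cox_class_def intro: cox_eq.intros)

lemma labelled_word_unique:
  assumes "coxeter_labelling S m lab" "u = map (\<lambda>r. lab (x + int r)) [0..<l]" "u \<in> lists S"
  shows "reduced_expr (cox_class S m u) v \<longleftrightarrow> v = u"
proof -
  have fold_u: "fold (cross lab) u x = x + int (length u)"
    using fold_cross_labels assms(2) by simp
  have len: "length u \<le> length v" if "v \<in> cox_class S m u" for v
    using that cox_eq_fold_cross[OF assms(1), of u v] fold_u fold_cross_le[of lab v x]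
    by (auto simp: cox_class_def)
  have eq: "v = u" if "v \<in> cox_class S m u" "length v = length u" for v
    using that cox_eq_fold_cross[OF assms(1), of u v] fold_u fold_cross_eq[of lab v x] assms(2)
    by (auto simp: cox_class_def)
  have "u \<in> cox_class S m u" using assms(3) by (auto simp: cox_class_def intro: cox_eq.intros)
  thus ?thesis using len eq by (auto simp: reduced_expr_def intro: le_antisym)
qed

text \<open>Uniqueness makes full commutativity trivial and also pins down the \<open>SOME\<close>
  in \<open>red_expr\<close>.\<close>

lemma labelled_word_FC:
  assumes "coxeter_labelling S m lab" "u = map (\<lambda>r. lab (x + int r)) [0..<l]" "u \<in> lists S"
  shows "cox_class S m u \<in> FC S m" "red_expr (cox_class S m u) = u"
  using labelled_word_unique[OF assms] assms(3)
  by (auto simp: FC_def red_expr_def cox_group_eq)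

section \<open>Coxeter relations from the local shape of a labelling\<close>

lemma fold_cross_square:
  assumes "\<And>x. lab x = s \<Longrightarrow> lab (x + 1) \<noteq> s"
  shows "cross lab s (cross lab s x) = x"
  using assms[of x] assms[of "x - 1"] by (auto simp: cross_def)

text \<open>Edges labelled \<open>s\<close> or \<open>t\<close> are isolated, so the two letters act
  by disjoint transpositions and commute.\<close>

lemma fold_cross_2:
  assumes "\<And>x. lab x = s \<Longrightarrow> lab (x + 1) \<noteq> s \<and> lab (x + 1) \<noteq> t"
    and "\<And>x. lab x = t \<Longrightarrow> lab (x + 1) \<noteq> s \<and> lab (x + 1) \<noteq> t"
  shows "fold (cross lab) [s, t, s, t] = id"
proof
  fix x
  show "fold (cross lab) [s, t, s, t] x = id x"
    using assms[of x] assms[of "x - 1"]  assms[of "x - 2"] assms[of "x + 1"] by (auto simp: cross_def)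
qed

lemma cross_outside: "lab x \<noteq> s \<Longrightarrow> lab (x - 1) \<noteq> s \<Longrightarrow> cross lab s x = x"
  by (simp add: cross_def)

text \<open>On the three vertices of a two-edge path the letters act as the adjacent transpositions
  of the symmetric group on three points, whose product has order 3.\<close>

lemma fold_cross_3:
  assumes "s \<noteq> t"
    and s: "\<And>x. lab x = s \<Longrightarrow>
      lab (x + 1) = t \<and> lab (x - 1) \<notin> {s, t} \<and> lab (x + 2) \<notin> {s, t} \<or>
      lab (x - 1) = t \<and> lab (x + 1) \<notin> {s, t} \<and> lab (x - 2) \<notin> {s, t}"
    and t: "\<And>x. lab x = t \<Longrightarrow>
      lab (x + 1) = s \<and> lab (x - 1) \<notin> {s, t} \<and> lab (x + 2) \<notin> {s, t} \<or>
      lab (x - 1) = s \<and> lab (x + 1) \<notin> {s, t} \<and> lab (x - 2) \<notin> {s, t}"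
  shows "fold (cross lab) [s, t, s, t, s, t] = id"
proof
  fix x
  have path: "fold (cross lab) [s, t, s, t, s, t] z = z"
    if "lab y = a" "lab (y + 1) = b" "lab (y - 1) \<notin> {s, t}" "lab (y + 2) \<notin> {s, t}"
      "(a, b) \<in> {(s, t), (t, s)}" "z \<in> {y, y + 1, y + 2}" for y z a b
  proof -
    have "a \<noteq> b" "lab (y - 1) \<notin> {a, b}" "lab (y + 2) \<notin> {a, b}" using that assms(1) by auto
    hence "cross lab a y = y + 1" "cross lab a (y + 1) = y" "cross lab a (y + 2) = y + 2"
       "cross lab b y = y" "cross lab b (y + 1) = y + 2" "cross lab b (y + 2) = y + 1"
      using that(1,2) by (simp_all add: cross_def add.commute)
    thus ?thesis using that(5,6) by auto
  qed
  show "fold (cross lab) [s, t, s, t, s, t] x = id x"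
  proof (cases "lab x \<in> {s, t} \<or> lab (x - 1) \<in> {s, t}")
    case False
    thus ?thesis using cross_outside[of lab x] by simp
  next
    case True
    \<comment> \<open>\<open>w\<close> is an edge at \<open>x\<close> labelled \<open>s\<close> or
      \<open>t\<close>; the two-edge path starts at \<open>w\<close> or at
      \<open>w - 1\<close>.\<close>
    then obtain w a b where w: "w \<in> {x, x - 1}" "lab w = a" "(a, b) \<in> {(s, t), (t, s)}"
      by auto
    have "lab (w + 1) = b \<and> lab (w - 1) \<notin> {s, t} \<and> lab (w + 2) \<notin> {s, t} \<or>
      lab (w - 1) = b \<and> lab (w + 1) \<notin> {s, t} \<and> lab (w - 2) \<notin> {s, t}"
      using s[of w] t[of w] w(2,3) by blast
    thus ?thesis
    proof (elim disjE conjE)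
      assume "lab (w + 1) = b" "lab (w - 1) \<notin> {s, t}" "lab (w + 2) \<notin> {s, t}"
      from path[OF w(2) this w(3), of x] show ?thesis using w(1) by auto
    next
      assume "lab (w - 1) = b" "lab (w + 1) \<notin> {s, t}" "lab (w - 2) \<notin> {s, t}"
      with path[of "w - 1" b a x] w show ?thesis by (auto simp: add.commute)
    qed
  qed
qed

text \<open>Here the paths read \<open>b a b\<close>: one letter swaps the two middle vertices, the
  other both outer pairs, and their product is a 4-cycle. The middle letter \<open>a\<close> may be
  \<open>s\<close> or \<open>t\<close>, whence the pair in the last assumption.\<close>

lemma fold_cross_4:
  assumes "s \<noteq> t"
    and s: "\<And>x. lab x = a \<Longrightarrow> lab (x + 1) = b \<and> lab (x - 1) = b \<and>
        lab (x - 2) \<notin> {a, b} \<and> lab (x + 2) \<notin> {a, b}"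
    and t: "\<And>x. lab x = b \<Longrightarrow> lab (x + 1) = a \<or> lab (x - 1) = a"
    and st: "(a, b) \<in> {(s, t), (t, s)}"
  shows "fold (cross lab) [s, t, s, t, s, t, s, t] = id"
proof
  fix x
  have path: "fold (cross lab) [s, t, s, t, s, t, s, t] z = z"
    if y: "lab y = a" and z: "z \<in> {y - 1, y, y + 1, y + 2}" for y z
  proof -
    have "a \<noteq> b" using assms(1) st by auto
    hence "cross lab b (y - 1) = y" "cross lab b y = y - 1" "cross lab b (y + 1) = y + 2"
       "cross lab b (y + 2) = y + 1"
       "cross lab a (y - 1) = y - 1" "cross lab a y = y + 1" "cross lab a (y + 1) = y"
       "cross lab a (y + 2) = y + 2"
      using s[OF y] y by (auto simp add: cross_def add.commute)
    thus ?thesis using st z by auto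
  qed
  show "fold (cross lab) [s, t, s, t, s, t, s, t] x = id x"
  proof (cases "lab x \<in> {a, b} \<or> lab (x - 1) \<in> {a, b}")
    case False
    thus ?thesis using cross_outside[of lab x] st by auto
  next
    case True
    then obtain y where "lab y = a" "x \<in> {y - 1, y, y + 1, y + 2}"
    proof -
      assume *: "\<And>y. lab y = a \<Longrightarrow> x \<in> {y - 1, y, y + 1, y + 2} \<Longrightarrow> thesis"
      show thesis
        using True *[of x] *[of "x - 1"] *[of "x + 1"] *[of "x - 2"] t[of x] t[of "x - 1"] by auto
    qed
    thus ?thesis using path by simp
  qed
qed

lemma replicate_words:
  "concat (replicate 1 [s, t]) = [s, t]"
  "concat (replicate 2 [s, t]) = [s, t, s, t]"
  "concat (replicate 3 [s, t]) = [s, t, s, t, s, t]"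
  "concat (replicate 4 [s, t]) = [s, t, s, t, s, t, s, t]"
  by (simp_all add: numeral_eq_Suc)

section \<open>Labellings for type A\<close>

text \<open>Each generator labels one edge of a finite path; all edges outside get 0, which is no
  generator and is never crossed. The two orientations serve increasing and decreasing interval
  words.\<close>

lemma coxeter_labelling_A:
  "coxeter_labelling {1..n+1} m_A (\<lambda>x. if 1 \<le> x \<and> x \<le> int n + 1 then nat x else 0)"
  "coxeter_labelling {1..n+1} m_A (\<lambda>x. if 1 \<le> x \<and> x \<le> int n + 1 then nat (int n + 2 - x) else 0)"
proof -
  \<comment> \<open>Only the position \<open>p s\<close> of the single edge labelled
    \<open>s\<close> matters, which treats both orientations at once.\<close>
  have *: "coxeter_labelling {1..n+1} m_A lab"
    if lab: "\<And>x s. s \<in> {1..n+1} \<Longrightarrow> lab x = s \<longleftrightarrow> x = p s"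
     and p': "(\<forall>s. p s = int s) \<or> (\<forall>s. p s = int n + 2 - int s)" for lab :: "int \<Rightarrow> nat" and p
    unfolding coxeter_labelling_def
  proof (intro conjI ballI allI impI)
    fix x assume "lab x \<in> {1..n + 1}"
    from lab[OF this, of x] lab[OF this, of "x + 1"] show "lab (x + 1) \<noteq> lab x" by auto
  next
    fix s t assume s: "s \<in> {1..n+1}" and t: "t \<in> {1..n+1}"
    consider "s = t" | "t = s + 1 \<or> s = t + 1" | "s \<noteq> t" "t \<noteq> s + 1" "s \<noteq> t + 1" by blast
    thus "fold (cross lab) (concat (replicate (m_A s t) [s, t])) = id"
    proof cases
      case 1
      have "cross lab s (cross lab s x) = x" for x
        by (rule fold_cross_square) (simp add: lab[OF s])
      thus ?thesis using 1 by (simp add: m_A_def fun_eq_iff)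
    next
      case 2
      hence "m_A s t = 3" by (auto simp: m_A_def)
      moreover have "fold (cross lab) [s, t, s, t, s, t] = id"
        by (rule fold_cross_3) (use 2 p' in \<open>auto simp: lab[OF s] lab[OF t]\<close>)
      ultimately show ?thesis by (simp only: replicate_words)
    next
      case 3
      hence "m_A s t = 2" by (auto simp: m_A_def)
      moreover have "fold (cross lab) [s, t, s, t] = id"
        by (rule fold_cross_2) (use 3 p' in \<open>auto simp: lab[OF s] lab[OF t]\<close>)
      ultimately show ?thesis by (simp only: replicate_words)
    qed
  qed
  show "coxeter_labelling {1..n+1} m_A (\<lambda>x. if 1 \<le> x \<and> x \<le> int n + 1 then nat x else 0)"
    by (rule *[where p = int]) auto
  show "coxeter_labelling {1..n+1} m_A (\<lambda>x. if 1 \<le> x \<and> x \<le> int n + 1 then nat (int n + 2 - x) else 0)"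
    by (rule *[where p = "\<lambda>s. int n + 2 - int s"]) auto
qed

section \<open>The zigzag labelling for type C\<close>

text \<open>The letter at position \<open>x\<close> of the infinite word: a sawtooth of period
  \<open>2 * n\<close> with minimum 1 at residue 0 and maximum \<open>n + 1\<close> at residue
  \<open>n\<close>.\<close>

definition zz_lab :: "nat \<Rightarrow> nat \<Rightarrow> nat" where
  "zz_lab n x = (let r = x mod (2 * n) in if r \<le> n then r + 1 else 2 * n + 1 - r)"

lemma zz_period_length: "n \<ge> 1 \<Longrightarrow> length (zz_period n) = 2 * n"
  by (simp add: zz_period_def del: upt_Suc)

lemma zz_period_nth:
  assumes "n \<ge> 1"
  shows "zz_period n ! (x mod length (zz_period n)) = zz_lab n x"
proof -
  define r where "r = x mod (2 * n)"
  have "r < 2 * n" using assms by (simp add: r_def)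
  hence "zz_period n ! r = (if r \<le> n then r + 1 else 2 * n + 1 - r)"
    by (auto simp: zz_period_def nth_append rev_nth nth_upt simp del: upt_Suc)
  thus ?thesis using assms by (simp add: zz_period_length zz_lab_def r_def Let_def)
qed

lemma zz_factor_iff:
  "n \<ge> 1 \<Longrightarrow> zz_factor n u \<longleftrightarrow> (\<exists>a b. u = map (zz_lab n) [a..<b] \<and> a \<le> b)"
  unfolding zz_factor_def zz_period_nth
  by (metis le_add1 le_Suc_ex)

text \<open>The action needs a label on every edge of the line, so the word is continued
  periodically to negative positions.\<close>

definition zz_ilab :: "nat \<Rightarrow> int \<Rightarrow> nat" where
  "zz_ilab n x = zz_lab n (nat (x mod (2 * int n)))"

lemma zz_ilab_of_nat: "zz_ilab n (int x) = zz_lab n x"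
  by (simp add: zz_ilab_def zz_lab_def nat_mod_distrib nat_mult_distrib)

lemma zz_ilab_eq_iff:
  assumes "n \<ge> 1" "s \<in> {1..n+1}"
  shows "zz_ilab n x = s \<longleftrightarrow> x mod (2 * int n) = int s - 1 \<or> x mod (2 * int n) = (2 * int n + 1 - int s) "
proof -
  define r where "r = x mod (2 * int n)"
  have r: "0 \<le> r" "r < 2 * int n" using assms by (auto simp: r_def)
  hence "nat r mod (2 * n) = nat r" by simp
  thus ?thesis using r assms unfolding zz_ilab_def r_def[symmetric] zz_lab_def Let_def
    by (auto split: if_splits)
qed

text \<open>Turns residues of nearby positions into piecewise linear terms, so that linear
  arithmetic can settle the local shapes.\<close>

lemma mod_shift:
  fixes x N c :: int
  assumes "\<bar>c\<bar> \<le> N" "0 < N"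
  shows "(x + c) mod N = (let r = x mod N + c in if r < 0 then r + N else if r \<ge> N then r - N else r)"
proof -
  define r where "r = x mod N + c"
  have "0 \<le> x mod N" "x mod N < N" using assms by auto
  hence r: "- N \<le> r" "r < 2 * N" using assms unfolding r_def by linarith+
  have "(x + c) mod N = r mod N" by (simp add: r_def mod_add_left_eq)
  also have "\<dots> = (if r < 0 then r + N else if r \<ge> N then r - N else r)"
    using r mod_pos_pos_trivial[of "r + N" N] mod_pos_pos_trivial[of "r - N" N]
      mod_pos_pos_trivial[of r N] minus_mod_self2[of r N] by auto
  finally show ?thesis by (simp add: r_def Let_def)
qed

text \<open>
  Residues modulo \<open>2 n\<close> of positions on the line: the edges labelled \<open>s\<close> have residues \<open>s - 1\<close>
  and \<open>- (s - 1)\<close>.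
\<close>

definition zz_res :: "int \<Rightarrow> int \<Rightarrow> int \<Rightarrow> bool" where
  "zz_res N r s \<longleftrightarrow> r = s - 1 \<or> r = N + 1 - s"

definition shift_res :: "int \<Rightarrow> int \<Rightarrow> int \<Rightarrow> int" where
  "shift_res N c r = (if r + c < 0 then r + c + N else if r + c \<ge> N then r + c - N else r + c)"

text \<open>\<open>a\<close> is a wall letter and \<open>b\<close> its neighbour: the sawtooth turns
  at \<open>a\<close>, so \<open>b\<close> stands on both sides and the paths have three edges. The
  right wall is written doubled because \<open>N\<close> stands for \<open>2 * n\<close>.\<close>

lemma zz_res_4:
  fixes r N a b :: int
  assumes "0 \<le> r" "r < N" "4 \<le> N" "a = 1 \<and> b = 2 \<or> 2 * a = N + 2 \<and> 2 * b = N"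
  shows "zz_res N r a \<Longrightarrow> zz_res N (shift_res N 1 r) b \<and> zz_res N (shift_res N (-1) r) b \<and>
    \<not> zz_res N (shift_res N (-2) r) a \<and> \<not> zz_res N (shift_res N (-2) r) b \<and>
    \<not> zz_res N (shift_res N 2 r) a \<and> \<not> zz_res N (shift_res N 2 r) b"
    "zz_res N r b \<Longrightarrow> zz_res N (shift_res N 1 r) a \<or> zz_res N (shift_res N (-1) r) a"
proof -
  { assume "zz_res N r a"
    hence "a = 1 \<and> b = 2 \<and> r = 0 \<or> 2 * a = N + 2 \<and> 2 * b = N \<and> r = a - 1"
      using assms by (auto simp: zz_res_def)
    thus "zz_res N (shift_res N 1 r) b \<and> zz_res N (shift_res N (-1) r) b \<and>
      \<not> zz_res N (shift_res N (-2) r) a \<and> \<not> zz_res N (shift_res N (-2) r) b \<and>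
      \<not> zz_res N (shift_res N 2 r) a \<and> \<not> zz_res N (shift_res N 2 r) b"
      using assms(3) by (elim disjE) (auto simp: zz_res_def shift_res_def) }
  { assume "zz_res N r b"
    hence "a = 1 \<and> b = 2 \<and> r = 1 \<or> a = 1 \<and> b = 2 \<and> r = N - 1 \<or>
       2 * a = N + 2 \<and> 2 * b = N \<and> r = a - 2 \<or> 2 * a = N + 2 \<and> 2 * b = N \<and> r = a"
      using assms by (auto simp: zz_res_def)
    thus "zz_res N (shift_res N 1 r) a \<or> zz_res N (shift_res N (-1) r) a"
      using assms(3) by (elim disjE) (auto simp: zz_res_def shift_res_def) }
qed

text \<open>Two neighbouring inner letters meet once on the rising and once on the falling branch.
  The four cases record the branch and whether \<open>t\<close> follows or precedes
  \<open>s\<close>.\<close>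

lemma zz_res_3:
  fixes r N s t :: int
  assumes "even N" "1 < s" "1 < t" "2 * s \<le> N" "2 * t \<le> N" "t = s + 1 \<or> s = t + 1" "zz_res N r s"
  shows "zz_res N (shift_res N 1 r) t \<and>
    \<not> zz_res N (shift_res N (-1) r) s \<and> \<not> zz_res N (shift_res N (-1) r) t \<and>
    \<not> zz_res N (shift_res N 2 r) s \<and> \<not> zz_res N (shift_res N 2 r) t \<or>
    zz_res N (shift_res N (-1) r) t \<and>
    \<not> zz_res N (shift_res N 1 r) s \<and> \<not> zz_res N (shift_res N 1 r) t \<and>
    \<not> zz_res N (shift_res N (-2) r) s \<and> \<not> zz_res N (shift_res N (-2) r) t"
proof -
  \<comment> \<open>The bounds exclude most coincidences of the rising branch \<open>s - 1\<close>
    with the falling branch \<open>N + 1 - s\<close>; parity excludes the rest.\<close>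
  have N: "2 * x \<noteq> N + 1" "2 * x \<noteq> N - 1" "2 * x \<noteq> N + 3" "2 * x \<noteq> N - 3" for x
    using assms(1) by presburger+
  from assms(6,7) consider "t = s + 1" "r = s - 1" | "s = t + 1" "r = N + 1 - s"
    | "s = t + 1" "r = s - 1" | "t = s + 1" "r = N + 1 - s" unfolding zz_res_def by blast
  thus ?thesis
  proof cases
    case 1
    hence "shift_res N 1 r = s" "shift_res N (-1) r = s - 2" "shift_res N 2 r = s + 1"
      using assms(2-5) by (auto simp: shift_res_def)
    thus ?thesis using 1 assms(2-5) N[of s] by (intro disjI1) (auto simp: zz_res_def)
  next
    case 2
    hence "shift_res N 1 r = N + 2 - s" "shift_res N (-1) r = N - s" 
       "shift_res N 2 r = (if s = 3 then 0 else N + 3 - s)"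
      using assms(2-5) by (auto simp: shift_res_def)
    thus ?thesis using 2 assms(2-5) N[of s] by (intro disjI1) (auto simp: zz_res_def split: if_splits)
  next
    case 3
    hence "shift_res N 1 r = s" "shift_res N (-1) r = s - 2" "shift_res N (-2) r = s - 3"
      using assms(2-5) by (auto simp: shift_res_def)
    thus ?thesis using 3 assms(2-5) N[of s] by (intro disjI2) (auto simp: zz_res_def)
  next
    case 4
    hence "shift_res N 1 r = (if s = 2 then 0 else N + 2 - s)" "shift_res N (-1) r = N - s" 
       "shift_res N (-2) r = N - 1 - s"
      using assms(2-5) by (auto simp: shift_res_def)
    thus ?thesis using 4 assms(2-5) N[of s] by (intro disjI2) (auto simp: zz_res_def split: if_splits)
  qed
qed

lemma zz_res_2:
  fixes r N s t :: int
  assumes "0 \<le> r" "r < N" "even N" "1 \<le> s" "1 \<le> t" "2 * s \<le> N + 2" "2 * t \<le> N + 2" "zz_res N r s"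
    "t \<noteq> s + 1" "s \<noteq> t + 1"
  shows "\<not> zz_res N (shift_res N 1 r) t"
proof -
  obtain k where N: "N = 2 * k" using assms(3) by (elim evenE)
  have "shift_res N 1 r = (if r = N - 1 then 0 else r + 1)" using assms by (auto simp: shift_res_def)
  thus ?thesis using assms(1,2,4-) unfolding N zz_res_def by (elim disjE) auto
qed

text \<open>A wall letter and its neighbour form three-edge paths, two neighbouring inner letters
  form two-edge paths, and letters at distance at least two never stand side by side. These are the
  local shapes for the orders 4, 3 and 2 in \<open>m_C\<close>.\<close>

lemma coxeter_labelling_C:
  assumes "n \<ge> 2"
  shows "coxeter_labelling {1..n+1} (m_C n) (zz_ilab n)"
  unfolding coxeter_labelling_def
proof (intro conjI ballI allI impI)
  let ?lab = "zz_ilab n"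
  define N where "N = 2 * int n"
  have N: "N \<ge> 4" "even N" using assms by (auto simp: N_def)
  have lab: "?lab x = s \<longleftrightarrow> zz_res N (x mod N) (int s)" if "s \<in> {1..n+1}" for x s
    using zz_ilab_eq_iff[of n s x] that assms by (simp add: N_def zz_res_def)
  have shift: "(x + c) mod N = shift_res N c (x mod N)" if "\<bar>c\<bar> \<le> 2" for x c
    using mod_shift[of c N x] that N by (simp add: shift_res_def Let_def)
  have labs: "?lab (x + 1) = s \<longleftrightarrow> zz_res N (shift_res N 1 (x mod N)) (int s)"
     "?lab (x - 1) = s \<longleftrightarrow> zz_res N (shift_res N (-1) (x mod N)) (int s)"
     "?lab (x + 2) = s \<longleftrightarrow> zz_res N (shift_res N 2 (x mod N)) (int s)"
     "?lab (x - 2) = s \<longleftrightarrow> zz_res N (shift_res N (-2) (x mod N)) (int s)"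
    if "s \<in> {1..n+1}" for x s
    using shift[of 1 x] shift[of "-1" x] shift[of 2 x] shift[of "-2" x] lab[OF that] by simp_all
  have r: "0 \<le> x mod N" "x mod N < N" for x using N by auto
  have S: "1 \<le> int s" "2 * int s \<le> N + 2" if "s \<in> {1..n+1}" for s using that by (auto simp: N_def)
  have step: "?lab (x + 1) \<noteq> t"
    if "?lab x = s" "s \<in> {1..n+1}" "t \<in> {1..n+1}" "t \<noteq> s + 1" "s \<noteq> t + 1" for x s t
  proof -
    have "int t \<noteq> int s + 1" "int s \<noteq> int t + 1" using that by auto
    thus ?thesis
      using zz_res_2[OF r N(2) S(1)[OF that(2)] S(1)[OF that(3)] S(2)[OF that(2)] S(2)[OF that(3)]]
        that(1) unfolding labs[OF that(3)] unfolding lab[OF that(2)] by blast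
  qed
  show "?lab (x + 1) \<noteq> ?lab x" if "?lab x \<in> {1..n+1}" for x
    using step[OF HOL.refl that that] by simp
  fix s t assume s: "s \<in> {1..n+1}" and t: "t \<in> {1..n+1}"
  have order4: "fold (cross ?lab) [s, t, s, t, s, t, s, t] = id"
    if "(a, b) \<in> {(s, t), (t, s)}" "a = 1 \<and> b = 2 \<or> a = n + 1 \<and> b = n" for a b
  proof (rule fold_cross_4[where a = a and b = b])
    have ab: "a \<in> {1..n+1}" "b \<in> {1..n+1}" using that s t by auto
    have "int a = 1 \<and> int b = 2 \<or> 2 * int a = N + 2 \<and> 2 * int b = N" using that by (auto simp: N_def)
    note res = zz_res_4[OF r N(1) this]
    show "s \<noteq> t" using that by auto
    fix x :: int
    show "?lab (x + 1) = b \<and> ?lab (x - 1) = b \<and> ?lab (x - 2) \<notin> {a, b} \<and> ?lab (x + 2) \<notin> {a, b}"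
      if "?lab x = a"
      using that res(1)[of x] unfolding insert_iff empty_iff labs[OF ab(1)] labs[OF ab(2)] unfolding lab[OF ab(1)]
      by blast
    show "?lab (x + 1) = a \<or> ?lab (x - 1) = a" if "?lab x = b"
      using that res(2)[of x] unfolding labs[OF ab(1)] unfolding lab[OF ab(2)] by blast
  qed (rule that(1))
  have order3: "fold (cross ?lab) [s, t, s, t, s, t] = id"
    if "t = s + 1 \<or> s = t + 1" "1 < s" "1 < t" "s \<le> n" "t \<le> n"
  proof (rule fold_cross_3)
    have ist: "int t = int s + 1 \<or> int s = int t + 1" "int s = int t + 1 \<or> int t = int s + 1"
      "1 < int s" "1 < int t" "2 * int s \<le> N" "2 * int t \<le> N"
      using that by (auto simp: N_def)
    show "s \<noteq> t" using that by auto
    fix x :: int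
    show "?lab (x + 1) = t \<and> ?lab (x - 1) \<notin> {s, t} \<and> ?lab (x + 2) \<notin> {s, t} \<or>
      ?lab (x - 1) = t \<and> ?lab (x + 1) \<notin> {s, t} \<and> ?lab (x - 2) \<notin> {s, t}" if "?lab x = s"
      using zz_res_3[OF N(2) ist(3,4,5,6,1), of "x mod N"] that
      unfolding insert_iff empty_iff labs[OF s] labs[OF t] unfolding lab[OF s] by blast
    show "?lab (x + 1) = s \<and> ?lab (x - 1) \<notin> {s, t} \<and> ?lab (x + 2) \<notin> {s, t} \<or>
      ?lab (x - 1) = s \<and> ?lab (x + 1) \<notin> {s, t} \<and> ?lab (x - 2) \<notin> {s, t}" if "?lab x = t"
      using zz_res_3[OF N(2) ist(4,3,6,5,2), of "x mod N"] that
      unfolding insert_iff empty_iff labs[OF s] labs[OF t] unfolding lab[OF t] by blast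
  qed
  have order2: "fold (cross ?lab) [s, t, s, t] = id"
    if "s \<noteq> t" "t \<noteq> s + 1" "s \<noteq> t + 1"
  proof (rule fold_cross_2)
    fix x :: int
    show "?lab (x + 1) \<noteq> s \<and> ?lab (x + 1) \<noteq> t" if "?lab x = s"
      using step[OF that s s] step[OF that s t] \<open>t \<noteq> s + 1\<close> \<open>s \<noteq> t + 1\<close> by simp
    show "?lab (x + 1) \<noteq> s \<and> ?lab (x + 1) \<noteq> t" if "?lab x = t"
      using step[OF that t s] step[OF that t t] \<open>t \<noteq> s + 1\<close> \<open>s \<noteq> t + 1\<close> by simp
  qed
  have edge: "s = 1 \<and> t = 2 \<or> s = 2 \<and> t = 1 \<or> s = n + 1 \<and> t = n \<or> s = n \<and> t = n + 1"
    if "t = s + 1 \<or> s = t + 1" "\<not> (1 < s \<and> 1 < t \<and> s \<le> n \<and> t \<le> n)"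
    using that s t by auto
  consider "s = t" | "s \<noteq> t" "t \<noteq> s + 1" "s \<noteq> t + 1"
    | "t = s + 1 \<or> s = t + 1" "1 < s" "1 < t" "s \<le> n" "t \<le> n"
    | "s = 1 \<and> t = 2 \<or> s = 2 \<and> t = 1 \<or> s = n + 1 \<and> t = n \<or> s = n \<and> t = n + 1"
    using edge by blast
  thus "fold (cross ?lab) (concat (replicate (m_C n s t) [s, t])) = id"
  proof cases
    case 1
    have "cross ?lab s (cross ?lab s x) = x" for x
      by (rule fold_cross_square) (rule step[OF _ s s], auto)
    thus ?thesis using 1 by (simp add: m_C_def fun_eq_iff)
  next
    case 2
    hence "m_C n s t = 2" by (auto simp: m_C_def)
    thus ?thesis using order2[OF 2] by (simp only: replicate_words)
  next
    case 3
    hence "{s, t} \<noteq> {1, 2}" "{s, t} \<noteq> {n, n + 1}" "s \<noteq> t"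
      by (simp_all add: doubleton_eq_iff) linarith+
    hence "m_C n s t = 3" unfolding m_C_def using 3(1) by (simp only: if_False if_True simp_thms)
    thus ?thesis using order3[OF 3] by (simp only: replicate_words)
  next
    case 4
    then obtain a b where ab: "(a, b) \<in> {(s, t), (t, s)}" "a = 1 \<and> b = 2 \<or> a = n + 1 \<and> b = n"
      by blast
    have "s \<noteq> t" "t = s + 1 \<or> s = t + 1" "{s, t} = {1, 2} \<or> {s, t} = {n, n + 1}"
      using 4 by (elim disjE; simp add: insert_commute)+
    hence "m_C n s t = 4" unfolding m_C_def by (simp only: if_False if_True simp_thms)
    thus ?thesis using order4[OF ab] by (simp only: replicate_words)
  qed
qed

section \<open>Concatenation of undecorated matchings\<close>

text \<open>At most one partner per node, with edges read in both orientations since walks may run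
  along them backwards.\<close>

definition partner_unique :: "edge set \<Rightarrow> bool" where
  "partner_unique E \<longleftrightarrow> (\<forall>p q r. ((p, q) \<in> E \<or> (q, p) \<in> E) \<and> ((p, r) \<in> E \<or> (r, p) \<in> E) \<longrightarrow> q = r)"

text \<open>The walk ends on a face of the product, where no link can continue it.\<close>

definition outer_end :: "step list \<Rightarrow> bool" where
  "outer_end ws \<longleftrightarrow> fst (last ws) = is_north (end_of ws)"

lemma walk_step: "walk x y ws \<Longrightarrow> (b, p, q) \<in> set ws \<Longrightarrow>
   (p, q) \<in> edges (if b then x else y) \<or> (q, p) \<in> edges (if b then x else y)"
  by (auto simp: walk_def Let_def dest!: bspec)

lemma walk_Cons:
  "walk x y (s # t # ws) \<longleftrightarrow> linked s t \<and> walk x y (t # ws) \<and> walk x y [s]"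
  by (auto simp: walk_def)

lemma linked_not_outer: "linked (b, p, q) t \<Longrightarrow> b \<noteq> is_north q"
  by (cases t) auto

lemma linked_unique: "linked s (b, p, q) \<Longrightarrow> linked s (b', p', q') \<Longrightarrow> b = b' \<and> p = p'"
  by (cases s) auto

text \<open>Walks are deterministic: the partner of a node is unique, the gluing fixes where the
  next step starts, and a walk stops exactly when it reaches a face of the product.\<close>

lemma walk_unique:
  assumes "partner_unique (edges x)" "partner_unique (edges y)"
  shows "walk x y ws \<Longrightarrow> walk x y ws' \<Longrightarrow> fst (hd ws) = fst (hd ws') \<Longrightarrow> start_of ws = start_of ws' \<Longrightarrow>
    outer_end ws \<Longrightarrow> outer_end ws' \<Longrightarrow> ws = ws'"
proof (induction ws arbitrary: ws')
  case Nil
  thus ?case by (simp add: walk_def)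
next
  case (Cons s us)
  then obtain s' us' where ws': "ws' = s' # us'" by (cases ws') (auto simp: walk_def)
  obtain b p q where s: "s = (b, p, q)" by (cases s)
  obtain q' where s': "s' = (b, p, q')"
    using Cons.prems(3,4) ws' s by (cases s') (auto simp: start_of_def)
  have "(p, q) \<in> edges (if b then x else y) \<or> (q, p) \<in> edges (if b then x else y)"
    using Cons.prems(1) s by (intro walk_step[of x y "s # us"]) auto
  moreover have "(p, q') \<in> edges (if b then x else y) \<or> (q', p) \<in> edges (if b then x else y)"
    using Cons.prems(2) ws' s' by (intro walk_step[of x y "s' # us'"]) auto
  moreover have "partner_unique (edges (if b then x else y))" using assms by simp
  ultimately have "q' = q" unfolding partner_unique_def by blast
  hence "s' = s" using s s' by simp
  have not_last: "\<not> outer_end [s]" if "linked s t" for t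
    using that s linked_not_outer[of b p q t] by (auto simp: outer_end_def end_of_def)
  show ?case
  proof (cases us)
    case Nil
    have "us' = []"
    proof (rule ccontr)
      assume "us' \<noteq> []"
      then obtain t vs where "us' = t # vs" by (cases us') auto
      thus False using Cons.prems(2,5) ws' \<open>s' = s\<close> Nil not_last[of t] by (simp add: walk_Cons)
    qed
    thus ?thesis using Nil ws' \<open>s' = s\<close> by simp
  next
    case u: (Cons t vs)
    show ?thesis
    proof (cases us')
      case Nil
      thus ?thesis using Cons.prems ws' \<open>s' = s\<close> u not_last[of t] by (simp add: walk_Cons)
    next
      case u': (Cons t' vs')
      have "us = us'"
      proof (rule Cons.IH)
        show "walk x y us" "walk x y us'" "outer_end us" "outer_end us'"
          using Cons.prems u u' ws' by (simp_all add: walk_Cons outer_end_def end_of_def)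
        have "linked s t" "linked s t'" using Cons.prems u u' ws' \<open>s' = s\<close> by (simp_all add: walk_Cons)
        thus "fst (hd us) = fst (hd us')" "start_of us = start_of us'"
          using linked_unique[of s "fst t" "fst (snd t)" "snd (snd t)" "fst t'" "fst (snd t')" "snd (snd t')"] u u'
          by (simp_all add: start_of_def)
      qed
      thus ?thesis using ws' \<open>s' = s\<close> by simp
    qed
  qed
qed

fun flip_step :: "step \<Rightarrow> step" where
  "flip_step (b, p, q) = (b, q, p)"

definition flip :: "step list \<Rightarrow> step list" where
  "flip ws = rev (map flip_step ws)"

lemma linked_flip_step: "linked (flip_step t) (flip_step s) \<longleftrightarrow> linked s t"
  by (cases s; cases t) auto

lemma walk_flip: "walk x y ws \<Longrightarrow> walk x y (flip ws)"
proof -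
  assume w: "walk x y ws"
  have "successively (\<lambda>s t. linked (flip_step t) (flip_step s)) ws"
    using w by (simp add: linked_flip_step walk_def)
  moreover have "(p, q) \<in> edges (if b then x else y) \<or> (q, p) \<in> edges (if b then x else y)"
    if "(b, p, q) \<in> set (flip ws)" for b p q
  proof -
    have "(b, q, p) \<in> set ws" using that by (auto simp: flip_def)
    from walk_step[OF w this] show ?thesis by blast
  qed
  hence "\<forall>(b, p, q)\<in>set (flip ws). let E = edges (if b then x else y) in (p, q) \<in> E \<or> (q, p) \<in> E"
    unfolding Let_def by blast
  ultimately show ?thesis using w
    by (simp only: walk_def) (simp add: flip_def successively_rev successively_map)
qed

lemma flip_ends:
  assumes "ws \<noteq> []"
  shows "fst (hd (flip ws)) = fst (last ws)" "fst (last (flip ws)) = fst (hd ws)"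
    "start_of (flip ws) = end_of ws" "end_of (flip ws) = start_of ws"
proof -
  have "fst (flip_step s) = fst s" "fst (snd (flip_step s)) = snd (snd s)"
    "snd (snd (flip_step s)) = fst (snd s)" for s
    by (cases s; simp)+
  thus "fst (hd (flip ws)) = fst (last ws)" "fst (last (flip ws)) = fst (hd ws)"
    "start_of (flip ws) = end_of ws" "end_of (flip ws) = start_of ws"
    using assms by (simp_all add: flip_def hd_rev last_rev last_map hd_map start_of_def end_of_def)
qed

lemma precedes_asym: "precedes p q \<Longrightarrow> \<not> precedes q p"
  by (auto simp: precedes_def)

text \<open>Replaces the quantification over all walks by a table \<open>st\<close> of explicit
  strands. If the table reaches every outer node from which a step can start, any strand shares an
  end with a tabulated one, so by determinism it is that one or its reversal.\<close>

lemma cat_edges_eqI: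
  assumes "partner_unique (edges x)" "partner_unique (edges y)"
    and st: "\<And>p q. (p, q) \<in> E \<Longrightarrow> strand x y (st (p, q)) \<and> start_of (st (p, q)) = p \<and> end_of (st (p, q)) = q"
    and cover: "\<And>b p q. b = is_north p \<Longrightarrow> (p, q) \<in> edges (if b then x else y) \<or> (q, p) \<in> edges (if b then x else y) \<Longrightarrow>
      \<exists>e\<in>E. fst e = p \<or> snd e = p"
  shows "cat_edges x y = E" "\<And>e. e \<in> E \<Longrightarrow> strand_of x y e = st e"
proof -
  have all: "(start_of ws, end_of ws) \<in> E \<and> ws = st (start_of ws, end_of ws)" if ws: "strand x y ws" for ws
  proof -
    have ne: "ws \<noteq> []" and w: "walk x y ws" "outer_end ws" using ws by (auto simp: strand_def walk_def outer_end_def)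
    obtain b p q where h: "hd ws = (b, p, q)" by (metis surj_pair)
    have "b = is_north p" using ws h by (auto simp: strand_def start_of_def)
    moreover have "(p, q) \<in> edges (if b then x else y) \<or> (q, p) \<in> edges (if b then x else y)"
      using h ne hd_in_set[of ws] by (intro walk_step[OF w(1)]) auto
    ultimately obtain e where e: "e \<in> E" "fst e = p \<or> snd e = p" using cover by blast
    obtain p' q' where e': "e = (p', q')" by (cases e)
    have s: "strand x y (st e)" "start_of (st e) = p'" "end_of (st e) = q'" using st e(1) e' by auto
    have sne: "st e \<noteq> []" "walk x y (st e)" using s by (auto simp: strand_def walk_def)
    have p: "start_of ws = p" using h by (simp add: start_of_def)
    from e(2) show ?thesis
    proof
      assume "fst e = p"
      hence "ws = st e" using e' s p w ws
        by (intro walk_unique[OF assms(1,2)]) (auto simp: strand_def outer_end_def)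
      thus ?thesis using s e e' by simp
    next
      assume "snd e = p"
      hence "ws = flip (st e)" using e' s p w ws sne
        by (intro walk_unique[OF assms(1,2)])
          (auto simp: strand_def outer_end_def walk_flip flip_ends)
      \<comment> \<open>A reversed strand would run against the reading direction.\<close>
      hence "precedes q' p'" using ws s sne by (auto simp: strand_def flip_ends)
      moreover have "precedes p' q'" using s by (auto simp: strand_def)
      ultimately show ?thesis using precedes_asym by blast
    qed
  qed
  show E: "cat_edges x y = E"
  proof
    show "cat_edges x y \<subseteq> E" using all by (auto simp: cat_edges_def)
    show "E \<subseteq> cat_edges x y"
    proof
      fix e assume "e \<in> E"
      moreover obtain p q where "e = (p, q)" by (cases e)
      ultimately show "e \<in> cat_edges x y"
        using st[of p q] by (auto simp: cat_edges_def intro!: exI[of _ "st e"])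
    qed
  qed
  fix e assume e: "e \<in> E"
  show "strand_of x y e = st e" unfolding strand_of_def
  proof (rule the_equality)
    show "strand x y (st e) \<and> (start_of (st e), end_of (st e)) = e"
      using e st[of "fst e" "snd e"] by simp
    show "ws = st e" if "strand x y ws \<and> (start_of ws, end_of ws) = e" for ws
      using that all[of ws] by simp
  qed
qed

lemma host_eqI:
  assumes "e \<in> cat_edges x y" "(b, f) \<in> set (strand_of x y e)"
    "\<And>e'. e' \<in> cat_edges x y \<Longrightarrow> (b, f) \<in> set (strand_of x y e') \<Longrightarrow> e' = e"
  shows "host x y b f = e"
  unfolding host_def using assms by (intro the_equality) blast+

text \<open>
  The first step of a loop is a south edge of \<open>x\<close>, and at both ends it is linked to a north edge of \<open>y\<close>.
\<close>

lemma new_loops_empty: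
  assumes "\<And>a b c d. (South a, South b) \<in> edges x \<or> (South b, South a) \<in> edges x \<Longrightarrow>
     (North a, North c) \<in> edges y \<or> (North c, North a) \<in> edges y \<Longrightarrow>
     (North b, North d) \<in> edges y \<or> (North d, North b) \<in> edges y \<Longrightarrow> False"
  shows "new_loops x y = {}"
proof -
  have False if "ws \<in> new_loops x y" for ws
  proof -
    have w: "walk x y ws" "linked (last ws) (hd ws)" "fst (hd ws)"
      using that by (auto simp: new_loops_def)
    obtain p q where h: "hd ws = (True, p, q)" using w(3) by (metis (full_types) prod.collapse)
    obtain r where ws: "ws = (True, p, q) # r" using w(1) h by (cases ws) (auto simp: walk_def)
    have "r \<noteq> []" using w(2) ws by auto
    then obtain t r' where r: "r = t # r'" by (cases r) auto
    have "linked (True, p, q) t" using w(1) ws r by (simp add: walk_Cons)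
    then obtain a q2 where t: "q = South a" "t = (False, North a, q2)" by (cases t) auto
    have "linked (last r) (True, p, q)" using w(2) ws \<open>r \<noteq> []\<close> by simp
    then obtain c p3 where l: "p = South c" "last r = (False, p3, North c)" by (cases "last r") auto
    have "\<exists>d. q2 = North d"
    proof (cases r')
      case Nil
      thus ?thesis using l r t by simp
    next
      case (Cons t' r'')
      hence "linked t t'" using w(1) ws r by (simp add: walk_Cons)
      thus ?thesis using t by (cases t') auto
    qed
    then obtain d where d: "q2 = North d" ..
    have "\<exists>d. p3 = North d"
    proof (cases "butlast r = []")
      case True
      thus ?thesis using l r t by (cases r') auto
    next
      case False
      have "r = butlast r @ [last r]" using \<open>r \<noteq> []\<close> by simp
      then obtain us u where "r = us @ [u, last r]" 
        by (metis False append_butlast_last_id append.assoc append_Cons append_Nil)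
      hence "ws = ((True, p, q) # us) @ [u, last r]" using ws by simp
      hence "linked u (last r)" using w(1) by (simp add: walk_def successively_append_iff successively_Cons split: if_splits)
      thus ?thesis using l by (cases u) auto
    qed
    then obtain e where e: "p3 = North e" ..
    have "(True, p, q) \<in> set ws" "(False, North a, q2) \<in> set ws" "(False, p3, North c) \<in> set ws"
      using ws r t l last_in_set[OF \<open>r \<noteq> []\<close>] by auto
    from this[THEN walk_step[OF w(1)]] show False
      using assms[of a c d e] d e l(1) t(1) by auto
  qed
  thus ?thesis by blast
qed

section \<open>Diagrams with one cup on each face\<close>

text \<open>The \<open>m\<close>-th node from the left that is not covered by a cup at
  \<open>i\<close>, \<open>i + 1\<close>. This numbers the propagating edges from 1 to
  \<open>n\<close> on either face.\<close>

definition skip :: "nat \<Rightarrow> nat \<Rightarrow> nat" where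
  "skip i m = (if m < i then m else m + 2)"

definition unskip :: "nat \<Rightarrow> nat \<Rightarrow> nat" where
  "unskip i a = (if a < i then a else a - 2)"

lemma unskip_skip [simp]: "unskip i (skip i m) = m"
  by (simp add: skip_def unskip_def)

lemma skip_neq [simp]: "skip i m \<noteq> i" "skip i m \<noteq> Suc i" "i \<noteq> skip i m" "Suc i \<noteq> skip i m"
  by (auto simp: skip_def)

lemma skip_eq_iff [simp]: "skip i m = skip i m' \<longleftrightarrow> m = m'"
  by (auto simp: skip_def split: if_splits)

lemma skip_less_iff [simp]: "skip i m < skip i m' \<longleftrightarrow> m < m'"
  by (auto simp: skip_def)

definition prop_edge :: "nat \<Rightarrow> nat \<Rightarrow> nat \<Rightarrow> edge" where
  "prop_edge i k m = (North (skip i m), South (skip k m))"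

definition ncup :: "nat \<Rightarrow> edge" where
  "ncup i = (North i, North (i + 1))"

definition scup :: "nat \<Rightarrow> edge" where
  "scup k = (South k, South (k + 1))"

definition cup_edges :: "nat \<Rightarrow> nat \<Rightarrow> nat \<Rightarrow> edge set" where
  "cup_edges n i k = {ncup i, scup k} \<union> prop_edge i k ` {1..n}"

lemma edge_neq [simp]:
  "ncup i \<noteq> scup k" "scup k \<noteq> ncup i"
  "ncup i \<noteq> prop_edge j k m" "prop_edge j k m \<noteq> ncup i"
  "scup i \<noteq> prop_edge j k m" "prop_edge j k m \<noteq> scup i"
  by (auto simp: ncup_def scup_def prop_edge_def)

lemma prop_edge_eq_iff [simp]: "prop_edge i k m = prop_edge i k m' \<longleftrightarrow> m = m'"
  by (auto simp: prop_edge_def)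

lemma propagating_simps [simp]:
  "\<not> propagating (ncup i)" "\<not> propagating (scup k)" "propagating (prop_edge i k m)"
  by (auto simp: propagating_def ncup_def scup_def prop_edge_def)

lemma finite_cup_edges [simp]: "finite (cup_edges n i k)"
  by (simp add: cup_edges_def)

text \<open>The partner of a node as a function, from which uniqueness of partners is
  immediate.\<close>

definition mate :: "nat \<Rightarrow> nat \<Rightarrow> node \<Rightarrow> node" where
  "mate i k p = (case p of
     North a \<Rightarrow> if a = i then North (i + 1) else if a = i + 1 then North i else South (skip k (unskip i a))
   | South a \<Rightarrow> if a = k then South (k + 1) else if a = k + 1 then South k else North (skip i (unskip k a)))"

lemma cup_edges_mate: "(p, q) \<in> cup_edges n i k \<or> (q, p) \<in> cup_edges n i k \<Longrightarrow> q = mate i k p"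
  by (auto simp: cup_edges_def ncup_def scup_def prop_edge_def mate_def)

lemma partner_unique_cup_edges: "partner_unique (cup_edges n i k)"
  unfolding partner_unique_def using cup_edges_mate by blast

definition wall_edge :: "nat \<Rightarrow> nat \<Rightarrow> nat \<Rightarrow> dec \<Rightarrow> edge" where
  "wall_edge n i k c = prop_edge i k (if black c then 1 else n)"

text \<open>The normal form of all computations. Black decorations belong on the first and white
  ones on the last propagating edge, so the list \<open>cs\<close> of decorations from top to bottom
  determines the vertical list.\<close>

definition cup_diag :: "nat \<Rightarrow> nat \<Rightarrow> nat \<Rightarrow> dec list \<Rightarrow> dec list \<Rightarrow> dec list \<Rightarrow> ddiag" where
  "cup_diag n i k bt bb cs = \<lparr>edges = cup_edges n i k,
     block = (\<lambda>e. if e = ncup i then bt else if e = scup k then bb else []),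
     vert = map (\<lambda>c. (wall_edge n i k c, c)) cs, loops = {#}\<rparr>"

lemma cup_diag_simps [simp]:
  "edges (cup_diag n i k bt bb cs) = cup_edges n i k"
  "block (cup_diag n i k bt bb cs) = (\<lambda>e. if e = ncup i then bt else if e = scup k then bb else [])"
  "vert (cup_diag n i k bt bb cs) = map (\<lambda>c. (wall_edge n i k c, c)) cs"
  "loops (cup_diag n i k bt bb cs) = {#}"
  by (simp_all add: cup_diag_def)

lemma aval_edges_cup_edges: "aval_edges (cup_edges n i k) = 1"
proof -
  have "{e \<in> cup_edges n i k. is_north (fst e) \<and> is_north (snd e)} = {ncup i}"
    by (auto simp: cup_edges_def ncup_def scup_def prop_edge_def)
  thus ?thesis by (simp add: aval_edges_def)
qed

lemma aval_cup_diag [simp]: "aval (cup_diag n i k bt bb cs) = 1"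
  by (simp add: aval_def aval_edges_cup_edges)

lemma prop_list_cup_edges:
  assumes "i \<ge> 1" "i \<le> n + 1"
  shows "prop_list (cup_edges n i k) = map (prop_edge i k) [1..<n+1]"
proof -
  have "{a. \<exists>b. (North a, South b) \<in> cup_edges n i k} = set (map (skip i) [1..<n+1])"
    by (fastforce simp: cup_edges_def ncup_def scup_def prop_edge_def)
  moreover have "sorted_wrt (<) (map (skip i) [1..<n+1])"
    by (simp add: sorted_wrt_map del: upt_Suc)
  ultimately have "sorted_list_of_set {a. \<exists>b. (North a, South b) \<in> cup_edges n i k} = map (skip i) [1..<n+1]"
    by (metis sorted_list_of_set.idem_if_sorted_distinct strict_sorted_iff)
  moreover have "(THE q. (North (skip i m), q) \<in> cup_edges n i k) = South (skip k m)" if "m \<in> {1..n}" for m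
    using that by (intro the_equality) (auto simp: cup_edges_def ncup_def scup_def prop_edge_def)
  ultimately show ?thesis
    unfolding prop_list_def by (simp add: prop_edge_def del: upt_Suc)
qed

lemma first_last_prop_cup:
  assumes "i \<ge> 1" "i \<le> n + 1" "n \<ge> 1" "edges d = cup_edges n i k"
  shows "first_prop d = prop_edge i k 1" "last_prop d = prop_edge i k n"
  using assms upt_conv_Cons[of 1 "n + 1"]
  by (simp_all add: first_prop_def last_prop_def prop_list_cup_edges last_map hd_map del: upt_Suc)

lemma word_cup_diag:
  assumes "e = ncup i \<or> e = scup k"
  shows "word (cup_diag n i k bt bb cs) e = (if e = ncup i then bt else bb)"
  using assms by (auto simp: word_def filter_map o_def wall_edge_def filter_empty_conv)

lemma trav_cup_diag:
  shows "trav (cup_diag n i k bt bb cs) (ncup i) = bt"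
    "trav (cup_diag n i k bt bb cs) (scup k) = bb"
    "trav (cup_diag n i k bt bb cs) (North (i + 1), North i) = rev bt"
    "trav (cup_diag n i k bt bb cs) (South (k + 1), South k) = rev bb"
proof -
  have "ncup i \<in> cup_edges n i k" "scup k \<in> cup_edges n i k"
     "(North (i + 1), North i) \<notin> cup_edges n i k" "(South (k + 1), South k) \<notin> cup_edges n i k"
    by (auto simp: cup_edges_def ncup_def scup_def prop_edge_def)
  moreover have "word (cup_diag n i k bt bb cs) (North i, North (i + 1)) = bt"
    "word (cup_diag n i k bt bb cs) (South k, South (k + 1)) = bb"
    using word_cup_diag[of "ncup i" i k n bt bb cs] word_cup_diag[of "scup k" i k n bt bb cs]
    by (simp_all only: ncup_def scup_def) (simp_all add: ncup_def scup_def)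
  ultimately show "trav (cup_diag n i k bt bb cs) (ncup i) = bt"
    "trav (cup_diag n i k bt bb cs) (scup k) = bb"
    "trav (cup_diag n i k bt bb cs) (North (i + 1), North i) = rev bt"
    "trav (cup_diag n i k bt bb cs) (South (k + 1), South k) = rev bb"
    by (simp_all add: trav_def ncup_def scup_def)
qed

section \<open>A generator on top of a diagram with an adjacent cup\<close>

text \<open>The south cup at \<open>i\<close> and the north cup at \<open>j\<close> share exactly
  the node \<open>max i j\<close>. Strand number \<open>min i j\<close> therefore runs down, through
  the lower cup, back up through the upper one, and down again; all others are straight.\<close>

definition cup_strand :: "nat \<Rightarrow> nat \<Rightarrow> nat \<Rightarrow> nat \<Rightarrow> step list" where
  "cup_strand i j k m =
     (let a = skip i m; b = max i j; c = skip j m in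
      if m = min i j
      then [(True, North a, South a), (False, North a, North b), (True, South b, South c),
        (False, North c, South (skip k m))]
      else [(True, North a, South a), (False, North a, South (skip k m))])"

definition strand_table :: "nat \<Rightarrow> nat \<Rightarrow> nat \<Rightarrow> edge \<Rightarrow> step list" where
  "strand_table i j k e = (if e = ncup i then [(True, e)] else if e = scup k then [(False, e)]
     else cup_strand i j k (unskip i (idx (fst e))))"

lemma strand_table_simps [simp]:
  "strand_table i j k (ncup i) = [(True, ncup i)]"
  "strand_table i j k (scup k) = [(False, scup k)]"
  "strand_table i j k (prop_edge i k m) = cup_strand i j k m"
  by (simp_all add: strand_table_def) (simp add: prop_edge_def)

text \<open>\<open>x\<close> is the generator on top, hence its two cups have the same
  position.\<close>

locale adjacent_cups =
  fixes n i j k :: nat and x y :: ddiag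
  assumes i: "1 \<le> i" "i \<le> n + 1" and j: "1 \<le> j" "j \<le> n + 1" and k: "1 \<le> k" "k \<le> n + 1"
    and adjacent: "j = i + 1 \<or> i = j + 1"
    and edges_x: "edges x = cup_edges n i i" and edges_y: "edges y = cup_edges n j k"
begin

lemma cup_strand_ends: "start_of (cup_strand i j k m) = North (skip i m)" "end_of (cup_strand i j k m) = South (skip k m)"
  by (auto simp: cup_strand_def start_of_def end_of_def Let_def)

lemma skip_adjacent:
  "m \<noteq> min i j \<Longrightarrow> skip j m = skip i m"
  "m = min i j \<Longrightarrow> (skip i m = j \<and> max i j = j + 1 \<or> skip i m = j + 1 \<and> max i j = j)"
  "m = min i j \<Longrightarrow> (skip j m = i \<and> max i j = i + 1 \<or> skip j m = i + 1 \<and> max i j = i)"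
  using adjacent by (auto simp: skip_def)

lemma strand_cup_strand:
  assumes "m \<in> {1..n}"
  shows "strand x y (cup_strand i j k m)"
proof -
  have px: "(North (skip i m), South (skip i m)) \<in> edges x"
    using assms by (auto simp: edges_x cup_edges_def prop_edge_def)
  have py: "(North (skip j m), South (skip k m)) \<in> edges y"
    using assms by (auto simp: edges_y cup_edges_def prop_edge_def)
  have cy: "(North j, North (j + 1)) \<in> edges y" and cx: "(South i, South (i + 1)) \<in> edges x"
    by (auto simp: edges_x edges_y cup_edges_def ncup_def scup_def)
  show ?thesis
  proof (cases "m = min i j")
    case False
    thus ?thesis using px py skip_adjacent(1)[OF False]
      by (simp add: strand_def walk_def cup_strand_def Let_def start_of_def end_of_def precedes_def)
  next
    case True
    show ?thesis using px py cx cy skip_adjacent(2,3)[OF True] True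
      by (auto simp: strand_def walk_def cup_strand_def Let_def start_of_def end_of_def precedes_def)
  qed
qed

lemma
  shows cat_edges_cup: "cat_edges x y = cup_edges n i k"
    and strand_of_cup: "\<And>e. e \<in> cup_edges n i k \<Longrightarrow> strand_of x y e = strand_table i j k e"
proof -
  have st: "strand x y (strand_table i j k (p, q)) \<and> start_of (strand_table i j k (p, q)) = p \<and>
      end_of (strand_table i j k (p, q)) = q" if pq: "(p, q) \<in> cup_edges n i k" for p q
  proof -
    consider "(p, q) = ncup i" | "(p, q) = scup k" | m where "m \<in> {1..n}" "(p, q) = prop_edge i k m"
      using pq unfolding cup_edges_def by blast
    thus ?thesis
    proof cases
      case 1
      thus ?thesis by (auto simp: ncup_def strand_table_def strand_def walk_def start_of_def end_of_def precedes_def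
          edges_x cup_edges_def)
    next
      case 2
      thus ?thesis by (auto simp: scup_def strand_table_def strand_def walk_def start_of_def end_of_def precedes_def
          edges_y cup_edges_def ncup_def)
    next
      case (3 m)
      thus ?thesis using strand_cup_strand[of m] cup_strand_ends[of m] by (simp add: prop_edge_def[symmetric]) (simp add: prop_edge_def)
    qed
  qed
  have cover: "\<exists>e\<in>cup_edges n i k. fst e = p \<or> snd e = p"
    if "b = is_north p" "(p, q) \<in> edges (if b then x else y) \<or> (q, p) \<in> edges (if b then x else y)" for b p q
    using that by (cases p) (auto simp: edges_x edges_y cup_edges_def ncup_def scup_def prop_edge_def)
  note eq = cat_edges_eqI[OF _ _ st cover, unfolded edges_x edges_y,
      OF partner_unique_cup_edges partner_unique_cup_edges]
  show "cat_edges x y = cup_edges n i k" using eq(1) by simp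
  show "strand_of x y e = strand_table i j k e" if "e \<in> cup_edges n i k" for e
    using eq(2) that by simp
qed

text \<open>A loop would need both glued cups to cover the same two nodes, but their positions
  differ by one.\<close>

lemma new_loops_cup: "new_loops x y = {}"
proof (rule new_loops_empty)
  fix a b c d
  assume "(South a, South b) \<in> edges x \<or> (South b, South a) \<in> edges x"
    "(North a, North c) \<in> edges y \<or> (North c, North a) \<in> edges y"
    "(North b, North d) \<in> edges y \<or> (North d, North b) \<in> edges y"
  hence "{a, b} = {i, i + 1}" "a \<in> {j, j + 1}" "b \<in> {j, j + 1}"
    by (auto simp: edges_x edges_y cup_edges_def ncup_def scup_def prop_edge_def)
  thus False using adjacent by (auto simp: doubleton_eq_iff)
qed

text \<open>Gluing preserves the numbering: strand \<open>m\<close> of the product contains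
  propagating edge \<open>m\<close> of \<open>y\<close> and no other one of \<open>y\<close>, so the
  decorations of \<open>y\<close> stay next to their wall.\<close>

lemma host_cup:
  assumes "m \<in> {1..n}"
  shows "host x y False (prop_edge j k m) = prop_edge i k m"
proof (rule host_eqI)
  show "prop_edge i k m \<in> cat_edges x y" using assms by (simp add: cat_edges_cup cup_edges_def)
  hence "strand_of x y (prop_edge i k m) = cup_strand i j k m"
    using strand_of_cup[of "prop_edge i k m"] cat_edges_cup by simp
  thus "(False, prop_edge j k m) \<in> set (strand_of x y (prop_edge i k m))"
    using skip_adjacent(1)[of m] by (auto simp: cup_strand_def prop_edge_def Let_def)
next
  fix e assume e: "e \<in> cat_edges x y" "(False, prop_edge j k m) \<in> set (strand_of x y e)"
  hence e': "e \<in> cup_edges n i k" "(False, prop_edge j k m) \<in> set (strand_table i j k e)"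
    using strand_of_cup cat_edges_cup by auto
  then consider "e = ncup i" | "e = scup k" | m' where "e = prop_edge i k m'"
    unfolding cup_edges_def by blast
  thus "e = prop_edge i k m"
  proof cases
    case (3 m')
    hence "(False, prop_edge j k m) \<in> set (cup_strand i j k m')" using e'(2) by simp
    hence "m' = m" by (auto simp: cup_strand_def prop_edge_def Let_def split: if_splits)
    thus ?thesis using 3 by simp
  qed (use e' in auto)
qed

end

text \<open>The strand through both cups collects their decorations, \<open>bj\<close> before
  \<open>bi'\<close> since it meets the lower cup first. The words must be palindromes because the
  cups may be traversed in either direction, and \<open>dots\<close> says that this strand is the
  one at the wall of the collected colour.\<close>

lemma cat_cup_diag:
  assumes ijk: "1 \<le> i" "i \<le> n + 1" "1 \<le> j" "j \<le> n + 1" "1 \<le> k" "k \<le> n + 1"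
    and adj: "j = i + 1 \<or> i = j + 1" and n: "n \<ge> 1"
    and sym: "rev bi' = bi'" "rev bj = bj"
    and dots: "\<And>c. c \<in> set (bj @ bi') \<Longrightarrow> min i j = (if black c then 1 else n)"
  shows "cat (cup_diag n i i bi bi' []) (cup_diag n j k bj bk cs) = cup_diag n i k bi bk (bj @ bi' @ cs)"
proof -
  let ?x = "cup_diag n i i bi bi' []" and ?y = "cup_diag n j k bj bk cs"
  interpret adjacent_cups n i j k ?x ?y
    using ijk adj by unfold_locales auto
  have m: "min i j \<in> {1..n}" using adj ijk by auto
  have trav_mid: "trav ?y (North (skip i (min i j)), North (max i j)) = bj"
     "trav ?x (South (max i j), South (skip j (min i j))) = bi'"
  proof -
    from skip_adjacent(2)[OF HOL.refl] show "trav ?y (North (skip i (min i j)), North (max i j)) = bj"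
      using trav_cup_diag(1)[of n j k bj bk cs] trav_cup_diag(3)[of n j k bj bk cs] sym
      by (auto simp: ncup_def simp del: One_nat_def)
    from skip_adjacent(3)[OF HOL.refl] show "trav ?x (South (max i j), South (skip j (min i j))) = bi'"
      using trav_cup_diag(2)[of n i i bi bi' "[]"] trav_cup_diag(4)[of n i i bi bi' "[]"] sym
      by (auto simp: scup_def simp del: One_nat_def)
  qed
  have middle: "walk_word ?x ?y (filter (\<lambda>(b, f). \<not> propagating f) (strand_of ?x ?y (prop_edge i k m))) =
      (if m = min i j then bj @ bi' else [])" if "m \<in> {1..n}" for m
  proof -
    have "strand_of ?x ?y (prop_edge i k m) = cup_strand i j k m"
      using strand_of_cup[of "prop_edge i k m"] that by (simp add: cup_edges_def)
    thus ?thesis using trav_mid by (simp add: cup_strand_def Let_def propagating_def walk_word_def)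
  qed
  \<comment> \<open>In the middle part of the vertical list only strand number
    \<open>min i j\<close> contributes.\<close>
  have sel: "concat (map (\<lambda>m. if m = l then f m else []) [1..<N+1]) = (if l \<in> {1..N} then f l else [])"
    for l N and f :: "nat \<Rightarrow> (edge \<times> dec) list"
    by (induction N) auto
  have "concat (map (\<lambda>e. map (Pair e)
         (walk_word ?x ?y (filter (\<lambda>(b, f). \<not> propagating f) (strand_of ?x ?y e))))
       (prop_list (cat_edges ?x ?y))) =
     concat (map (\<lambda>m. if m = min i j then map (Pair (prop_edge i k m)) (bj @ bi') else []) [1..<n+1])"
    unfolding cat_edges_cup prop_list_cup_edges[OF ijk(1,2)] map_map
    by (intro arg_cong[where f = concat] map_cong) (auto simp: middle simp del: upt_Suc)
  also have "\<dots> = map (Pair (prop_edge i k (min i j))) (bj @ bi')"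
    using sel[of "min i j" "\<lambda>m. map (Pair (prop_edge i k m)) (bj @ bi')" n] m by simp
  also have "\<dots> = map (\<lambda>c. (wall_edge n i k c, c)) (bj @ bi')"
    using dots by (auto simp: wall_edge_def)
  finally have mid: "concat (map (\<lambda>e. map (Pair e)
         (walk_word ?x ?y (filter (\<lambda>(b, f). \<not> propagating f) (strand_of ?x ?y e))))
       (prop_list (cat_edges ?x ?y))) = map (\<lambda>c. (wall_edge n i k c, c)) (bj @ bi')" .
  have vert: "cat_vert ?x ?y = map (\<lambda>c. (wall_edge n i k c, c)) (bj @ bi' @ cs)"
    unfolding cat_vert_def mid using host_cup[of 1] host_cup[of n] n
    by (auto simp: wall_edge_def)
  have one: "aval_edges (cup_edges n i k) = 1" by (rule aval_edges_cup_edges)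
  have block: "(if e \<in> cup_edges n i k \<and> \<not> propagating e then walk_word ?x ?y (strand_of ?x ?y e) else []) =
      (if e = ncup i then bi else if e = scup k then bk else [])" for e
  proof -
    have "walk_word ?x ?y [(True, ncup i)] = bi" "walk_word ?x ?y [(False, scup k)] = bk"
      by (simp_all add: walk_word_def trav_cup_diag)
    moreover have "ncup i \<in> cup_edges n i k" "scup k \<in> cup_edges n i k" by (auto simp: cup_edges_def)
    moreover have "e = ncup i \<or> e = scup k" if "e \<in> cup_edges n i k" "\<not> propagating e"
      using that by (auto simp: cup_edges_def)
    ultimately show ?thesis using strand_of_cup by auto
  qed
  show ?thesis
    unfolding cat_def Let_def cat_edges_cup one vert new_loops_cup
    by (simp add: cup_diag_def block)
qed

lemma simple_eq_cup_diag:
  assumes "i \<in> {1..n+1}"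
  shows "simple n i = cup_diag n i i [] [] []"
    "dsimple n i = (let b = if i = 1 then [Bul] else if i = n + 1 then [Circ] else [] in cup_diag n i i b b [])"
proof -
  have "j \<in> skip i ` {1..n} \<longleftrightarrow> j \<in> {1..n+2} - {i, i+1}" for j
  proof
    assume "j \<in> {1..n+2} - {i, i+1}"
    hence "j = skip i (unskip i j)" "unskip i j \<in> {1..n}"
      using assms by (auto simp: skip_def unskip_def split: if_splits)
    thus "j \<in> skip i ` {1..n}" by blast
  qed (use assms in \<open>auto simp: skip_def split: if_splits\<close>)
  hence "skip i ` {1..n} = {1..n+2} - {i, i+1}" by blast
  hence "(\<lambda>j. (North j, South j)) ` skip i ` {1..n} = (\<lambda>j. (North j, South j)) ` ({1..n+2} - {i, i+1})" by simp
  hence E: "cup_edges n i i = {(North i, North (i+1)), (South i, South (i+1))} \<union>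
       {(North j, South j) | j. j \<in> {1..n+2} - {i, i+1}}"
    unfolding cup_edges_def ncup_def scup_def prop_edge_def image_image by blast
  show "simple n i = cup_diag n i i [] [] []"
    unfolding simple_def cup_diag_def E by auto
  thus "dsimple n i = (let b = if i = 1 then [Bul] else if i = n + 1 then [Circ] else [] in cup_diag n i i b b [])"
    unfolding dsimple_def by (auto simp: cup_diag_def ncup_def scup_def Let_def fun_eq_iff)
qed

lemma trav_undecorated:
  "(\<And>e. block d e = []) \<Longrightarrow> vert d = [] \<Longrightarrow> trav d e = []"
  by (simp add: trav_def word_def)

text \<open>The identity, at which \<open>foldr\<close> starts in \<open>diag_prod\<close>, has no
  cup, so its product needs a table of its own: the south cup of the result runs up to the generator
  and back down.\<close>

lemma cat_simple_ident:
  assumes i: "i \<in> {1..n+1}"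
  shows "cat (simple n i) (ident n) = simple n i"
proof -
  let ?x = "cup_diag n i i [] [] []" and ?y = "ident n"
  have ey: "edges ?y = {(North j, South j) | j. j \<in> {1..n+2}}" by (simp add: ident_def)
  define st where "st e = (if e = ncup i then [(True, e)]
    else if e = scup i then [(False, South i, North i), (True, South i, South (i + 1)), (False, North (i + 1), South (i + 1))]
    else [(True, e), (False, e)])" for e
  have st: "strand ?x ?y (st (p, q)) \<and> start_of (st (p, q)) = p \<and> end_of (st (p, q)) = q"
    if pq: "(p, q) \<in> cup_edges n i i" for p q
  proof -
    consider "(p, q) = ncup i" | "(p, q) = scup i" | m where "m \<in> {1..n}" "(p, q) = prop_edge i i m"
      using pq unfolding cup_edges_def by blast
    thus ?thesis
    proof cases
      case 1
      thus ?thesis by (auto simp: ncup_def scup_def st_def strand_def walk_def start_of_def end_of_def precedes_def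
          cup_edges_def)
    next
      case 2
      thus ?thesis using i by (auto simp: scup_def ncup_def st_def strand_def walk_def start_of_def end_of_def precedes_def
          cup_edges_def ey)
    next
      case (3 m)
      have "skip i m \<in> {1..n+2}" using 3 by (auto simp: skip_def)
      moreover have "prop_edge i i m \<in> cup_edges n i i" using 3 by (simp add: cup_edges_def)
      ultimately show ?thesis using 3
        by (simp add: st_def) (auto simp: strand_def walk_def start_of_def end_of_def precedes_def
          prop_edge_def ey)
    qed
  qed
  have py: "partner_unique (edges ?y)" by (auto simp: partner_unique_def ey)
  have px: "partner_unique (edges ?x)" using partner_unique_cup_edges by simp
  have "\<exists>m\<in>{1..n}. a = skip i m" if "a \<in> {1..n+2}" "a \<noteq> i" "a \<noteq> i + 1" for a
    by (rule bexI[of _ "unskip i a"]) (use that i in \<open>auto simp: skip_def unskip_def\<close>)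
  hence cover: "\<exists>e\<in>cup_edges n i i. fst e = p \<or> snd e = p"
    if "b = is_north p" "(p, q) \<in> edges (if b then ?x else ?y) \<or> (q, p) \<in> edges (if b then ?x else ?y)" for b p q
    using that by (cases p) (auto simp: ey cup_edges_def ncup_def scup_def prop_edge_def image_iff)
  have E: "cat_edges ?x ?y = cup_edges n i i"
    by (rule cat_edges_eqI(1)[of ?x ?y, OF px py st cover])
  have loops: "new_loops ?x ?y = {}"
    by (rule new_loops_empty) (auto simp: ey)
  have y: "vert ?y = []" "loops ?y = {#}" by (simp_all add: ident_def)
  have w: "trav ?x e = []" "trav ?y e = []" for e
    by (rule trav_undecorated; simp add: ident_def)+
  have ww: "walk_word ?x ?y ws = []" for ws
    by (auto simp: walk_word_def w)
  have "cat ?x ?y = \<lparr>edges = cup_edges n i i, block = (\<lambda>e. []), vert = [], loops = {#}\<rparr>"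
    unfolding cat_def Let_def E loops ww
    by (simp add: aval_edges_cup_edges cat_vert_def ww y)
  also have "\<dots> = ?x" by (simp add: cup_diag_def fun_eq_iff)
  finally have "cat ?x ?y = ?x" .
  thus ?thesis using simple_eq_cup_diag(1)[OF i] by simp
qed

definition path_word :: "nat \<Rightarrow> nat list \<Rightarrow> bool" where
  "path_word n u \<longleftrightarrow> set u \<subseteq> {1..n+1} \<and> successively (\<lambda>i j. j = i + 1 \<or> i = j + 1) u"

lemma diag_prod_path:
  assumes "path_word n u" "u \<noteq> []" "n \<ge> 1"
  shows "diag_prod n u = cup_diag n (hd u) (last u) [] [] []"
  using assms(1,2)
proof (induction u)
  case (Cons i u)
  have i: "i \<in> {1..n+1}" using Cons.prems by (simp add: path_word_def)
  show ?case
  proof (cases u)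
    case Nil
    thus ?thesis using cat_simple_ident[OF i] simple_eq_cup_diag(1)[OF i] by (simp add: diag_prod_def)
  next
    case u: (Cons j v)
    have "diag_prod n u = cup_diag n j (last u) [] [] []"
      using Cons u by (simp add: path_word_def)
    hence "diag_prod n (i # u) = cat (cup_diag n i i [] [] []) (cup_diag n j (last u) [] [] [])"
      using simple_eq_cup_diag(1)[OF i] by (simp add: diag_prod_def)
    also have "\<dots> = cup_diag n i (last u) [] [] []"
    proof -
      have "last u \<in> set u" using u by simp
      hence "last u \<in> {1..n+1}" "j \<in> {1..n+1}" "j = i + 1 \<or> i = j + 1"
        using Cons.prems u by (auto simp: path_word_def)
      thus ?thesis using cat_cup_diag[of i n j "last u" "[]" "[]" "[]" "[]" "[]"] i assms(3) by simp
    qed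
    finally show ?thesis using u by simp
  qed
qed simp

section \<open>Decorated diagrams of words\<close>

definition dot :: "nat \<Rightarrow> nat \<Rightarrow> dec list" where
  "dot n i = (if i = 1 then [Bul] else if i = n + 1 then [Circ] else [])"

text \<open>What two adjacent copies of \<open>dot n i\<close> fuse to.\<close>

definition tri :: "nat \<Rightarrow> nat \<Rightarrow> dec list" where
  "tri n i = (if i = 1 then [BTri] else if i = n + 1 then [WTri] else [])"

section \<open>Planarity and deformability of the normal form\<close>

lemma cup_edges_cases:
  assumes "e \<in> cup_edges n i k"
  obtains "e = ncup i" | "e = scup k" | m where "m \<in> {1..n}" "e = prop_edge i k m"
  using assms unfolding cup_edges_def by blast

lemma cup_edges_nodes:
  assumes "i \<in> {1..n+1}" "k \<in> {1..n+1}" "(p, q) \<in> cup_edges n i k"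
  shows "p \<in> nodes n" "q \<in> nodes n" "precedes p q"
  using assms by (auto simp: cup_edges_def ncup_def scup_def prop_edge_def nodes_def precedes_def skip_def)

text \<open>Since \<open>skip\<close> is monotone, the propagating edges are nested once the
  boundary is cut open at the left wall, and a cup joins neighbouring positions, which nothing can
  separate.\<close>

lemma planar_cup_edges:
  assumes "i \<in> {1..n+1}" "k \<in> {1..n+1}"
  shows "planar_matching n (cup_edges n i k)"
  unfolding planar_matching_def
proof (intro conjI)
  show "\<forall>(p, q)\<in>cup_edges n i k. p \<in> nodes n \<and> q \<in> nodes n \<and> precedes p q"
    using cup_edges_nodes[OF assms] by blast
  have unskip: "\<exists>m\<in>{1..n}. a = skip i m" if "a \<in> {1..n+2}" "a \<noteq> i" "a \<noteq> i + 1" "i \<in> {1..n+1}" for a i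
    by (rule bexI[of _ "unskip i a"]) (use that in \<open>auto simp: skip_def unskip_def\<close>)
  show "\<forall>p\<in>nodes n. \<exists>!e. e \<in> cup_edges n i k \<and> (p = fst e \<or> p = snd e)"
  proof
    fix p assume p: "p \<in> nodes n"
    have "\<exists>e. e \<in> cup_edges n i k \<and> (p = fst e \<or> p = snd e)"
    proof (cases p)
      case (North a)
      hence "a \<in> {1..n+2}" using p by (auto simp: nodes_def)
      then consider "a = i" | "a = i + 1" | m where "m \<in> {1..n}" "a = skip i m" using unskip assms by metis
      thus ?thesis
      proof cases
        case (3 m)
        thus ?thesis by (intro exI[of _ "prop_edge i k m"]) (simp add: North cup_edges_def prop_edge_def)
      qed (auto simp: North cup_edges_def ncup_def)
    next
      case (South a)
      hence "a \<in> {1..n+2}" using p by (auto simp: nodes_def)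
      then consider "a = k" | "a = k + 1" | m where "m \<in> {1..n}" "a = skip k m" using unskip assms by metis
      thus ?thesis
      proof cases
        case (3 m)
        thus ?thesis by (intro exI[of _ "prop_edge i k m"]) (simp add: South cup_edges_def prop_edge_def)
      qed (auto simp: South cup_edges_def scup_def)
    qed
    moreover have "e = f"
      if "e \<in> cup_edges n i k" "p = fst e \<or> p = snd e" "f \<in> cup_edges n i k" "p = fst f \<or> p = snd f" for e f
    proof -
      obtain a b c d where ef: "e = (a, b)" "f = (c, d)" by (cases e; cases f)
      have "e \<in> {(p, mate i k p), (mate i k p, p)}" "f \<in> {(p, mate i k p), (mate i k p, p)}"
        using that cup_edges_mate[of p _ n i k] unfolding ef by auto
      moreover have "\<not> (precedes p (mate i k p) \<and> precedes (mate i k p) p)" using precedes_asym by blast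
      ultimately show ?thesis
        using that(1,3) cup_edges_nodes(3)[OF assms] by auto
    qed
    ultimately show "\<exists>!e. e \<in> cup_edges n i k \<and> (p = fst e \<or> p = snd e)" by blast
  qed
  show "\<forall>e\<in>cup_edges n i k. \<forall>f\<in>cup_edges n i k. \<not> (lo (pos_left n) e < lo (pos_left n) f \<and>
        lo (pos_left n) f < hi (pos_left n) e \<and> hi (pos_left n) e < hi (pos_left n) f)"
  proof (intro ballI)
    have pos: "lo (pos_left n) (ncup i) = i" "hi (pos_left n) (ncup i) = i + 1"
      "lo (pos_left n) (scup k) = 2 * n + 4 - k" "hi (pos_left n) (scup k) = 2 * n + 5 - k"
      using assms by (auto simp: lo_def hi_def ncup_def scup_def)
    have pos_prop: "lo (pos_left n) (prop_edge i k m) = skip i m" 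
       "hi (pos_left n) (prop_edge i k m) = 2 * n + 5 - skip k m" 
       "1 \<le> skip i m" "skip i m \<le> n + 2" "1 \<le> skip k m" "skip k m \<le> n + 2"
      if "m \<in> {1..n}" for m
      using that assms by (auto simp: lo_def hi_def prop_edge_def skip_def min_def max_def)
    fix e f assume "e \<in> cup_edges n i k" "f \<in> cup_edges n i k"
    thus "\<not> (lo (pos_left n) e < lo (pos_left n) f \<and>
        lo (pos_left n) f < hi (pos_left n) e \<and> hi (pos_left n) e < hi (pos_left n) f)"
    proof (elim cup_edges_cases)
      fix m m' assume m: "m \<in> {1..n}" "e = prop_edge i k m" and m': "m' \<in> {1..n}" "f = prop_edge i k m'"
      show ?thesis
      proof (cases "m < m'")
        case True
        hence "skip k m < skip k m'" by simp
        thus ?thesis using pos_prop[OF m(1)] pos_prop[OF m'(1)] unfolding m(2) m'(2) by linarith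
      next
        case False
        hence "\<not> skip i m < skip i m'" by simp
        thus ?thesis using pos_prop[OF m(1)] pos_prop[OF m'(1)] unfolding m(2) m'(2) by linarith
      qed
    next
      fix m' assume m': "m' \<in> {1..n}" "f = prop_edge i k m'" and "e = ncup i"
      thus ?thesis using pos pos_prop[OF m'(1)] skip_neq[of i m'] by simp
    next
      fix m' assume m': "m' \<in> {1..n}" "f = prop_edge i k m'" and "e = scup k"
      thus ?thesis using pos pos_prop[OF m'(1)] skip_neq[of k m'] assms by simp
    next
      fix m assume m: "m \<in> {1..n}" "e = prop_edge i k m" and "f = ncup i"
      thus ?thesis using pos pos_prop[OF m(1)] by simp
    next
      fix m assume m: "m \<in> {1..n}" "e = prop_edge i k m" and f: "f = scup k"
      have "skip k m < k \<or> skip k m > k + 1" using skip_neq[of k m] by linarith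
      thus ?thesis using pos pos_prop[OF m(1)] assms m f by auto
    qed (use pos assms in auto)
  qed
qed

text \<open>Needed before any relation may be applied. The list \<open>cs\<close> is arbitrary so
  that diagrams with two dots still to be fused are covered.\<close>

lemma decorated_cup_diag:
  assumes i: "i \<in> {1..n+1}" and k: "k \<in> {1..n+1}" and n: "n \<ge> 2"
  shows "decorated n (cup_diag n i k (dot n i) (dot n k) cs)" (is "decorated n ?d")
proof -
  have word: "(e = ncup i \<and> c \<in> set (dot n i)) \<or> (e = scup k \<and> c \<in> set (dot n k)) \<or>
      (\<exists>m\<in>{1..n}. e = prop_edge i k m \<and> m = (if black c then 1 else n))"
    if e: "e \<in> cup_edges n i k" and c: "c \<in> set (word ?d e)" for e c
    using e
  proof (rule cup_edges_cases)
    fix m assume "m \<in> {1..n}" "e = prop_edge i k m"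
    thus ?thesis using c by (auto simp: word_def wall_edge_def)
  qed (use c word_cup_diag[of e i k n] in auto)
  have bounds: "1 \<le> lo (pos_left n) f" "1 \<le> lo (pos_right n) f"
     "hi (pos_left n) f \<le> 2 * n + 4" "hi (pos_right n) f \<le> 2 * n + 4"
    if "f \<in> cup_edges n i k" for f
  proof -
    obtain p q where f: "f = (p, q)" by (cases f)
    hence "p \<in> nodes n" "q \<in> nodes n" using cup_edges_nodes[OF i k] that by auto
    thus "1 \<le> lo (pos_left n) f" "1 \<le> lo (pos_right n) f"
     "hi (pos_left n) f \<le> 2 * n + 4" "hi (pos_right n) f \<le> 2 * n + 4"
      by (auto simp: f nodes_def lo_def hi_def)
  qed
  have exposed: "exposed (if black c then pos_left n else pos_right n) (cup_edges n i k) e"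
    if e: "e \<in> cup_edges n i k" and c: "c \<in> set (word ?d e)" for e c
    using word[OF e c]
  proof (elim disjE bexE conjE)
    assume *: "e = ncup i" "c \<in> set (dot n i)"
    hence "black c \<and> i = 1 \<or> \<not> black c \<and> i = n + 1" by (auto simp: dot_def black_def split: if_splits)
    \<comment> \<open>A dotted cup touches a corner, an extremal position of the cut boundary, so no
      edge can enclose it.\<close>
    hence "lo (if black c then pos_left n else pos_right n) e = 1"
      using * by (auto simp: ncup_def lo_def)
    thus ?thesis using bounds by (fastforce simp: exposed_def)
  next
    assume *: "e = scup k" "c \<in> set (dot n k)"
    hence "black c \<and> k = 1 \<or> \<not> black c \<and> k = n + 1" by (auto simp: dot_def black_def split: if_splits)
    hence "hi (if black c then pos_left n else pos_right n) e = 2 * n + 4"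
      using * by (auto simp: scup_def hi_def)
    thus ?thesis using bounds by (fastforce simp: exposed_def)
  next
    fix m assume m: "m \<in> {1..n}" "e = prop_edge i k m" "m = (if black c then 1 else n)"
    show ?thesis unfolding exposed_def
    proof (rule notI, erule bexE)
      fix f assume f: "f \<in> cup_edges n i k" and lt: "lo (if black c then pos_left n else pos_right n) f
        < lo (if black c then pos_left n else pos_right n) e \<and> hi (if black c then pos_left n else pos_right n) e
        < hi (if black c then pos_left n else pos_right n) f"
      from f show False
      proof (rule cup_edges_cases)
        fix m' assume m': "m' \<in> {1..n}" "f = prop_edge i k m'"
        hence "skip i m' \<ge> skip i 1" "skip i m' \<le> skip i n" "skip i m' \<le> n + 2" "skip i m' \<ge> 1"
          "skip k m' \<le> n + 2" "skip k m' \<ge> 1"  "skip i n \<le> n + 2" "skip k n \<le> n + 2"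
          "skip i 1 \<ge> 1" "skip k 1 \<ge> 1" "skip i 1 \<le> n + 2" "skip k 1 \<le> n + 2"
          "skip i n \<ge> 1" "skip k n \<ge> 1"
          using n by (auto simp: skip_def)
        thus False using lt m m' by (auto simp: prop_edge_def lo_def hi_def min_def max_def split: if_splits)
      qed (use lt i k m n in \<open>auto simp: ncup_def scup_def prop_edge_def lo_def hi_def skip_def min_def max_def split: if_splits\<close>)
    qed
  qed
  have cups: "e = ncup i \<or> e = scup k" if "e \<in> cup_edges n i k" "\<not> propagating e" for e
    using that by (elim cup_edges_cases) auto
  have dots: "black_then_white (dot n i)" for i
    unfolding black_then_white_def
    by (rule exI[of _ "if i = 1 then dot n i else []"], rule exI[of _ "if i = 1 then [] else dot n i"])
      (auto simp: dot_def black_def)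
  \<comment> \<open>Each face has a single non-propagating edge, which makes the left-to-right
    condition on colours vacuous.\<close>
  have same: "\<not> (idx (fst e) < idx (fst f))"
    if "e \<in> cup_edges n i k" "\<not> propagating e" "f \<in> cup_edges n i k" "\<not> propagating f"
      "is_north (fst e) = is_north (fst f)" for e f
    using cups[OF that(1,2)] cups[OF that(3,4)] that(5) by (auto simp: ncup_def scup_def)
  have "deformable n ?d"
    unfolding deformable_def cup_diag_simps
  proof (intro conjI ballI impI)
    show "black_then_white (word ?d e)" if "e \<in> cup_edges n i k" "\<not> propagating e" for e
      using cups[OF that] dots by (auto simp: word_cup_diag)
  qed (use exposed same in auto)
  moreover have "ncup i \<in> cup_edges n i k" "scup k \<in> cup_edges n i k"
    "prop_edge i k 1 \<in> cup_edges n i k" "prop_edge i k n \<in> cup_edges n i k"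
    using n by (auto simp: cup_edges_def)
  ultimately show ?thesis
    unfolding decorated_def using planar_cup_edges[OF i k]
    by (auto simp: wall_edge_def)
qed

section \<open>Membership in the algebra\<close>

lemma in_D_dsimple: "i \<in> {1..n+1} \<Longrightarrow> in_D n (dsimple n i)"
  unfolding in_D_def by (rule D_alg.gen)

lemma in_D_cat:
  assumes "in_D n d" "in_D n d'"
  shows "in_D n (cat d d')"
proof -
  have "cmult (Poly_Mapping.single d 1) (Poly_Mapping.single d' 1) = Poly_Mapping.single (cat d d') 1"
    by (simp add: cmult_def)
  thus ?thesis using D_alg.mult[of "Poly_Mapping.single d 1" n "Poly_Mapping.single d' 1"] assms
    by (simp add: in_D_def)
qed

text \<open>Coefficient 1 identifies the two diagrams themselves; coefficient 2 would only put twice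
  the new diagram into the algebra.\<close>

lemma in_D_drel:
  assumes "in_D n d" "decorated n d" "drel d [:1:] d'"
  shows "in_D n d'"
proof -
  have "0 + (Poly_Mapping.single d 1 - Poly_Mapping.single d' (1 * [:1:])) \<in> null_combs n"
    by (rule null_combs.rel[OF null_combs.zero assms(2,3)])
  hence "Poly_Mapping.single d 1 - Poly_Mapping.single d' 1 \<in> null_combs n"
    by (simp add: one_pCons)
  thus ?thesis using D_alg.cong assms(1) by (simp add: in_D_def)
qed

text \<open>The product of the decorated generators along \<open>u\<close> after all fusions: an end
  letter leaves its dots, an inner wall letter a triangle.\<close>

definition word_diag :: "nat \<Rightarrow> nat list \<Rightarrow> ddiag" where
  "word_diag n u = cup_diag n (hd u) (last u) (dot n (hd u)) (dot n (last u))
     (dot n (hd u) @ concat (map (tri n) (butlast (tl u))) @ dot n (last u))"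

lemma rev_dot [simp]: "rev (dot n i) = dot n i"
  by (simp add: dot_def)

lemma cat_dsimple_cup_diag:
  assumes "n \<ge> 2" "i \<in> {1..n+1}" "j \<in> {1..n+1}" "k \<in> {1..n+1}" "j = i + 1 \<or> i = j + 1"
  shows "cat (dsimple n i) (cup_diag n j k (dot n j) (dot n k) cs) =
    cup_diag n i k (dot n i) (dot n k) (dot n j @ dot n i @ cs)"
proof -
  have "dsimple n i = cup_diag n i i (dot n i) (dot n i) []"
    using simple_eq_cup_diag(2)[OF assms(2)] by (simp add: dot_def Let_def)
  moreover have "min i j = (if black c then 1 else n)" if "c \<in> set (dot n j @ dot n i)" for c
    using that assms by (auto simp: dot_def black_def split: if_splits)
  ultimately show ?thesis using assms
    by (simp only:) (rule cat_cup_diag, auto simp del: One_nat_def)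
qed

text \<open>Prefixing \<open>i\<close> makes the former first letter \<open>j\<close> an inner one.
  The dot on its north cup moves onto the strand through both cups and meets the dot which that
  propagating edge already carries. The induction starts at length 2, as for a single wall letter
  \<open>word_diag\<close> is not the generator.\<close>

lemma in_D_word_diag:
  assumes "n \<ge> 2" "path_word n u" "length u \<ge> 2"
  shows "in_D n (word_diag n u)"
  using assms(2,3)
proof (induction u)
  case (Cons i u)
  then obtain j v where u: "u = j # v" by (cases u) auto
  let ?k = "last u"
  have i: "i \<in> {1..n+1}" and j: "j \<in> {1..n+1}" and k: "?k \<in> {1..n+1}" and adj: "j = i + 1 \<or> i = j + 1"
    and pu: "path_word n u"
    using Cons.prems u last_in_set[of u] by (auto simp: path_word_def simp del: last.simps)
  \<comment> \<open>As \<open>n\<close> is at least 2, two neighbouring letters are never both wall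
    letters.\<close>
  have dd: "dot n i = [] \<or> dot n j = []" using adj assms(1) by (auto simp: dot_def)
  show ?case
  proof (cases "v = []")
    case True
    have "dsimple n j = cup_diag n j j (dot n j) (dot n j) []"
      using simple_eq_cup_diag(2)[OF j] by (simp add: dot_def Let_def)
    hence "in_D n (cup_diag n i j (dot n i) (dot n j) (dot n j @ dot n i))"
      using in_D_cat[OF in_D_dsimple[OF i] in_D_dsimple[OF j]]
        cat_dsimple_cup_diag[OF assms(1) i j j adj, of "[]"] by simp
    moreover have "dot n j @ dot n i = dot n i @ dot n j" using dd by auto
    ultimately show ?thesis using True u by (simp add: word_diag_def)
  next
    case False
    let ?t = "concat (map (tri n) (butlast v)) @ dot n ?k"
    have "in_D n (word_diag n u)" using Cons.IH pu u False by (cases v) auto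
    hence "in_D n (cat (dsimple n i) (word_diag n u))" using in_D_cat in_D_dsimple[OF i] by blast
    moreover have "word_diag n u = cup_diag n j ?k (dot n j) (dot n ?k) (dot n j @ ?t)"
      using u by (simp add: word_diag_def)
    ultimately have *: "in_D n (cup_diag n i ?k (dot n i) (dot n ?k) (dot n j @ dot n i @ dot n j @ ?t))"
      using cat_dsimple_cup_diag[OF assms(1) i j k adj] by simp
    have goal: "word_diag n (i # u) = cup_diag n i ?k (dot n i) (dot n ?k) (dot n i @ tri n j @ ?t)"
      using u False by (simp add: word_diag_def)
    show ?thesis
    proof (cases "dot n j = []")
      case True
      hence "tri n j = []" by (auto simp: dot_def tri_def split: if_splits)
      thus ?thesis using * True goal by simp
    next
      case dj: False
      then obtain a c where ac: "dot n j = [a]" "tri n j = [c]" "fuse a a = Some (1, c)" "black a = black c"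
        by (auto simp: dot_def tri_def black_def split: if_splits)
      let ?d = "cup_diag n i ?k (dot n i) (dot n ?k) ([a, a] @ ?t)"
      let ?vs = "map (\<lambda>c. (wall_edge n i ?k c, c)) ?t"
      have "vert ?d = [] @ [(wall_edge n i ?k a, a), (wall_edge n i ?k a, a)] @ ?vs" by simp
      from drel.vert[OF ac(3) this]
      have fuse: "drel ?d [:1:] (?d\<lparr>vert := [] @ [(wall_edge n i ?k a, c)] @ ?vs\<rparr>)" .
      have "in_D n ?d" using * ac(1) dd by simp
      from in_D_drel[OF this decorated_cup_diag[OF i k assms(1)] fuse]
      have "in_D n (?d\<lparr>vert := [] @ [(wall_edge n i ?k a, c)] @ ?vs\<rparr>)" .
      moreover have "?d\<lparr>vert := [] @ [(wall_edge n i ?k a, c)] @ ?vs\<rparr> =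
          cup_diag n i ?k (dot n i) (dot n ?k) (c # ?t)"
        using ac(4) by (simp add: cup_diag_def wall_edge_def)
      ultimately have "in_D n (cup_diag n i ?k (dot n i) (dot n ?k) (c # ?t))" by (simp only:)
      thus ?thesis using goal ac dd by simp
    qed
  qed
qed simp

section \<open>The map on zigzag words\<close>

text \<open>Supplies a candidate for \<open>tau\<close>: the interval word from \<open>i\<close> to
  \<open>k\<close> has the one-cup diagram with these positions.\<close>

lemma interval_word_FC_A:
  assumes "i \<in> {1..n+1}" "k \<in> {1..n+1}"
  obtains x where "x \<in> FC_A n" "path_word n (red_expr x)" "red_expr x \<noteq> []"
    "hd (red_expr x) = i" "last (red_expr x) = k"
proof (cases "i \<le> k")
  case True
  let ?lab = "\<lambda>x. if 1 \<le> x \<and> x \<le> int n + 1 then nat x else 0"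
  define u where "u = [i..<k+1]"
  have "u = map (\<lambda>r. ?lab (int i + int r)) [0..<k+1-i]"
    using assms True by (intro nth_equalityI) (auto simp: u_def simp del: upt_Suc)
  moreover have "u \<in> lists {1..n+1}" using assms by (auto simp: u_def)
  ultimately have "cox_class {1..n+1} m_A u \<in> FC_A n" "red_expr (cox_class {1..n+1} m_A u) = u"
    using labelled_word_FC[OF coxeter_labelling_A(1)] unfolding FC_A_def by blast+
  moreover have "path_word n u"
    using assms True by (auto simp: u_def path_word_def successively_conv_nth simp del: upt_Suc)
  ultimately show ?thesis using that[of "cox_class {1..n+1} m_A u"] True by (simp add: u_def hd_append)
next
  case False
  let ?lab = "\<lambda>x. if 1 \<le> x \<and> x \<le> int n + 1 then nat (int n + 2 - x) else 0"
  define u where "u = rev [k..<i+1]"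
  have "u = map (\<lambda>r. ?lab (int (n + 2 - i) + int r)) [0..<i+1-k]"
    using assms False by (intro nth_equalityI) (auto simp: u_def rev_nth simp del: upt_Suc)
  moreover have "u \<in> lists {1..n+1}" using assms by (auto simp: u_def)
  ultimately have "cox_class {1..n+1} m_A u \<in> FC_A n" "red_expr (cox_class {1..n+1} m_A u) = u"
    using labelled_word_FC[OF coxeter_labelling_A(2)] unfolding FC_A_def by blast+
  moreover have "path_word n u"
    using assms False by (auto simp: u_def path_word_def successively_conv_nth rev_nth simp del: upt_Suc)
  ultimately show ?thesis using that[of "cox_class {1..n+1} m_A u"] False
    by (simp add: u_def last_rev)
qed

text \<open>Whichever element \<open>SOME\<close> picks, the equation in \<open>tau\<close> fixes
  its diagram: the product has no loops, so the exponent is 0 and both sides coincide.\<close>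

lemma diag_A_tau:
  assumes "n \<ge> 1" "path_word n (red_expr w)" "red_expr w \<noteq> []"
  shows "diag_A n (tau n w) = cup_diag n (hd (red_expr w)) (last (red_expr w)) [] [] []"
proof -
  let ?u = "red_expr w" and ?D = "cup_diag n (hd (red_expr w)) (last (red_expr w)) [] [] []"
  let ?P = "\<lambda>x. x \<in> FC_A n \<and> (\<exists>\<alpha>. diag_prod n ?u =
       (diag_A n x)\<lparr>loops := loops (diag_A n x) + replicate_mset \<alpha> []\<rparr>)"
  have D: "diag_prod n ?u = ?D" by (rule diag_prod_path[OF assms(2,3,1)])
  have "hd ?u \<in> set ?u" "last ?u \<in> set ?u" using assms(3) by auto
  hence "hd ?u \<in> {1..n+1}" "last ?u \<in> {1..n+1}" using assms(2) unfolding path_word_def by blast+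
  then obtain x where x: "x \<in> FC_A n" "path_word n (red_expr x)" "red_expr x \<noteq> []"
    "hd (red_expr x) = hd ?u" "last (red_expr x) = last ?u" by (rule interval_word_FC_A)
  have "diag_A n x = ?D" using diag_prod_path[OF x(2,3) assms(1)] x by (simp add: diag_A_def)
  hence "?P x" using x(1) D by (intro conjI exI[of _ 0]) (auto simp: cup_diag_def)
  hence "?P (tau n w)" unfolding tau_def by (rule someI)
  then obtain \<alpha> where \<alpha>: "?D = (diag_A n (tau n w))\<lparr>loops := loops (diag_A n (tau n w)) + replicate_mset \<alpha> []\<rparr>"
    using D by auto
  hence "loops (diag_A n (tau n w)) + replicate_mset \<alpha> [] = {#}"
    by (metis cup_diag_simps(4) ddiag.select_convs(4) ddiag.surjective ddiag.update_convs(4))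
  hence "loops (diag_A n (tau n w)) = {#}" "\<alpha> = 0" by auto
  thus ?thesis using \<alpha> by simp
qed

text \<open>Neighbouring letters never commute, so the heap is a chain.\<close>

lemma heap_path_word:
  assumes "path_word n u"
  shows "heap (m_C n) u = {(i, j). i < j \<and> j < length u}"
proof -
  have step: "(i, Suc i) \<in> heap (m_C n) u" if "Suc i < length u" for i
  proof -
    have "u ! Suc i = u ! i + 1 \<or> u ! i = u ! Suc i + 1"
      using assms that unfolding path_word_def successively_conv_nth by blast
    thus ?thesis using that unfolding heap_def by (intro r_into_trancl) (auto simp: m_C_def)
  qed
  have "(i, i + Suc d) \<in> heap (m_C n) u" if "i + Suc d < length u" for i d
    using that
  proof (induction d)
    case 0
    thus ?case using step by simp
  next
    case (Suc d)
    hence "(i, i + Suc d) \<in> heap (m_C n) u" "(i + Suc d, i + Suc (Suc d)) \<in> heap (m_C n) u"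
      using step[of "i + Suc d"] by auto
    thus ?case unfolding heap_def by (rule trancl_trans)
  qed
  hence "(i, j) \<in> heap (m_C n) u" if "i < j" "j < length u" for i j
    using that less_imp_Suc_add by (metis add_Suc_right)
  moreover have "i < j \<and> j < length u" if "(i, j) \<in> heap (m_C n) u" for i j
    using that unfolding heap_def by (induction rule: trancl_induct) auto
  ultimately show ?thesis by auto
qed

text \<open>A subset of a chain has exactly one increasing enumeration, which makes the
  \<open>THE\<close> meaningful.\<close>

lemma end_nodes_path_word:
  assumes "path_word n u"
  shows "end_nodes n u = filter (\<lambda>k. u ! k \<in> {1, n+1}) [0..<length u]"
  unfolding end_nodes_def
proof (rule the_equality)
  let ?ks = "filter (\<lambda>k. u ! k \<in> {1, n+1}) [0..<length u]"
  have "sorted_wrt (<) ?ks" by (rule sorted_wrt_filter) simp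
  hence "sorted_wrt (\<lambda>i j. (i, j) \<in> heap (m_C n) u) ?ks"
    by (rule sorted_wrt_mono_rel[rotated]) (auto simp: heap_path_word[OF assms])
  thus "set ?ks = {k. k < length u \<and> u ! k \<in> {1, n+1}} \<and> sorted_wrt (\<lambda>i j. (i, j) \<in> heap (m_C n) u) ?ks"
    by auto
  fix ks assume ks: "set ks = {k. k < length u \<and> u ! k \<in> {1, n+1}} \<and>
    sorted_wrt (\<lambda>i j. (i, j) \<in> heap (m_C n) u) ks"
  hence "sorted_wrt (\<lambda>i j. (i, j) \<in> heap (m_C n) u) ks" by simp
  hence "sorted_wrt (<) ks"
    by (rule sorted_wrt_mono_rel[rotated]) (auto simp: heap_path_word[OF assms])
  moreover have "set ks = set ?ks" using ks by auto
  ultimately show "ks = ?ks" using \<open>sorted_wrt (<) ?ks\<close> strict_sorted_equal by blast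
qed

lemma map_filter_tri:
  "map (\<lambda>k. if u ! k = 1 then (wall_edge n i j BTri, BTri) else (wall_edge n i j WTri, WTri))
     (filter (\<lambda>k. u ! k \<in> {1, n+1}) [0..<length u]) =
   map (\<lambda>c. (wall_edge n i j c, c)) (concat (map (tri n) u))"
proof -
  let ?g = "\<lambda>a. if a = 1 then (wall_edge n i j BTri, BTri) else (wall_edge n i j WTri, WTri)"
  have "filter (\<lambda>a. a \<in> {1, n+1}) u = filter (\<lambda>a. a \<in> {1, n+1}) (map ((!) u) [0..<length u])"
    by (simp only: map_nth)
  also have "\<dots> = map ((!) u) (filter (\<lambda>k. u ! k \<in> {1, n+1}) [0..<length u])"
    by (simp only: filter_map o_def)
  finally have "map ?g (filter (\<lambda>a. a \<in> {1, n+1}) u) =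
      map (\<lambda>k. ?g (u ! k)) (filter (\<lambda>k. u ! k \<in> {1, n+1}) [0..<length u])"
    by (simp only: map_map o_def)
  moreover have "map ?g (filter (\<lambda>a. a \<in> {1, n+1}) u) = map (\<lambda>c. (wall_edge n i j c, c)) (concat (map (tri n) u))"
    by (induction u) (auto simp: tri_def)
  ultimately show ?thesis by simp
qed

lemma word_split:
  assumes "length u \<ge> 2"
  shows "u = hd u # butlast (tl u) @ [last u]"
  using assms by (cases u; cases "tl u") auto

text \<open>If the first letter is a wall letter, its triangle heads the vertical list, so
  \<open>replace_first\<close> hits precisely that one; likewise \<open>replace_last\<close> at the
  bottom.\<close>

lemma dec_Z_path_word:
  assumes n: "n \<ge> 2" and u: "red_expr w = u" "path_word n u" "length u \<ge> 2"
  shows "dec_Z n w = word_diag n u"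
proof -
  let ?i = "hd u" and ?k = "last u" and ?t = "concat (map (tri n) (butlast (tl u)))"
  have "hd u \<in> set u" "last u \<in> set u" using u(3) by (cases u; auto)+
  hence i: "?i \<in> {1..n+1}" and k: "?k \<in> {1..n+1}" using u(2) unfolding path_word_def by blast+
  let ?d = "cup_diag n ?i ?k [] [] []"
  let ?W = "wall_edge n ?i ?k"
  let ?V = "map (\<lambda>c. (?W c, c))"
  have fl: "first_prop d = ?W Bul" "first_prop d = ?W BTri" "last_prop d = ?W Circ" "last_prop d = ?W WTri"
    if "edges d = cup_edges n ?i ?k" for d
    using first_last_prop_cup[OF _ _ _ that] i n by (simp_all add: wall_edge_def black_def)
  have "u = ?i # butlast (tl u) @ [?k]" by (rule word_split[OF u(3)])
  hence "concat (map (tri n) u) = concat (map (tri n) (?i # butlast (tl u) @ [?k]))" by (rule arg_cong)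
  hence tri_u: "concat (map (tri n) u) = tri n ?i @ ?t @ tri n ?k" by simp
  define d0 where "d0 = ?d\<lparr>vert := ?V (tri n ?i @ ?t @ tri n ?k)\<rparr>"
  have edges0: "edges d0 = cup_edges n ?i ?k" by (simp add: d0_def)
  \<comment> \<open>Only the top is adjusted: the last letter still has its triangle, and the south
    cup no dot.\<close>
  define d1 where "d1 = ?d\<lparr>vert := ?V (dot n ?i @ ?t @ tri n ?k), block := \<lambda>e. if e = ncup ?i then dot n ?i else []\<rparr>"
  have edges1: "edges d1 = cup_edges n ?i ?k" by (simp add: d1_def)
  have "dec_Z n w = adjust_bottom n ?k (adjust_top n ?i d0)"
  proof -
    have "red_expr w \<noteq> []" using u by auto
    hence dA: "diag_A n (tau n w) = ?d" using diag_A_tau[of n w] u n by simp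
    have V: "map (\<lambda>k. if u ! k = 1 then (first_prop ?d, BTri) else (last_prop ?d, WTri)) (end_nodes n u) =
        ?V (tri n ?i @ ?t @ tri n ?k)"
      unfolding fl(2)[OF cup_diag_simps(1)] fl(4)[OF cup_diag_simps(1)] end_nodes_path_word[OF u(2)] tri_u[symmetric]
      by (rule map_filter_tri)
    show ?thesis unfolding dec_Z_def Let_def u(1) d0_def dA V ..
  qed
  also have "adjust_top n ?i d0 = d1"
  proof -
    consider "?i = 1" | "?i = n + 1" | "?i \<noteq> 1" "?i \<noteq> n + 1" by blast
    thus ?thesis
    proof cases
      case 1
      thus ?thesis using fl[OF edges0] n
        by (simp add: adjust_top_def d1_def)
          (simp add: d0_def cup_diag_def add_dec_def tri_def dot_def ncup_def fun_eq_iff)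
    next
      case 2
      thus ?thesis using fl[OF edges0] n
        by (simp add: adjust_top_def d1_def)
          (simp add: d0_def cup_diag_def add_dec_def tri_def dot_def ncup_def fun_eq_iff)
    next
      case 3
      thus ?thesis by (simp add: adjust_top_def d0_def d1_def tri_def dot_def cup_diag_def fun_eq_iff)
    qed
  qed
  also have "adjust_bottom n ?k d1 = word_diag n u"
  proof -
    consider "?k = 1" | "?k = n + 1" | "?k \<noteq> 1" "?k \<noteq> n + 1" by blast
    thus ?thesis
    proof cases
      case 1
      thus ?thesis using fl[OF edges1] n
        by (simp add: adjust_bottom_def word_diag_def)
          (simp add: d1_def cup_diag_def add_dec_def tri_def dot_def ncup_def scup_def fun_eq_iff replace_last_def)
    next
      case 2
      thus ?thesis using fl[OF edges1] n
        by (simp add: adjust_bottom_def word_diag_def)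
          (simp add: d1_def cup_diag_def add_dec_def tri_def dot_def ncup_def scup_def fun_eq_iff replace_last_def)
    next
      case 3
      thus ?thesis by (simp add: adjust_bottom_def word_diag_def d1_def tri_def dot_def cup_diag_def fun_eq_iff)
    qed
  qed
  finally show ?thesis .
qed

section \<open>Zigzag words\<close>

lemma zz_lab_eq_iff:
  assumes "n \<ge> 1"
  shows "zz_lab n x = 1 \<longleftrightarrow> x mod (2 * n) = 0" "zz_lab n x = n + 1 \<longleftrightarrow> x mod (2 * n) = n"
    "zz_lab n x \<in> {1..n+1}"
proof -
  define r where "r = x mod (2 * n)"
  have "r < 2 * n" using assms by (simp add: r_def)
  thus "zz_lab n x = 1 \<longleftrightarrow> x mod (2 * n) = 0" "zz_lab n x = n + 1 \<longleftrightarrow> x mod (2 * n) = n"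
    "zz_lab n x \<in> {1..n+1}"
    unfolding zz_lab_def Let_def r_def[symmetric] by auto
qed

lemma zz_lab_Suc:
  assumes "n \<ge> 2"
  shows "zz_lab n (Suc x) = zz_lab n x + 1 \<or> zz_lab n x = zz_lab n (Suc x) + 1"
proof -
  define r where "r = x mod (2 * n)"
  have "r < 2 * n" using assms by (simp add: r_def)
  moreover define s where "s = Suc x mod (2 * n)"
  hence "s = (if Suc r = 2 * n then 0 else Suc r)"
    by (simp add: r_def mod_Suc)
  ultimately show ?thesis using assms unfolding zz_lab_def Let_def r_def[symmetric] s_def[symmetric]
    by (cases "Suc r = 2 * n") auto
qed

lemma path_word_zz:
  assumes "n \<ge> 2"
  shows "path_word n (map (zz_lab n) [a..<b])"
  unfolding path_word_def successively_conv_nth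
proof (intro conjI allI impI)
  show "set (map (zz_lab n) [a..<b]) \<subseteq> {1..n+1}" using zz_lab_eq_iff(3)[of n] assms by auto
  fix r assume "Suc r < length (map (zz_lab n) [a..<b])"
  thus "map (zz_lab n) [a..<b] ! Suc r = map (zz_lab n) [a..<b] ! r + 1 \<or>
      map (zz_lab n) [a..<b] ! r = map (zz_lab n) [a..<b] ! Suc r + 1"
    using zz_lab_Suc[OF assms, of "a + r"] by auto
qed

lemma zz_word_FC:
  assumes n: "n \<ge> 2" and u: "u = map (zz_lab n) [a..<b]"
  shows "cox_class {1..n+1} (m_C n) u \<in> FC_C n" "red_expr (cox_class {1..n+1} (m_C n) u) = u"
    "reduced_expr (cox_class {1..n+1} (m_C n) u) v \<longleftrightarrow> v = u"
proof -
  have "u = map (\<lambda>r. zz_ilab n (int a + int r)) [0..<b-a]"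
    by (rule nth_equalityI) (simp_all add: u flip: of_nat_add zz_ilab_of_nat)
  moreover have "u \<in> lists {1..n+1}" using path_word_zz[of n a b] n by (auto simp: u path_word_def)
  ultimately show "cox_class {1..n+1} (m_C n) u \<in> FC_C n" "red_expr (cox_class {1..n+1} (m_C n) u) = u"
    "reduced_expr (cox_class {1..n+1} (m_C n) u) v \<longleftrightarrow> v = u"
    unfolding FC_C_def
    by (rule labelled_word_FC[OF coxeter_labelling_C[OF n]] labelled_word_unique[OF coxeter_labelling_C[OF n]];
        assumption)+
qed

section \<open>The two families as one set of words\<close>

definition zz_words :: "nat \<Rightarrow> nat list set" where
  "zz_words n = {u. (\<exists>a b. u = map (zz_lab n) [a..<b]) \<and> {1, n+1} \<subseteq> set (butlast (tl u))}"

lemma interior_map_upt: "butlast (tl (map f [a..<b])) = map f [Suc a..<b - 1]"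
proof -
  have "butlast [Suc a..<b] = [Suc a..<b - 1]" by (cases b) auto
  thus ?thesis by (simp only: map_tl[symmetric] map_butlast[symmetric] tl_upt)
qed

lemma residue_in_window:
  fixes N :: nat
  assumes "r < N"
  obtains y where "x \<le> y" "y < x + N" "y mod N = r"
proof
  \<comment> \<open>The summand represents \<open>r - x\<close> modulo \<open>N\<close> without
    truncated subtraction.\<close>
  let ?y = "x + (r + (N - x mod N)) mod N"
  show "x \<le> ?y" "?y < x + N" using assms by auto
  have "?y mod N = (x mod N + (r + (N - x mod N))) mod N" by (metis mod_add_eq mod_mod_trivial)
  also have "x mod N + (r + (N - x mod N)) = r + N" using assms mod_less_divisor[of N x] by linarith
  finally show "?y mod N = r" using assms by simp
qed

lemma count_list_map_upt:
  "count_list (map f [a..<b]) i = card {x \<in> {a..<b}. f x = i}"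
proof (induction b)
  case (Suc b)
  show ?case
  proof (cases "a \<le> b")
    case True
    have "{x \<in> {a..<Suc b}. f x = i} = {x \<in> {a..<b}. f x = i} \<union> (if f b = i then {b} else {})"
      using True by (auto simp: less_Suc_eq)
    thus ?thesis using Suc True by simp
  qed simp
qed simp

text \<open>An inner letter has two residues modulo \<open>2 * n\<close>, so among three occurrences
  two are at least a full period apart, and a full period hits both walls.\<close>

lemma three_occurrences:
  assumes n: "n \<ge> 2" and i: "i \<in> {2..n}" and c: "count_list (map (zz_lab n) [a..<b]) i \<ge> 3"
    and s: "s \<in> {1, n+1}"
  shows "s \<in> set (butlast (tl (map (zz_lab n) [a..<b])))"
proof -
  let ?P = "{x \<in> {a..<b}. zz_lab n x = i}"
  let ?N = "2 * n"
  have P: "3 \<le> card ?P" using c by (simp add: count_list_map_upt)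
  have res: "x mod ?N \<in> {i - 1, 2 * n + 1 - i}" if "x \<in> ?P" for x
  proof -
    have "x mod ?N < ?N" using n by simp
    thus ?thesis using that i unfolding zz_lab_def Let_def by (auto split: if_splits)
  qed
  have "\<exists>x\<in>?P. \<exists>z\<in>?P. x + ?N \<le> z"
  proof (rule ccontr)
    assume *: "\<not> ?thesis"
    have eq: "x = z" if "x \<in> ?P" "z \<in> ?P" "x mod ?N = z mod ?N" "x \<le> z" for x z
    proof -
      have "?N dvd z - x" using that(3,4) mod_eq_dvd_iff_nat[of x z ?N] by simp
      moreover have "\<not> x + ?N \<le> z" using * that(1,2) by blast
      hence "z - x < ?N" using that(4) by linarith
      ultimately have "z - x = 0" using nat_dvd_not_less by blast
      thus ?thesis using that(4) by simp
    qed
    have "inj_on (\<lambda>x. x mod ?N) ?P"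
    proof (rule inj_onI)
      fix x z assume xz: "x \<in> ?P" "z \<in> ?P" "x mod ?N = z mod ?N"
      thus "x = z" using eq[of x z] eq[of z x] by (metis linear)
    qed
    hence "card ?P = card ((\<lambda>x. x mod ?N) ` ?P)" by (simp add: card_image)
    also have "\<dots> \<le> card {i - 1, 2 * n + 1 - i}" using res by (intro card_mono) auto
    also have "\<dots> \<le> 2" by (simp add: card_insert_if)
    finally show False using P by simp
  qed
  then obtain x z where xz: "x \<in> ?P" "z \<in> ?P" "x + ?N \<le> z" by blast
  have "(if s = 1 then 0 else n) < ?N" using n by simp
  from residue_in_window[OF this, of x]
  obtain y where y: "x \<le> y" "y < x + ?N" "y mod ?N = (if s = 1 then 0 else n)" by blast
  have "zz_lab n y = s" using y(3) s zz_lab_eq_iff(1,2)[of n y] n by (auto split: if_splits)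
  \<comment> \<open>\<open>i\<close> is no wall letter, so \<open>y\<close> comes strictly after
    \<open>x\<close>, and it comes before \<open>z\<close> because the window is one period
    long.\<close>
  moreover have "y \<noteq> x" using xz(1) i s calculation n by auto
  ultimately have "zz_lab n y = s" "y \<in> {Suc a..<b - 1}" using y xz by auto
  thus ?thesis unfolding interior_map_upt by force
qed

text \<open>A wall letter has a single neighbour in the Coxeter graph, so the same letter precedes
  and follows it.\<close>

lemma interior_factor:
  assumes n: "n \<ge> 2" and s: "s \<in> set (butlast (tl (map (zz_lab n) [a..<b])))" "s = 1 \<and> t = 2 \<or> s = n + 1 \<and> t = n"
  shows "\<exists>p q. map (zz_lab n) [a..<b] = p @ [t, s, t] @ q"
proof -
  obtain y where y: "Suc a \<le> y" "y < b - 1" "zz_lab n y = s"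
    using s(1) unfolding interior_map_upt by auto
  then obtain x where x: "y = Suc x" by (cases y) auto
  have n1: "n \<ge> 1" using n by simp
  have "zz_lab n x = t" "zz_lab n (Suc y) = t"
    using zz_lab_Suc[OF n, of x] zz_lab_Suc[OF n, of y] zz_lab_eq_iff(3)[OF n1, of x] zz_lab_eq_iff(3)[OF n1, of "Suc y"]
      s(2) y(3) x by auto
  moreover have "[a..<b] = [a..<x] @ [x, y, Suc y] @ [Suc (Suc y)..<b]"
  proof -
    have "[a..<b] = [a..<x] @ [x..<b]" using y x upt_add_eq_append[of a x "b - x"] by simp
    also have "[x..<b] = [x, y, Suc y] @ [Suc (Suc y)..<b]" using y x by (simp add: upt_conv_Cons)
    finally show ?thesis .
  qed
  hence "map (zz_lab n) [a..<b] =
      map (zz_lab n) [a..<x] @ [zz_lab n x, zz_lab n y, zz_lab n (Suc y)] @ map (zz_lab n) [Suc (Suc y)..<b]"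
    by simp
  ultimately show ?thesis using y(3) by metis
qed

lemma mem_interior_factor: "s \<in> set (butlast (tl (p @ [t, s, t'] @ q)))"
  by (cases p) (auto simp: butlast_append)

text \<open>Both walls are hit strictly inside by pigeonhole in (ZZ) and by the two prescribed
  factors in (PZZ). Conversely such a word contains both factors, and the number of occurrences
  decides to which family it belongs.\<close>

lemma ZZ_PZZ_eq:
  assumes n: "n \<ge> 2"
  shows "ZZ n \<union> PZZ n = cox_class {1..n+1} (m_C n) ` zz_words n"
proof
  have n1: "n \<ge> 1" using n by simp
  show "ZZ n \<union> PZZ n \<subseteq> cox_class {1..n+1} (m_C n) ` zz_words n"
  proof
    fix w assume w: "w \<in> ZZ n \<union> PZZ n"
    then obtain u where u: "reduced_expr w u" "zz_factor n u"
      "(\<exists>i\<in>{2..n}. count_list u i \<ge> 3) \<or>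
       (\<exists>p q. u = p @ [2, 1, 2] @ q) \<and> (\<exists>p q. u = p @ [n, n + 1, n] @ q)"
      unfolding ZZ_def PZZ_def by blast
    have "w \<in> cox_group {1..n+1} (m_C n)" using w by (auto simp: ZZ_def PZZ_def FC_C_def FC_def)
    hence "w = cox_class {1..n+1} (m_C n) u" using u(1) cox_group_eq_class by (auto simp: reduced_expr_def)
    moreover obtain a b where ab: "u = map (zz_lab n) [a..<b]" using u(2) zz_factor_iff[OF n1] by blast
    have "{1, n+1} \<subseteq> set (butlast (tl u))"
      using u(3)
    proof
      assume "\<exists>i\<in>{2..n}. count_list u i \<ge> 3"
      thus ?thesis using three_occurrences[OF n] unfolding ab by blast
    next
      assume "(\<exists>p q. u = p @ [2, 1, 2] @ q) \<and> (\<exists>p q. u = p @ [n, n + 1, n] @ q)"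
      thus ?thesis using mem_interior_factor[of 1 _ 2 2] mem_interior_factor[of "n + 1" _ n n] by fastforce
    qed
    ultimately show "w \<in> cox_class {1..n+1} (m_C n) ` zz_words n" using ab unfolding zz_words_def by blast
  qed
  show "cox_class {1..n+1} (m_C n) ` zz_words n \<subseteq> ZZ n \<union> PZZ n"
  proof
    fix w assume "w \<in> cox_class {1..n+1} (m_C n) ` zz_words n"
    then obtain u a b where u: "w = cox_class {1..n+1} (m_C n) u" "u = map (zz_lab n) [a..<b]"
      "{1, n+1} \<subseteq> set (butlast (tl u))"
      unfolding zz_words_def by blast
    have ab: "a \<le> b"
    proof (rule ccontr)
      assume "\<not> a \<le> b"
      thus False using u(2,3) by simp
    qed
    hence "zz_factor n u" using zz_factor_iff[OF n1] u(2) by blast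
    moreover have "w \<in> FC_C n" "reduced_expr w u" using zz_word_FC[OF n u(2)] u(1) by auto
    moreover have factors: "\<exists>p q. u = p @ [2, 1, 2] @ q" "\<exists>p q. u = p @ [n, n + 1, n] @ q"
      using u(3) interior_factor[OF n, of 1 a b 2] interior_factor[OF n, of "n + 1" a b n] unfolding u(2) by auto
    ultimately show "w \<in> ZZ n \<union> PZZ n"
    proof (cases "\<exists>i\<in>{2..n}. count_list u i \<ge> 3")
      case False
      hence "\<forall>i\<in>{2..n}. count_list u i < 3" by (simp add: not_le)
      hence "w \<in> PZZ n" unfolding PZZ_def mem_Collect_eq
        using \<open>zz_factor n u\<close> \<open>w \<in> FC_C n\<close> \<open>reduced_expr w u\<close> factors by blast
      thus ?thesis by blast
    qed (auto simp: ZZ_def)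
  qed
qed

section \<open>Wall hits along the zigzag\<close>

text \<open>The zigzag meets a wall at the positions \<open>n * t\<close>; the parity of
  \<open>t\<close> tells which wall.\<close>

definition alt :: "nat \<Rightarrow> dec" where
  "alt t = (if even t then BTri else WTri)"

text \<open>The ceiling of \<open>b / n\<close>, that is, the number of wall hits at positions below
  \<open>b\<close>.\<close>

definition walls :: "nat \<Rightarrow> nat \<Rightarrow> nat" where
  "walls n b = (b + n - 1) div n"

lemma tri_zz_lab:
  assumes "n \<ge> 1"
  shows "tri n (zz_lab n x) = (if n dvd x then [alt (x div n)] else [])"
proof -
  have "x mod (2 * n) = 0 \<longleftrightarrow> n dvd x \<and> even (x div n)" "x mod (2 * n) = n \<longleftrightarrow> n dvd x \<and> odd (x div n)"
  proof -
    have *: "x mod (2 * n) = n * (x div n mod 2) + x mod n" using mod_mult2_eq[of x n 2] by (simp add: mult.commute)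
    have "x mod n < n" using assms by simp
    thus "x mod (2 * n) = 0 \<longleftrightarrow> n dvd x \<and> even (x div n)" "x mod (2 * n) = n \<longleftrightarrow> n dvd x \<and> odd (x div n)"
      unfolding * using assms by (cases "even (x div n)"; auto simp: mod_eq_0_iff_dvd odd_iff_mod_2_eq_one)+
  qed
  thus ?thesis using zz_lab_eq_iff(1,2)[OF assms, of x] assms unfolding tri_def alt_def by auto
qed

lemma concat_tri_zz:
  assumes "n \<ge> 1" "a \<le> b"
  shows "concat (map (tri n) (map (zz_lab n) [a..<b])) = map alt [walls n a..<walls n b]"
  using assms(2)
proof (induction b rule: dec_induct)
  case (step b)
  have S: "walls n (Suc b) = Suc (b div n)" using assms(1) by (simp add: walls_def)
  have mono: "walls n a \<le> walls n b" using step(1) by (auto simp: walls_def intro: div_le_mono)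
  \<comment> \<open>The counter increases in passing from \<open>b\<close> to \<open>Suc b\<close>
    exactly when \<open>b\<close> is a multiple of \<open>n\<close>.\<close>
  have "walls n b = (if n dvd b then b div n else Suc (b div n))"
  proof (cases "n dvd b")
    case True
    then obtain q where "b = n * q" by blast
    hence "b + n - 1 = (n - 1) + n * q" using assms(1) by simp
    hence "walls n b = q" using assms(1) unfolding walls_def by (simp only: div_mult_self2) simp
    thus ?thesis using True \<open>b = n * q\<close> assms(1) by simp
  next
    case False
    hence "0 < b mod n" by (simp add: mod_greater_zero_iff_not_dvd)
    hence "b + n - 1 = n + (b mod n - 1) + n * (b div n)"
      using mult_div_mod_eq[of n b] by linarith
    moreover have "b mod n - 1 < n" using assms(1) mod_less_divisor[of n b] by linarith
    ultimately have "walls n b = b div n + (n + (b mod n - 1)) div n"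
      using assms(1) unfolding walls_def by (simp only: div_mult_self2)
    moreover have "(n + (b mod n - 1)) div n = 1"
      using \<open>b mod n - 1 < n\<close> assms(1) by (simp add: div_add_self1)
    ultimately show ?thesis using False by simp
  qed
  thus ?case using step S mono tri_zz_lab[OF assms(1), of b] by auto
qed simp

section \<open>Zigzag words give Z-diagrams\<close>

text \<open>Opposite colours sit on different propagating edges, so alternation means that every
  block is a single decoration.\<close>

definition alternating :: "dec list \<Rightarrow> bool" where
  "alternating cs \<longleftrightarrow> successively (\<lambda>c d. black c \<noteq> black d) cs"

lemma alternating_map_black:
  "alternating cs \<longleftrightarrow> successively (\<noteq>) (map black cs)"
  by (simp add: alternating_def successively_map)

lemma runs_alternating:
  "successively (\<lambda>x y. fst x \<noteq> fst y) vs \<Longrightarrow> runs vs = map (\<lambda>(e, c). (e, [c])) vs"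
proof (induction vs)
  case (Cons x vs)
  thus ?case by (cases x; cases vs) (auto split: prod.splits)
qed simp

lemma wall_edge_eq_iff:
  assumes "n \<ge> 2"
  shows "wall_edge n i k c = prop_edge i k 1 \<longleftrightarrow> black c" "wall_edge n i k c = prop_edge i k n \<longleftrightarrow> \<not> black c"
    "wall_edge n i k c = wall_edge n i k c' \<longleftrightarrow> black c = black c'"
  using assms by (auto simp: wall_edge_def)

lemma successively_wall_edge:
  assumes "n \<ge> 2"
  shows "successively (\<lambda>x y. fst x \<noteq> fst y) (map (\<lambda>c. (wall_edge n i k c, c)) cs) \<longleftrightarrow> alternating cs"
  unfolding alternating_def successively_map using wall_edge_eq_iff(3)[OF assms] by simp

lemma prop_blocks_cup_diag:
  assumes "n \<ge> 2" "alternating cs"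
  shows "prop_blocks (cup_diag n i k bt bb cs) (prop_edge i k 1) = map (\<lambda>c. [c]) (filter black cs)"
    "prop_blocks (cup_diag n i k bt bb cs) (prop_edge i k n) = map (\<lambda>c. [c]) (filter (\<lambda>c. \<not> black c) cs)"
proof -
  have "runs (map (\<lambda>c. (wall_edge n i k c, c)) cs) = map (\<lambda>c. (wall_edge n i k c, [c])) cs"
    using assms by (subst runs_alternating) (auto simp: successively_wall_edge)
  hence r: "prop_blocks (cup_diag n i k bt bb cs) e = map (\<lambda>c. [c]) (filter (\<lambda>c. wall_edge n i k c = e) cs)" for e
    by (simp add: prop_blocks_def filter_map o_def)
  show "prop_blocks (cup_diag n i k bt bb cs) (prop_edge i k 1) = map (\<lambda>c. [c]) (filter black cs)"
    "prop_blocks (cup_diag n i k bt bb cs) (prop_edge i k n) = map (\<lambda>c. [c]) (filter (\<lambda>c. \<not> black c) cs)"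
    unfolding r wall_edge_eq_iff(1,2)[OF assms(1)] by simp_all
qed

lemma decs_cup_diag:
  "decs (cup_diag n i k bt bb cs) = mset bt + mset bb + mset cs"
proof -
  have "(\<Sum>e\<in>cup_edges n i k. mset (if e = ncup i then bt else if e = scup k then bb else [])) =
      (\<Sum>e\<in>{ncup i, scup k}. mset (if e = ncup i then bt else if e = scup k then bb else []))"
    by (rule sum.mono_neutral_right) (auto simp: cup_edges_def)
  also have "\<dots> = mset bt + mset bb" by simp
  finally show ?thesis by (simp add: decs_def o_def)
qed

definition bdot :: "nat \<Rightarrow> dec list" where
  "bdot i = (if i = 1 then [Bul] else [])"

definition wdot :: "nat \<Rightarrow> nat \<Rightarrow> dec list" where
  "wdot n i = (if i = n + 1 then [Circ] else [])"

lemma filter_dot: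
  assumes "n \<ge> 1"
  shows "filter black (dot n i) = bdot i" "filter (\<lambda>c. \<not> black c) (dot n i) = wdot n i"
  using assms by (auto simp: dot_def bdot_def wdot_def black_def)

lemma filter_tris:
  assumes "set T \<subseteq> {BTri, WTri}"
  shows "filter black T = replicate (count_list T BTri) BTri"
    "filter (\<lambda>c. \<not> black c) T = replicate (count_list T WTri) WTri"
  using assms by (induction T) (auto simp: black_def)

text \<open>Whether \<open>i\<close> and \<open>k\<close> are at a wall decides the possible end
  shapes there: (a) if neither is, (c) or (d) if one is, (b) or (e) if both are.\<close>

lemma mem_cup_edges:
  assumes "1 \<le> i" "i \<le> n + 1" "1 \<le> k" "k \<le> n + 1" "n \<ge> 2"
  shows "(North 1, North 2) \<in> cup_edges n i k \<longleftrightarrow> i = 1" "(South 1, South 2) \<in> cup_edges n i k \<longleftrightarrow> k = 1"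
    "(North (n+1), North (n+2)) \<in> cup_edges n i k \<longleftrightarrow> i = n + 1"
    "(South (n+1), South (n+2)) \<in> cup_edges n i k \<longleftrightarrow> k = n + 1"
    "(North 1, South 1) \<in> cup_edges n i k \<longleftrightarrow> i \<noteq> 1 \<and> k \<noteq> 1"
    "(North (n+2), South (n+2)) \<in> cup_edges n i k \<longleftrightarrow> i \<noteq> n + 1 \<and> k \<noteq> n + 1"
    "i = 1 \<Longrightarrow> (North 3, South 1) \<in> cup_edges n i k \<longleftrightarrow> k \<noteq> 1"
    "k = 1 \<Longrightarrow> (North 1, South 3) \<in> cup_edges n i k \<longleftrightarrow> i \<noteq> 1"
    "i = 1 \<Longrightarrow> k = 1 \<Longrightarrow> (North 3, South 3) \<in> cup_edges n i k"
    "i = n + 1 \<Longrightarrow> (North n, South (n+2)) \<in> cup_edges n i k \<longleftrightarrow> k \<noteq> n + 1"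
    "k = n + 1 \<Longrightarrow> (North (n+2), South n) \<in> cup_edges n i k \<longleftrightarrow> i \<noteq> n + 1"
    "i = n + 1 \<Longrightarrow> k = n + 1 \<Longrightarrow> (North n, South n) \<in> cup_edges n i k"
  using assms
  by (auto simp: cup_edges_def ncup_def scup_def prop_edge_def skip_def image_iff split: if_splits
      intro: bexI[of _ 1] bexI[of _ n])

lemma prop_edge_ends:
  assumes "1 \<le> i" "i \<le> n + 1" "1 \<le> k" "k \<le> n + 1" "n \<ge> 2"
  shows "prop_edge i k 1 = (North (if i = 1 then 3 else 1), South (if k = 1 then 3 else 1))"
    "prop_edge i k n = (North (if i = n + 1 then n else n + 2), South (if k = n + 1 then n else n + 2))"
  using assms by (auto simp: prop_edge_def skip_def)

lemma end_shapes_cup_diag: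
  assumes ik: "1 \<le> i" "i \<le> n + 1" "1 \<le> k" "k \<le> n + 1" and n: "n \<ge> 2"
    and cs: "cs = dot n i @ T @ dot n k" "alternating cs" "set T \<subseteq> {BTri, WTri}"
  shows "end_shape (cup_diag n i k (dot n i) (dot n k) cs) (North 1, North 2) (South 1, South 2) 1 3 Bul BTri"
     (is "end_shape ?d _ _ _ _ _ _")
    and "end_shape (cup_diag n i k (dot n i) (dot n k) cs)
      (North (n+1), North (n+2)) (South (n+1), South (n+2)) (n+2) n Circ WTri"
proof -
  have n1: "n \<ge> 1" using n by simp
  note E = mem_cup_edges[OF ik n] and F = prop_edge_ends[OF ik n]
  have B: "prop_blocks ?d (prop_edge i k 1) = map (\<lambda>c. [c]) (bdot i) @
      replicate (count_list T BTri) [BTri] @ map (\<lambda>c. [c]) (bdot k)"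
    using prop_blocks_cup_diag(1)[OF n cs(2), of i k "dot n i" "dot n k"]
    unfolding cs(1) filter_append filter_dot[OF n1] filter_tris[OF cs(3)] by simp
  have W: "prop_blocks ?d (prop_edge i k n) = map (\<lambda>c. [c]) (wdot n i) @
      replicate (count_list T WTri) [WTri] @ map (\<lambda>c. [c]) (wdot n k)"
    using prop_blocks_cup_diag(2)[OF n cs(2), of i k "dot n i" "dot n k"]
    unfolding cs(1) filter_append filter_dot[OF n1] filter_tris[OF cs(3)] by simp
  have "count (mset T) Bul = 0" "count (mset T) Circ = 0" using cs(3) by (auto simp: count_mset count_list_0_iff)
  hence cB: "count (decs ?d) Bul = (if i = 1 then 2 else 0) + (if k = 1 then 2 else 0)"
    and cW: "count (decs ?d) Circ = (if i = n + 1 then 2 else 0) + (if k = n + 1 then 2 else 0)"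
    using n unfolding decs_cup_diag cs(1) by (auto simp: dot_def)
  have bB: "i = 1 \<Longrightarrow> block ?d (North 1, North 2) = [Bul]" "k = 1 \<Longrightarrow> block ?d (South 1, South 2) = [Bul]"
    and bW: "i = n + 1 \<Longrightarrow> block ?d (North (n+1), North (n+2)) = [Circ]"
      "k = n + 1 \<Longrightarrow> block ?d (South (n+1), South (n+2)) = [Circ]"
    using n by (auto simp: dot_def ncup_def scup_def)
  have hB: "i = 1 \<Longrightarrow> hd (vert ?d) = (prop_edge i k 1, Bul)" "k = 1 \<Longrightarrow> last (vert ?d) = (prop_edge i k 1, Bul)"
    and hW: "i = n + 1 \<Longrightarrow> hd (vert ?d) = (prop_edge i k n, Circ)"
      "k = n + 1 \<Longrightarrow> last (vert ?d) = (prop_edge i k n, Circ)"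
    using n unfolding cs(1) by (auto simp: dot_def wall_edge_def black_def)
  show "end_shape ?d (North 1, North 2) (South 1, South 2) 1 3 Bul BTri"
    unfolding end_shape_def cup_diag_simps(1)
    using B E(1,2,5,7,8,9) cB bB hB unfolding F bdot_def
    by (cases "i = 1"; cases "k = 1") (simp_all del: cup_diag_simps One_nat_def; blast)+
  show "end_shape ?d (North (n+1), North (n+2)) (South (n+1), South (n+2)) (n+2) n Circ WTri"
    unfolding end_shape_def cup_diag_simps(1)
    using W E(3,4,6,10,11,12) cW bW hW unfolding F wdot_def
    by (cases "i = n + 1"; cases "k = n + 1") (simp_all del: cup_diag_simps One_nat_def; blast)+
qed

lemma no_drel_cup_diag:
  assumes "n \<ge> 2" "alternating cs" "length bt \<le> 1" "length bb \<le> 1"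
  shows "\<not> drel (cup_diag n i k bt bb cs) p d'"
proof
  assume "drel (cup_diag n i k bt bb cs) p d'"
  thus False
  proof cases
    case (block a b k' c e u v)
    thus False using arg_cong[OF block(4), of length] assms(3,4) by (auto split: if_splits)
  next
    case (vert a b k' c u e v)
    have "successively (\<lambda>x y. fst x \<noteq> fst y) (map (\<lambda>c. (wall_edge n i k c, c)) cs)"
      using successively_wall_edge[OF assms(1)] assms(2) by simp
    thus False using vert by (auto simp: successively_append_iff)
  qed simp_all
qed

lemma Z_diagram_cup_diag:
  assumes ik: "1 \<le> i" "i \<le> n + 1" "1 \<le> k" "k \<le> n + 1" and n: "n \<ge> 2"
    and cs: "cs = dot n i @ T @ dot n k" "alternating cs" "set T = {BTri, WTri}"
  shows "Z_diagram n (cup_diag n i k (dot n i) (dot n k) cs)"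
proof -
  let ?d = "cup_diag n i k (dot n i) (dot n k) cs"
  have "decorated n ?d" using decorated_cup_diag ik n by simp
  moreover have "\<not> drel ?d p d'" for p d'
    using no_drel_cup_diag[OF n cs(2)] by (auto simp: dot_def)
  ultimately have "admissible1 n ?d"
    unfolding admissible1_def using end_shapes_cup_diag[OF ik n cs(1,2)] cs(3) by simp
  moreover have "BTri \<in> set cs" "WTri \<in> set cs" using cs(1,3) by auto
  moreover have "first_prop ?d = wall_edge n i k BTri" "last_prop ?d = wall_edge n i k WTri"
    using first_last_prop_cup[of i n ?d k] ik n by (simp_all add: wall_edge_def black_def)
  ultimately show ?thesis unfolding Z_diagram_def by auto
qed

lemma alternating_alt: "alternating (map alt [a..<b])"
  unfolding alternating_def successively_conv_nth by (auto simp: alt_def black_def)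

lemma map_black_dot_tri: "map black (dot n i) = map black (tri n i)"
  by (simp add: dot_def tri_def black_def)

text \<open>Alternation sees colours only. Trading the end dots for triangles makes the whole list a
  piece of the sequence \<open>alt\<close>.\<close>

lemma alternating_dot_iff_tri:
  "alternating (dot n i @ T @ dot n k) \<longleftrightarrow> alternating (tri n i @ T @ tri n k)"
  unfolding alternating_map_black by (simp add: map_black_dot_tri)

lemma tri_word_split:
  assumes "length u \<ge> 2"
  shows "concat (map (tri n) u) = tri n (hd u) @ concat (map (tri n) (butlast (tl u))) @ tri n (last u)"
  using arg_cong[OF word_split[OF assms], of "\<lambda>u. concat (map (tri n) u)"] by simp

lemma zz_words_length: "u \<in> zz_words n \<Longrightarrow> length u \<ge> 2"
  by (cases u; cases "tl u") (auto simp: zz_words_def)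

lemma zz_words_path: "n \<ge> 2 \<Longrightarrow> u \<in> zz_words n \<Longrightarrow> path_word n u"
  using path_word_zz by (auto simp: zz_words_def)

lemma Z_diagram_word_diag:
  assumes n: "n \<ge> 2" and u: "u \<in> zz_words n"
  shows "Z_diagram n (word_diag n u)"
proof -
  let ?T = "concat (map (tri n) (butlast (tl u)))"
  obtain a b where ab: "u = map (zz_lab n) [a..<b]" using u by (auto simp: zz_words_def)
  have len: "length u \<ge> 2" by (rule zz_words_length[OF u])
  hence "a \<le> b" using ab by (cases "a \<le> b") auto
  hence "alternating (concat (map (tri n) u))"
    unfolding ab using concat_tri_zz[of n a b] n alternating_alt by simp
  hence "alternating (dot n (hd u) @ ?T @ dot n (last u))"
    unfolding alternating_dot_iff_tri tri_word_split[OF len] .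
  moreover have "set ?T = {BTri, WTri}"
  proof
    show "set ?T \<subseteq> {BTri, WTri}" by (auto simp: tri_def split: if_splits)
    have "tri n 1 = [BTri]" "tri n (n + 1) = [WTri]" using n by (auto simp: tri_def)
    thus "{BTri, WTri} \<subseteq> set ?T" using u unfolding zz_words_def by (force simp del: One_nat_def)
  qed
  moreover have "hd u \<in> set u" "last u \<in> set u" using len by (cases u; auto)+
  hence "hd u \<in> {1..n+1}" "last u \<in> {1..n+1}"
    using zz_words_path[OF n u] unfolding path_word_def by blast+
  ultimately show ?thesis unfolding word_diag_def using n
    by (intro Z_diagram_cup_diag) auto
qed

section \<open>Every Z-diagram comes from a zigzag word\<close>

text \<open>The single north cup joins neighbours, since a node under it would start a propagating
  edge crossing it. The other \<open>n\<close> north nodes are joined to south nodes in increasing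
  order and leave two south nodes over, whose edge again can enclose nothing.\<close>

lemma planar_matching_one_cup:
  assumes planar: "planar_matching n E" and a1: "aval_edges E = 1"
  obtains i k where "i \<in> {1..n+1}" "k \<in> {1..n+1}" "E = cup_edges n i k"
proof -
  have nodes: "p \<in> nodes n" "q \<in> nodes n" "precedes p q" if "(p, q) \<in> E" for p q
    using planar that unfolding planar_matching_def by blast+
  have ex: "\<exists>e\<in>E. p = fst e \<or> p = snd e" if "p \<in> nodes n" for p
    using planar that unfolding planar_matching_def by blast
  have uniq: "e = f" if "e \<in> E" "f \<in> E" "p \<in> {fst e, snd e}" "p \<in> {fst f, snd f}" for e f p
  proof -
    have "p \<in> nodes n" using nodes[of "fst e" "snd e"] that(1,3) by auto
    thus ?thesis using planar that unfolding planar_matching_def by blast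
  qed
  have cross: False if "e \<in> E" "f \<in> E" "lo (pos_left n) e < lo (pos_left n) f"
      "lo (pos_left n) f < hi (pos_left n) e" "hi (pos_left n) e < hi (pos_left n) f" for e f
    using planar that unfolding planar_matching_def by blast
  have idx: "North a \<in> nodes n \<longleftrightarrow> 1 \<le> a \<and> a \<le> n + 2" "South a \<in> nodes n \<longleftrightarrow> 1 \<le> a \<and> a \<le> n + 2" for a
    by (auto simp: nodes_def)
  have prop_pos: "lo (pos_left n) (North a, South s) = a" "hi (pos_left n) (North a, South s) = 2 * n + 5 - s"
    "1 \<le> a" "a \<le> n + 2" "1 \<le> s" "s \<le> n + 2" if "(North a, South s) \<in> E" for a s
    using nodes[OF that] by (auto simp: idx lo_def hi_def min_def max_def)
  obtain c where c: "{e \<in> E. is_north (fst e) \<and> is_north (snd e)} = {c}"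
    using a1 unfolding aval_edges_def by (auto simp: card_1_singleton_iff)
  then obtain i b where ib: "c = (North i, North b)" "(North i, North b) \<in> E"
    by (cases c) (metis (mono_tags, lifting) fst_conv insertI1 is_north.elims(2) mem_Collect_eq snd_conv)
  have ib_less: "1 \<le> i" "i < b" "b \<le> n + 2" using nodes[OF ib(2)] by (auto simp: idx precedes_def)
  have north: "\<exists>s. (North a, South s) \<in> E" if a: "1 \<le> a" "a \<le> n + 2" "a \<noteq> i" "a \<noteq> b" for a
  proof -
    obtain e where e: "e \<in> E" "North a = fst e \<or> North a = snd e" using ex[of "North a"] a idx by auto
    obtain p q where pq: "e = (p, q)" by (cases e)
    have "\<not> (is_north p \<and> is_north q)"
    proof
      assume "is_north p \<and> is_north q"
      hence "e \<in> {e \<in> E. is_north (fst e) \<and> is_north (snd e)}" using e(1) pq by simp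
      hence "e = (North i, North b)" unfolding c ib(1) by simp
      thus False using e(2) a by auto
    qed
    moreover have "precedes p q" using nodes(3) e(1) pq by blast
    ultimately show ?thesis using e pq by (cases p; cases q) (auto simp: precedes_def)
  qed
  have b: "b = i + 1"
  proof (rule ccontr)
    assume "b \<noteq> i + 1"
    then obtain s where s: "(North (i + 1), South s) \<in> E" using north[of "i + 1"] ib_less by auto
    have "lo (pos_left n) (North i, North b) = i" "hi (pos_left n) (North i, North b) = b"
      using ib_less by (auto simp: lo_def hi_def)
    thus False using prop_pos[OF s] ib_less \<open>b \<noteq> i + 1\<close>
      by (intro cross[OF ib(2) s]) linarith+
  qed
  have sk: "1 \<le> skip i m" "skip i m \<le> n + 2" if "m \<in> {1..n}" for m
    using that ib_less b by (auto simp: skip_def)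
  define g where "g m = (SOME s. (North (skip i m), South s) \<in> E)" for m
  have g: "(North (skip i m), South (g m)) \<in> E" if "m \<in> {1..n}" for m
    unfolding g_def by (rule someI_ex) (rule north, use sk[OF that] b in auto)
  have g_less: "g m < g m'" if m: "m \<in> {1..n}" "m' \<in> {1..n}" "m < m'" for m m'
  proof -
    have "g m \<noteq> g m'"
      using uniq[OF g[OF m(1)] g[OF m(2)], of "South (g m)"] m(3) by auto
    moreover have "\<not> g m' < g m"
    proof
      assume "g m' < g m"
      moreover have "skip i m < skip i m'" using m(3) by simp
      ultimately show False using prop_pos[OF g[OF m(1)]] prop_pos[OF g[OF m(2)]]
        by (intro cross[OF g[OF m(1)] g[OF m(2)]]) linarith+
    qed
    ultimately show ?thesis by simp
  qed
  have inj: "inj_on g {1..n}"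
    by (rule inj_onI) (metis g_less linorder_neqE_nat less_irrefl)
  have g_range: "g ` {1..n} \<subseteq> {1..n+2}" using prop_pos(5,6)[OF g] by auto
  have "card ({1..n+2} - g ` {1..n}) = 2"
    using card_Diff_subset[OF _ g_range] card_image[OF inj] by simp
  then obtain p q where "{1..n+2} - g ` {1..n} = {p, q}" "p \<noteq> q" by (auto simp: card_2_iff)
  then obtain k r where R: "{1..n+2} - g ` {1..n} = {k, r}" "k < r"
    by (metis insert_commute linorder_neqE_nat)
  have south: "a \<in> {k, r} \<and> a' \<in> {k, r} \<and> a < a'" if e: "(South a, South a') \<in> E" for a a'
  proof -
    have "s \<notin> g ` {1..n}" if "s \<in> {a, a'}" for s
    proof
      assume "s \<in> g ` {1..n}"
      then obtain m where "m \<in> {1..n}" "s = g m" by blast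
      thus False using uniq[OF e g[of m], of "South s"] that by auto
    qed
    moreover have "1 \<le> a" "a \<le> n + 2" "1 \<le> a'" "a' \<le> n + 2" "a < a'"
      using nodes[OF e] by (auto simp: idx precedes_def)
    ultimately have "a \<in> {1..n+2} - g ` {1..n}" "a' \<in> {1..n+2} - g ` {1..n}" "a < a'" by auto
    thus ?thesis unfolding R by blast
  qed
  \<comment> \<open>A propagating edge at \<open>k\<close> would start at some
    \<open>skip i m\<close> and so put \<open>k\<close> into the range of \<open>g\<close>; hence
    the edge at \<open>k\<close> stays on the south face.\<close>
  have kr: "(South k, South r) \<in> E"
  proof -
    have k: "1 \<le> k" "k \<le> n + 2" "k \<notin> g ` {1..n}" using R(1) by auto
    then obtain e where e: "e \<in> E" "South k = fst e \<or> South k = snd e" using ex[of "South k"] idx by auto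
    obtain p q where pq: "e = (p, q)" by (cases e)
    have pre: "precedes p q" using nodes(3) e(1) pq by blast
    have "\<not> is_north p"
    proof
      assume "is_north p"
      then obtain x where x: "p = North x" "q = South k" using e pq by (cases p) auto
      hence xk: "(North x, South k) \<in> E" using e pq by simp
      have "x \<noteq> i" "x \<noteq> b" using uniq[OF xk ib(2), of "North x"] by auto
      moreover have "1 \<le> x" "x \<le> n + 2" using prop_pos[OF xk] by auto
      ultimately have "unskip i x \<in> {1..n}" "x = skip i (unskip i x)"
        using b ib_less by (auto simp: unskip_def skip_def)
      thus False using uniq[OF xk g, of "unskip i x" "North x"] k(3) by auto
    qed
    then obtain a a' where "p = South a" "q = South a'" using pre by (cases p; cases q) (auto simp: precedes_def)
    thus ?thesis using south[of a a'] e pq R(2) by auto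
  qed
  have r: "r = k + 1"
  proof (rule ccontr)
    assume *: "r \<noteq> k + 1"
    have "1 \<le> k" "r \<le> n + 2" "k + 1 \<in> {1..n+2} - {k, r}" using R * by auto
    hence "k + 1 \<in> g ` {1..n}" unfolding R(1)[symmetric] by blast
    then obtain m where m: "m \<in> {1..n}" "g m = k + 1" by auto
    have "lo (pos_left n) (South k, South r) = 2 * n + 5 - r" "hi (pos_left n) (South k, South r) = 2 * n + 5 - k"
      using R(2) by (auto simp: lo_def hi_def)
    thus False using prop_pos[OF g[OF m(1)]] m(2) R(2) * \<open>1 \<le> k\<close> \<open>r \<le> n + 2\<close>
      by (intro cross[OF g[OF m(1)] kr]) linarith+
  qed
  have "k \<in> {1..n+2}" "r \<in> {1..n+2}" using R(1) by blast+
  hence k: "k \<in> {1..n+1}" using r by auto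
  have "set (map g [1..<n+1]) = g ` {1..n}"
    by (simp add: atLeastLessThanSuc_atLeastAtMost del: upt_Suc)
  also have "\<dots> = {1..n+2} - {k, r}" using g_range R(1) by blast
  also have "\<dots> = set (map (skip k) [1..<n+1])"
  proof -
    have "{1..n+2} - {k, r} = skip k ` {1..<n+1}"
    proof (intro equalityI subsetI)
      show "x \<in> skip k ` {1..<n+1}" if "x \<in> {1..n+2} - {k, r}" for x
        by (rule image_eqI[of _ _ "unskip k x"]) (use that k r in \<open>auto simp: unskip_def skip_def\<close>)
      show "x \<in> {1..n+2} - {k, r}" if "x \<in> skip k ` {1..<n+1}" for x
        using that k r by (elim imageE) (auto simp: skip_def)
    qed
    thus ?thesis by (simp only: set_map set_upt)
  qed
  finally have "set (map g [1..<n+1]) = set (map (skip k) [1..<n+1])" .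
  moreover have "sorted_wrt (<) (map (skip k) [1..<n+1])"
    by (simp add: sorted_wrt_map del: upt_Suc)
  moreover have "sorted_wrt (<) (map g [1..<n+1])"
    unfolding sorted_wrt_map
  proof (rule sorted_wrt_mono_rel)
    show "sorted_wrt (<) [1..<n+1]" by (rule sorted_wrt_upt)
    fix m m' assume "m \<in> set [1..<n+1]" "m' \<in> set [1..<n+1]" "m < m'"
    thus "g m < g m'" by (intro g_less) (simp_all del: upt_Suc)
  qed
  \<comment> \<open>Both lists enumerate the same set increasingly.\<close>
  ultimately have "map g [1..<n+1] = map (skip k) [1..<n+1]"
    using strict_sorted_equal by blast
  hence g_skip: "g m = skip k m" if "m \<in> {1..n}" for m
    using that unfolding map_eq_conv set_upt by simp
  have "E = cup_edges n i k"
  proof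
    show "cup_edges n i k \<subseteq> E"
      using ib(2) kr g g_skip unfolding b r by (auto simp: cup_edges_def ncup_def scup_def prop_edge_def)
    show "E \<subseteq> cup_edges n i k"
    proof
      fix e assume e: "e \<in> E"
      obtain p q where pq: "e = (p, q)" by (cases e)
      have pre: "precedes p q" using nodes(3) e pq by blast
      show "e \<in> cup_edges n i k"
      proof (cases p)
        case (North x)
        hence x: "1 \<le> x" "x \<le> n + 2" using nodes(1) e pq idx by auto
        show ?thesis
        proof (cases "x = i \<or> x = i + 1")
          case True
          hence "e = (North i, North b)" using uniq[OF e ib(2), of p] North pq b by auto
          thus ?thesis using b by (simp add: cup_edges_def ncup_def)
        next
          case False
          hence m: "unskip i x \<in> {1..n}" "x = skip i (unskip i x)"
            using x b ib_less by (auto simp: unskip_def skip_def)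
          hence "e = (North x, South (g (unskip i x)))"
            using uniq[OF e g[OF m(1)], of p] North pq by auto
          hence "e = prop_edge i k (unskip i x)" using g_skip[OF m(1)] m(2) by (simp add: prop_edge_def)
          thus ?thesis using m(1) by (simp add: cup_edges_def)
        qed
      next
        case (South a)
        then obtain a' where "q = South a'" using pre by (cases q) (auto simp: precedes_def)
        hence "e = (South k, South r)" using south[of a a'] e pq South R(2) by auto
        thus ?thesis using r by (simp add: cup_edges_def scup_def)
      qed
    qed
  qed
  thus ?thesis using that[of i k] k ib_less b by auto
qed

text \<open>Two neighbours on one edge would merge into a run of length at least two.\<close>

lemma alternating_runs:
  assumes "\<forall>(e, w)\<in>set (runs vs). length w = 1"
  shows "successively (\<lambda>x y. fst x \<noteq> fst y) vs"
  using assms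
proof (induction vs)
  case (Cons x vs)
  have runs_Nil: "runs (y # ys) \<noteq> []" for y :: "edge \<times> dec" and ys
    by (cases y) (auto split: list.splits)
  have runs_hd: "\<exists>w bs. runs (y # ys) = (fst y, w) # bs \<and> w \<noteq> []" for y :: "edge \<times> dec" and ys
    by (cases y) (auto split: list.splits)
  show ?case
  proof (cases vs)
    case v: (Cons y ys)
    obtain w bs where r: "runs vs = (fst y, w) # bs" "w \<noteq> []" using runs_hd[of y ys] v by auto
    obtain e c where x: "x = (e, c)" by (cases x)
    have ne: "e \<noteq> fst y"
    proof
      assume "e = fst y"
      hence "runs (x # vs) = (e, c # w) # bs" using r x by simp
      thus False using Cons.prems r(2) by simp
    qed
    hence "runs (x # vs) = (e, [c]) # runs vs" using r x by simp
    hence "successively (\<lambda>x y. fst x \<noteq> fst y) vs" using Cons by auto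
    thus ?thesis using v ne x by simp
  qed simp
qed simp

lemma runs_edges: "fst ` set (runs vs) \<subseteq> fst ` set vs"
proof (induction vs)
  case (Cons x vs)
  have "fst ` set (runs (x # vs)) \<subseteq> insert (fst x) (fst ` set (runs vs))"
    by (cases x; cases "runs vs") auto
  thus ?case using Cons by auto
qed simp

section \<open>Recovering the decorations of a Z-diagram\<close>

lemma exposedD:
  "exposed pos E e \<Longrightarrow> f \<in> E \<Longrightarrow> lo pos f < lo pos e \<Longrightarrow> hi pos e < hi pos f \<Longrightarrow> False"
  unfolding exposed_def by blast

text \<open>The first propagating edge shields everything from the left wall except itself and cups
  in the left corners; the last one does so on the right.\<close>

lemma exposed_cup_edges:
  assumes "1 \<le> i" "i \<le> n + 1" "1 \<le> k" "k \<le> n + 1" "n \<ge> 2"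
  shows "m \<in> {1..n} \<Longrightarrow> exposed (pos_left n) (cup_edges n i k) (prop_edge i k m) \<Longrightarrow> m = 1"
    "m \<in> {1..n} \<Longrightarrow> exposed (pos_right n) (cup_edges n i k) (prop_edge i k m) \<Longrightarrow> m = n"
    "exposed (pos_left n) (cup_edges n i k) (ncup i) \<Longrightarrow> i = 1"
    "exposed (pos_right n) (cup_edges n i k) (ncup i) \<Longrightarrow> i = n + 1"
    "exposed (pos_left n) (cup_edges n i k) (scup k) \<Longrightarrow> k = 1"
    "exposed (pos_right n) (cup_edges n i k) (scup k) \<Longrightarrow> k = n + 1"
proof -
  have mem: "prop_edge i k 1 \<in> cup_edges n i k" "prop_edge i k n \<in> cup_edges n i k"
    using assms by (auto simp: cup_edges_def)
  have L: "lo (pos_left n) (prop_edge i k m) = skip i m" "hi (pos_left n) (prop_edge i k m) = 2 * n + 5 - skip k m"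
    "lo (pos_right n) (prop_edge i k m) = n + 3 - skip i m" "hi (pos_right n) (prop_edge i k m) = n + 2 + skip k m"
    "skip i m \<le> n + 2" "skip k m \<le> n + 2" if "m \<in> {1..n}" for m
    using that assms by (auto simp: lo_def hi_def prop_edge_def skip_def min_def max_def)
  have "1 \<in> {1..n}" "n \<in> {1..n}" using assms by auto
  note L1 = L[OF this(1)] and Ln = L[OF this(2)]
  have C: "lo (pos_left n) (ncup i) = i" "hi (pos_left n) (ncup i) = i + 1"
    "lo (pos_right n) (ncup i) = n + 2 - i" "hi (pos_right n) (ncup i) = n + 3 - i"
    "lo (pos_left n) (scup k) = 2 * n + 4 - k" "hi (pos_left n) (scup k) = 2 * n + 5 - k"
    "lo (pos_right n) (scup k) = n + 2 + k" "hi (pos_right n) (scup k) = n + 3 + k"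
    using assms by (auto simp: lo_def hi_def ncup_def scup_def)
  have s: "skip i 1 \<le> 3" "skip k 1 \<le> 3" "skip i n \<ge> n" "skip k n \<ge> n"
     "i \<noteq> 1 \<Longrightarrow> skip i 1 = 1" "k \<noteq> 1 \<Longrightarrow> skip k 1 = 1"
     "i \<noteq> n + 1 \<Longrightarrow> skip i n = n + 2" "k \<noteq> n + 1 \<Longrightarrow> skip k n = n + 2"
    using assms by (auto simp: skip_def)
  show "m = 1" if "m \<in> {1..n}" "exposed (pos_left n) (cup_edges n i k) (prop_edge i k m)"
  proof (rule ccontr)
    assume "m \<noteq> 1"
    hence "skip i 1 < skip i m" "skip k 1 < skip k m" using that by auto
    thus False using L1 L[OF that(1)] by (intro exposedD[OF that(2) mem(1)]) linarith+
  qed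
  show "m = n" if "m \<in> {1..n}" "exposed (pos_right n) (cup_edges n i k) (prop_edge i k m)"
  proof (rule ccontr)
    assume "m \<noteq> n"
    hence "skip i m < skip i n" "skip k m < skip k n" using that by auto
    thus False using Ln L[OF that(1)] by (intro exposedD[OF that(2) mem(2)]) linarith+
  qed
  show "i = 1" if "exposed (pos_left n) (cup_edges n i k) (ncup i)"
  proof (rule ccontr)
    assume "i \<noteq> 1"
    thus False using s(2) s(5) L1 C assms by (intro exposedD[OF that mem(1)]) linarith+
  qed
  show "i = n + 1" if "exposed (pos_right n) (cup_edges n i k) (ncup i)"
  proof (rule ccontr)
    assume "i \<noteq> n + 1"
    thus False using s(4) s(7) Ln C assms by (intro exposedD[OF that mem(2)]) linarith+
  qed
  show "k = 1" if "exposed (pos_left n) (cup_edges n i k) (scup k)"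
  proof (rule ccontr)
    assume "k \<noteq> 1"
    thus False using s(1) s(6) L1 C assms by (intro exposedD[OF that mem(1)]) linarith+
  qed
  show "k = n + 1" if "exposed (pos_right n) (cup_edges n i k) (scup k)"
  proof (rule ccontr)
    assume "k \<noteq> n + 1"
    thus False using s(3) s(8) Ln C assms by (intro exposedD[OF that mem(2)]) linarith+
  qed
qed

text \<open>An admissible loop carries both colours and cannot reach both walls past a propagating
  edge.\<close>

lemma loops_empty:
  assumes "deformable n d" "e \<in> edges d" "propagating e"
    and "\<forall>w\<in>#loops d. w = [BTri, WTri] \<or> w = [WTri, BTri]"
  shows "loops d = {#}"
proof (rule ccontr)
  assume "loops d \<noteq> {#}"
  then obtain w where w: "w \<in># loops d" by blast
  hence "(\<exists>c\<in>set w. black c) \<and> (\<exists>c\<in>set w. \<not> black c)" using assms(4) by (auto simp: black_def)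
  thus False using assms(1-3) w unfolding deformable_def by blast
qed

text \<open>Exposure sends black decorations to the first and white ones to the last propagating
  edge, which brings the diagram into normal form, and allows a decorated cup only in a
  corner.\<close>

lemma decorated_one_cup:
  assumes n: "n \<ge> 2" and dec: "decorated n d" "aval d = 1" "loops d = {#}"
    and E: "edges d = cup_edges n i k" and ik: "1 \<le> i" "i \<le> n + 1" "1 \<le> k" "k \<le> n + 1"
  shows "d = cup_diag n i k (block d (ncup i)) (block d (scup k)) (map snd (vert d))"
    "\<And>c. c \<in> set (block d (ncup i)) \<Longrightarrow> i = (if black c then 1 else n + 1)"
    "\<And>c. c \<in> set (block d (scup k)) \<Longrightarrow> k = (if black c then 1 else n + 1)"
proof -
  note ex = exposed_cup_edges[OF ik n]
  have cups: "ncup i \<in> edges d" "scup k \<in> edges d" by (auto simp: E cup_edges_def)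
  have deco: "\<forall>e. block d e \<noteq> [] \<longrightarrow> e \<in> edges d"
    "\<forall>e. propagating e \<longrightarrow> block d e = []"
    "\<forall>(e, c)\<in>set (vert d). e \<in> edges d \<and> propagating e" "deformable n d"
    using dec(1,2) unfolding decorated_def by auto
  have exposed: "exposed (if black c then pos_left n else pos_right n) (cup_edges n i k) e"
    if "e \<in> edges d" "c \<in> set (word d e)" for e c
    using deco(4) that unfolding deformable_def E by blast
  show "i = (if black c then 1 else n + 1)" if "c \<in> set (block d (ncup i))" for c
    using exposed[OF cups(1), of c] that ex(3,4) by (auto simp: word_def split: if_splits)
  show "k = (if black c then 1 else n + 1)" if "c \<in> set (block d (scup k))" for c
    using exposed[OF cups(2), of c] that ex(5,6) by (auto simp: word_def split: if_splits)
  have prop_nil: "block d e = []" if "propagating e" for e using deco(2) that by blast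
  have blk: "block d = (\<lambda>e. if e = ncup i then block d (ncup i) else if e = scup k then block d (scup k) else [])"
  proof
    fix e
    show "block d e = (if e = ncup i then block d (ncup i) else if e = scup k then block d (scup k) else [])"
    proof (cases "e \<in> cup_edges n i k")
      case True
      thus ?thesis by (rule cup_edges_cases) (use prop_nil in auto)
    next
      case False
      hence "block d e = []" using deco(1) unfolding E by blast
      thus ?thesis using False cups unfolding E by auto
    qed
  qed
  have "fst x = wall_edge n i k (snd x)" if "x \<in> set (vert d)" for x
  proof -
    obtain e c where x: "x = (e, c)" by (cases x)
    have e: "e \<in> cup_edges n i k" "propagating e" using deco(3) that x unfolding E by auto
    then obtain m where m: "m \<in> {1..n}" "e = prop_edge i k m" by (elim cup_edges_cases) auto
    have "(e, c) \<in> set (filter (\<lambda>x. fst x = e) (vert d))" using that x by simp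
    hence "c \<in> set (map snd (filter (\<lambda>x. fst x = e) (vert d)))" by force
    hence "c \<in> set (word d e)" by (simp add: word_def)
    hence "exposed (if black c then pos_left n else pos_right n) (cup_edges n i k) (prop_edge i k m)"
      using exposed[of e c] e(1) m(2) E by simp
    hence "m = (if black c then 1 else n)" using ex(1,2)[OF m(1)] by (auto split: if_splits)
    thus ?thesis using m(2) x by (simp add: wall_edge_def)
  qed
  hence "vert d = map (\<lambda>c. (wall_edge n i k c, c)) (map snd (vert d))"
    by (intro nth_equalityI) (auto simp: prod_eq_iff)
  thus "d = cup_diag n i k (block d (ncup i)) (block d (scup k)) (map snd (vert d))"
    using E blk dec(3) by (intro ddiag.equality) (simp_all only: cup_diag_simps, simp)
qed

lemma end_shape_cup_diag_west:
  assumes ik: "1 \<le> i" "i \<le> n + 1" "1 \<le> k" "k \<le> n + 1" and n: "n \<ge> 2"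
    and sh: "end_shape (cup_diag n i k bt bb cs) (North 1, North 2) (South 1, South 2) 1 3 Bul BTri"
    and W: "WTri \<in> set cs"
  shows "\<exists>r. prop_blocks (cup_diag n i k bt bb cs) (prop_edge i k 1) = map (\<lambda>c. [c]) (bdot i @ replicate r BTri @ bdot k)"
    "i = 1 \<Longrightarrow> bt = [Bul] \<and> hd cs = Bul" "k = 1 \<Longrightarrow> bb = [Bul] \<and> last cs = Bul"
proof -
  let ?d = "cup_diag n i k bt bb cs"
  note E = mem_cup_edges[OF ik n] and F = prop_edge_ends[OF ik n]
  have "WTri \<in># decs ?d" unfolding decs_cup_diag using W by simp
  \<comment> \<open>The white triangle excludes shape (b), where nothing else is decorated. This
    leaves one shape for each position of the cups.\<close>
  hence nb: "decs ?d \<noteq> {#Bul, Bul#}" "decs ?d \<noteq> {#Bul, Bul, BTri#}" by (auto)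
  have ne: "cs \<noteq> []" using W by auto
  have hl: "hd (vert ?d) = (wall_edge n i k (hd cs), hd cs)" "last (vert ?d) = (wall_edge n i k (last cs), last cs)"
    using ne by (simp_all add: hd_map last_map)
  have b: "block ?d (North 1, North 2) = bt" if "i = 1" using that by (simp add: ncup_def numeral_2_eq_2)
  have b': "block ?d (South 1, South 2) = bb" if "k = 1" using that by (simp add: ncup_def scup_def numeral_2_eq_2)
  from sh have *: "(\<exists>r. prop_blocks ?d (prop_edge i k 1) = map (\<lambda>c. [c]) (bdot i @ replicate r BTri @ bdot k)) \<and>
      (i = 1 \<longrightarrow> bt = [Bul] \<and> hd cs = Bul) \<and> (k = 1 \<longrightarrow> bb = [Bul] \<and> last cs = Bul)"
    unfolding end_shape_def cup_diag_simps(1) hl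
    using nb E(1,2,5,7,8,9) b b' unfolding F bdot_def
    by (cases "i = 1"; cases "k = 1") (simp_all del: cup_diag_simps One_nat_def; blast)+
  thus "\<exists>r. prop_blocks ?d (prop_edge i k 1) = map (\<lambda>c. [c]) (bdot i @ replicate r BTri @ bdot k)"
    "i = 1 \<Longrightarrow> bt = [Bul] \<and> hd cs = Bul" "k = 1 \<Longrightarrow> bb = [Bul] \<and> last cs = Bul" by blast+
qed

lemma end_shape_cup_diag_east:
  assumes ik: "1 \<le> i" "i \<le> n + 1" "1 \<le> k" "k \<le> n + 1" and n: "n \<ge> 2"
    and sh: "end_shape (cup_diag n i k bt bb cs)
      (North (n+1), North (n+2)) (South (n+1), South (n+2)) (n+2) n Circ WTri"
    and W: "BTri \<in> set cs"
  shows "\<exists>r. prop_blocks (cup_diag n i k bt bb cs) (prop_edge i k n) = map (\<lambda>c. [c]) (wdot n i @ replicate r WTri @ wdot n k)"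
    "i = n + 1 \<Longrightarrow> bt = [Circ] \<and> hd cs = Circ" "k = n + 1 \<Longrightarrow> bb = [Circ] \<and> last cs = Circ"
proof -
  let ?d = "cup_diag n i k bt bb cs"
  note E = mem_cup_edges[OF ik n] and F = prop_edge_ends[OF ik n]
  have "BTri \<in># decs ?d" unfolding decs_cup_diag using W by simp
  hence nb: "decs ?d \<noteq> {#Circ, Circ#}" "decs ?d \<noteq> {#Circ, Circ, WTri#}" by (auto)
  have ne: "cs \<noteq> []" using W by auto
  have hl: "hd (vert ?d) = (wall_edge n i k (hd cs), hd cs)" "last (vert ?d) = (wall_edge n i k (last cs), last cs)"
    using ne by (simp_all add: hd_map last_map)
  have b: "block ?d (North (n+1), North (n+2)) = bt" if "i = n + 1" using that by (simp add: ncup_def)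
  have b': "block ?d (South (n+1), South (n+2)) = bb" if "k = n + 1" using that by (simp add: ncup_def scup_def)
  from sh have *: "(\<exists>r. prop_blocks ?d (prop_edge i k n) = map (\<lambda>c. [c]) (wdot n i @ replicate r WTri @ wdot n k)) \<and>
      (i = n + 1 \<longrightarrow> bt = [Circ] \<and> hd cs = Circ) \<and> (k = n + 1 \<longrightarrow> bb = [Circ] \<and> last cs = Circ)"
    unfolding end_shape_def cup_diag_simps(1) hl
    using nb E(3,4,6,10,11,12) b b' unfolding F wdot_def
    by (cases "i = n + 1"; cases "k = n + 1") (simp_all del: cup_diag_simps One_nat_def; blast)+
  thus "\<exists>r. prop_blocks ?d (prop_edge i k n) = map (\<lambda>c. [c]) (wdot n i @ replicate r WTri @ wdot n k)"
    "i = n + 1 \<Longrightarrow> bt = [Circ] \<and> hd cs = Circ" "k = n + 1 \<Longrightarrow> bb = [Circ] \<and> last cs = Circ" by blast+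
qed

lemma alternating_if_single_blocks:
  assumes n: "n \<ge> 2"
    and "\<forall>w\<in>set (prop_blocks (cup_diag n i k bt bb cs) (prop_edge i k 1)). length w = 1"
    and "\<forall>w\<in>set (prop_blocks (cup_diag n i k bt bb cs) (prop_edge i k n)). length w = 1"
  shows "alternating cs"
proof -
  let ?vs = "map (\<lambda>c. (wall_edge n i k c, c)) cs"
  have "length w = 1" if ew: "(e, w) \<in> set (runs ?vs)" for e w
  proof -
    have "e \<in> fst ` set (runs ?vs)" using ew by force
    hence "e = prop_edge i k 1 \<or> e = prop_edge i k n"
      using runs_edges[of ?vs] by (auto simp: wall_edge_def split: if_splits)
    moreover have "w \<in> set (prop_blocks (cup_diag n i k bt bb cs) e)"
      using ew by (force simp: prop_blocks_def)
    ultimately show ?thesis using assms(2,3) by blast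
  qed
  hence "successively (\<lambda>x y. fst x \<noteq> fst y) ?vs" by (intro alternating_runs) blast
  thus ?thesis using successively_wall_edge[OF n] by blast
qed

text \<open>The conditions on highest and lowest decorations place the dots at the ends of
  \<open>cs\<close>; once they are peeled off, both colours consist of triangles only.\<close>

lemma split_dots:
  assumes n: "n \<ge> 2" and mem: "BTri \<in> set cs" "WTri \<in> set cs"
    and B: "filter black cs = bdot i @ replicate r BTri @ bdot k"
    and W: "filter (\<lambda>c. \<not> black c) cs = wdot n i @ replicate r' WTri @ wdot n k"
    and hd: "i = 1 \<Longrightarrow> hd cs = Bul" "i = n + 1 \<Longrightarrow> hd cs = Circ"
    and last: "k = 1 \<Longrightarrow> last cs = Bul" "k = n + 1 \<Longrightarrow> last cs = Circ"
  obtains T where "cs = dot n i @ T @ dot n k" "set T = {BTri, WTri}"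
proof -
  have n1: "n \<ge> 1" using n by simp
  have "cs = hd cs # tl cs" using mem(1) by (cases cs) auto
  hence "cs = dot n i @ (if i = 1 \<or> i = n + 1 then tl cs else cs)"
    using hd by (auto simp: dot_def)
  then obtain S where S: "cs = dot n i @ S" by blast
  have memS: "BTri \<in> set S" "WTri \<in> set S" using mem S by (auto simp: dot_def split: if_splits)
  hence "S \<noteq> []" by auto
  hence "S = butlast S @ [last S]" "last S = last cs" using S by simp_all
  then obtain T where T: "S = T @ dot n k"
    using last that by (metis append.right_neutral dot_def)
  have cs: "cs = dot n i @ T @ dot n k" using S T by simp
  have "filter black T = replicate r BTri" "filter (\<lambda>c. \<not> black c) T = replicate r' WTri"
    using B W unfolding cs filter_append filter_dot[OF n1] by simp_all
  hence "c \<in> {BTri, WTri}" if "c \<in> set T" for c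
  proof -
    have "c \<in> set (filter black T) \<or> c \<in> set (filter (\<lambda>c. \<not> black c) T)" using that by simp
    thus ?thesis unfolding \<open>filter black T = _\<close> \<open>filter (\<lambda>c. \<not> black c) T = _\<close> by auto
  qed
  moreover have "BTri \<in> set T" "WTri \<in> set T" using memS T by (auto simp: dot_def split: if_splits)
  ultimately show ?thesis using that[of T] cs by blast
qed

lemma Z_diagram_decompose:
  assumes n: "n \<ge> 2" and Z: "Z_diagram n d"
  obtains i k T where "1 \<le> i" "i \<le> n + 1" "1 \<le> k" "k \<le> n + 1"
    "d = cup_diag n i k (dot n i) (dot n k) (dot n i @ T @ dot n k)"
    "alternating (dot n i @ T @ dot n k)" "set T = {BTri, WTri}"
proof -
  have adm: "decorated n d" "aval d = 1" "\<forall>w\<in>#loops d. w = [BTri, WTri] \<or> w = [WTri, BTri]"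
    and west: "end_shape d (North 1, North 2) (South 1, South 2) 1 3 Bul BTri"
    and east: "end_shape d (North (n+1), North (n+2)) (South (n+1), South (n+2)) (n+2) n Circ WTri"
    and tris: "(first_prop d, BTri) \<in> set (vert d)" "(last_prop d, WTri) \<in> set (vert d)"
    using Z unfolding Z_diagram_def admissible1_def by blast+
  have "planar_matching n (edges d)" "deformable n d" using adm(1) unfolding decorated_def by blast+
  then obtain i k where ik': "i \<in> {1..n+1}" "k \<in> {1..n+1}" and E: "edges d = cup_edges n i k"
    using planar_matching_one_cup adm(2) unfolding aval_def by blast
  hence ik: "1 \<le> i" "i \<le> n + 1" "1 \<le> k" "k \<le> n + 1" by auto
  have "prop_edge i k 1 \<in> edges d" using n by (simp add: E cup_edges_def)
  hence loops: "loops d = {#}"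
    using loops_empty[OF \<open>deformable n d\<close> _ _ adm(3)] by simp
  define bt bb cs where "bt = block d (ncup i)" and "bb = block d (scup k)" and "cs = map snd (vert d)"
  note D = decorated_one_cup[OF n adm(1,2) loops E ik, folded bt_def bb_def cs_def]
  have mem: "BTri \<in> set cs" "WTri \<in> set cs" using tris unfolding cs_def by force+
  note west' = end_shape_cup_diag_west[OF ik n west[unfolded D(1)] mem(2)]
  note east' = end_shape_cup_diag_east[OF ik n east[unfolded D(1)] mem(1)]
  obtain r where r: "prop_blocks (cup_diag n i k bt bb cs) (prop_edge i k 1) =
      map (\<lambda>c. [c]) (bdot i @ replicate r BTri @ bdot k)" using west'(1) by blast
  obtain r' where r': "prop_blocks (cup_diag n i k bt bb cs) (prop_edge i k n) =
      map (\<lambda>c. [c]) (wdot n i @ replicate r' WTri @ wdot n k)" using east'(1) by blast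
  have alt: "alternating cs"
    by (rule alternating_if_single_blocks[OF n, of i k bt bb]) (unfold r r', auto)
  have inj: "map (\<lambda>c. [c]) xs = map (\<lambda>c. [c]) ys \<longleftrightarrow> xs = ys" for xs ys :: "dec list"
    by (rule inj_map_eq_map) (simp add: inj_def)
  have B: "filter black cs = bdot i @ replicate r BTri @ bdot k"
    using prop_blocks_cup_diag(1)[OF n alt, of i k bt bb] r inj by metis
  have W: "filter (\<lambda>c. \<not> black c) cs = wdot n i @ replicate r' WTri @ wdot n k"
    using prop_blocks_cup_diag(2)[OF n alt, of i k bt bb] r' inj by metis
  obtain T where T: "cs = dot n i @ T @ dot n k" "set T = {BTri, WTri}"
    using split_dots[OF n mem B W] west'(2,3) east'(2,3) by blast
  have bt: "bt = dot n i"
  proof -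
    consider "i = 1" | "i = n + 1" | "i \<noteq> 1" "i \<noteq> n + 1" by blast
    thus ?thesis
    proof cases
      case 3
      \<comment> \<open>A cup away from the corners is exposed to neither wall.\<close>
      hence "c \<notin> set bt" for c using D(2)[of c] by (auto split: if_splits)
      hence "bt = []" by (cases bt) auto
      thus ?thesis using 3 by (simp add: dot_def)
    qed (use west'(2) east'(2) n in \<open>auto simp: dot_def\<close>)
  qed
  have bb: "bb = dot n k"
  proof -
    consider "k = 1" | "k = n + 1" | "k \<noteq> 1" "k \<noteq> n + 1" by blast
    thus ?thesis
    proof cases
      case 3
      hence "c \<notin> set bb" for c using D(3)[of c] by (auto split: if_splits)
      hence "bb = []" by (cases bb) auto
      thus ?thesis using 3 by (simp add: dot_def)
    qed (use west'(3) east'(3) n in \<open>auto simp: dot_def\<close>)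
  qed
  show ?thesis using that[OF ik] D(1) alt T unfolding bt bb T(1) by blast
qed

section \<open>Constructing the zigzag word\<close>

lemma alternating_eq_alt:
  "alternating A \<Longrightarrow> set A \<subseteq> {BTri, WTri} \<Longrightarrow> A \<noteq> [] \<Longrightarrow> hd A = alt t \<Longrightarrow> A = map alt [t..<t + length A]"
proof (induction A arbitrary: t)
  case (Cons c A)
  show ?case
  proof (cases A)
    case Nil
    thus ?thesis using Cons.prems by simp
  next
    case A: (Cons c' A')
    have "black c \<noteq> black c'" "c' \<in> {BTri, WTri}" "c = alt t" using Cons.prems A by (auto simp: alternating_def)
    hence "c' = alt (Suc t)" by (auto simp: alt_def black_def split: if_splits)
    hence "A = map alt [Suc t..<Suc t + length A]"
      using Cons.prems A by (intro Cons.IH) (auto simp: alternating_def)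
    thus ?thesis using \<open>c = alt t\<close> upt_conv_Cons[of t "t + length (c # A)"] by simp
  qed
qed simp

text \<open>The first decoration decides the branch on which to start: a falling one leads to the
  wall \<open>1\<close>, a rising one to \<open>n + 1\<close>. The falling position
  \<open>2 * n + 1 - i\<close> precedes hit number 2, the rising one \<open>2 * n + (i - 1)\<close>
  hit number 3; at a wall the start is itself that hit.\<close>

lemma zz_start:
  assumes "n \<ge> 2" "1 \<le> i" "i \<le> n + 1" "i = 1 \<Longrightarrow> c = BTri" "i = n + 1 \<Longrightarrow> c = WTri" "c \<in> {BTri, WTri}"
  obtains x where "zz_lab n x = i" "alt (walls n x) = c"
proof (cases "c = BTri")
  case True
  let ?x = "2 * n + 1 - i"
  have i: "i \<le> n" using True assms by (cases "i = n + 1") auto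
  have "?x + n - 1 = (n - i) + n * 2" using i assms by simp
  hence "walls n ?x = 2" using i assms unfolding walls_def by (simp only: div_mult_self2) simp
  moreover have "zz_lab n ?x = i"
  proof (cases "i = 1")
    case False
    hence "?x mod (2 * n) = ?x" using i assms by (intro mod_less) auto
    moreover have "\<not> ?x \<le> n" using i by linarith
    ultimately show ?thesis using i by (simp add: zz_lab_def Let_def)
  qed (simp add: zz_lab_def)
  ultimately show ?thesis using that[of ?x] True by (simp add: alt_def)
next
  case False
  let ?x = "2 * n + (i - 1)"
  have i: "2 \<le> i" using False assms by (cases "i = 1") auto
  have "?x + n - 1 = (i - 2) + n * 3" using i assms by simp
  hence "walls n ?x = 3" using i assms unfolding walls_def by (simp only: div_mult_self2) simp
  moreover have "?x mod (2 * n) = i - 1" using i assms by (simp only: mod_add_self1) simp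
  hence "zz_lab n ?x = i" using i assms by (simp add: zz_lab_def Let_def)
  ultimately show ?thesis using that[of ?x] False assms(6) by (simp add: alt_def)
qed

text \<open>Hit number \<open>t\<close> is at position \<open>n * t\<close>. From there
  \<open>k\<close> is \<open>k - 1\<close> steps away after the wall \<open>1\<close> and
  \<open>n + 1 - k\<close> steps after the other one; the parity assumptions keep \<open>k\<close>
  from being the next hit. \<open>Suc y\<close> is the exclusive end of the word.\<close>

lemma zz_stop:
  assumes "n \<ge> 2" "1 \<le> k" "k \<le> n + 1" "k = 1 \<Longrightarrow> even t" "k = n + 1 \<Longrightarrow> odd t"
  obtains y where "zz_lab n y = k" "walls n (Suc y) = Suc t"
proof (cases "even t")
  case True
  let ?y = "n * t + (k - 1)"
  have k: "k \<le> n" using True assms by (cases "k = n + 1") auto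
  have "Suc ?y + n - 1 = (k - 1) + n * Suc t" using k assms by simp
  hence "walls n (Suc ?y) = Suc t" using k assms unfolding walls_def by (simp only: div_mult_self2) simp
  moreover obtain q where "t = 2 * q" using True by blast
  hence "?y = (k - 1) + (2 * n) * q" by simp
  hence "?y mod (2 * n) = k - 1" using k assms by (simp only: mod_mult_self2) simp
  hence "zz_lab n ?y = k" using k assms by (simp add: zz_lab_def Let_def)
  ultimately show ?thesis using that by blast
next
  case False
  let ?y = "n * t + (n + 1 - k)"
  have k: "2 \<le> k" using False assms by (cases "k = 1") auto
  have "Suc ?y + n - 1 = (n + 1 - k) + n * Suc t" using k assms by simp
  hence "walls n (Suc ?y) = Suc t" using k assms unfolding walls_def by (simp only: div_mult_self2) simp
  moreover obtain q where "t = 2 * q + 1" using False by (elim oddE)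
  hence "?y = (n + (n + 1 - k)) + (2 * n) * q" by (simp add: algebra_simps)
  hence "?y mod (2 * n) = n + (n + 1 - k)" using k assms by (simp only: mod_mult_self2) simp
  hence "zz_lab n ?y = k" using k assms by (auto simp: zz_lab_def Let_def)
  ultimately show ?thesis using that by blast
qed

lemma Z_diagram_is_word_diag:
  assumes n: "n \<ge> 2" and Z: "Z_diagram n d"
  obtains u where "u \<in> zz_words n" "d = word_diag n u"
proof -
  obtain i k T where ik: "1 \<le> i" "i \<le> n + 1" "1 \<le> k" "k \<le> n + 1"
    and d: "d = cup_diag n i k (dot n i) (dot n k) (dot n i @ T @ dot n k)"
    and T: "alternating (dot n i @ T @ dot n k)" "set T = {BTri, WTri}"
    using Z_diagram_decompose[OF n Z] by blast
  have n1: "n \<ge> 1" using n by simp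
  \<comment> \<open>The decorations of \<open>d\<close> with the end dots traded for triangles, to
    be matched with the wall hits.\<close>
  define A where "A = tri n i @ T @ tri n k"
  have tris: "set (tri n j) \<subseteq> {BTri, WTri}" for j by (auto simp: tri_def)
  have A: "alternating A" "set A \<subseteq> {BTri, WTri}" "A \<noteq> []"
  proof -
    show "alternating A" unfolding A_def by (rule T(1)[unfolded alternating_dot_iff_tri])
    show "set A \<subseteq> {BTri, WTri}" unfolding A_def set_append T(2) using tris by blast
    have "T \<noteq> []" using T(2) by (metis empty_set insert_not_empty)
    thus "A \<noteq> []" unfolding A_def by simp
  qed
  have "card (set T) \<le> length T" by (rule card_length)
  hence len: "length A \<ge> 2" using T(2) by (simp add: A_def)
  have ends: "hd A \<in> {BTri, WTri}" "last A \<in> {BTri, WTri}"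
    "i = 1 \<Longrightarrow> hd A = BTri" "i = n + 1 \<Longrightarrow> hd A = WTri" "k = 1 \<Longrightarrow> last A = BTri" "k = n + 1 \<Longrightarrow> last A = WTri"
  proof -
    show "hd A \<in> {BTri, WTri}" "last A \<in> {BTri, WTri}"
      using A(2) hd_in_set[OF A(3)] last_in_set[OF A(3)] by blast+
    show "i = 1 \<Longrightarrow> hd A = BTri" "i = n + 1 \<Longrightarrow> hd A = WTri" "k = 1 \<Longrightarrow> last A = BTri" "k = n + 1 \<Longrightarrow> last A = WTri"
      using n by (simp_all add: A_def tri_def)
  qed
  obtain x where x: "zz_lab n x = i" "alt (walls n x) = hd A"
    using zz_start[OF n ik(1,2) ends(3,4,1)] by blast
  have A_alt: "A = map alt [walls n x..<walls n x + length A]"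
    by (rule alternating_eq_alt[OF A x(2)[symmetric]])
  \<comment> \<open>The number of the last wall hit that the word has to make.\<close>
  define t where "t = walls n x + length A - 1"
  have St: "Suc t = walls n x + length A" using len by (simp add: t_def)
  have A_t: "A = map alt [walls n x..<Suc t]" unfolding St by (rule A_alt)
  moreover have "walls n x \<le> t" using len by (simp add: t_def)
  ultimately have "last A = alt t" by simp
  hence "k = 1 \<Longrightarrow> even t" "k = n + 1 \<Longrightarrow> odd t"
    using ends(5,6) by (auto simp: alt_def split: if_splits)
  then obtain y where y: "zz_lab n y = k" "walls n (Suc y) = Suc t"
    using zz_stop[OF n ik(3,4), of t] by blast
  define u where "u = map (zz_lab n) [x..<Suc y]"
  \<comment> \<open>Otherwise there would be no wall hit from \<open>x\<close> up to
    \<open>y\<close>, while \<open>A\<close> has at least two entries.\<close>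
  have "x \<le> y"
  proof (rule ccontr)
    assume "\<not> x \<le> y"
    hence "walls n (Suc y) \<le> walls n x" by (auto simp: walls_def intro: div_le_mono)
    thus False using y(2) St len by simp
  qed
  hence ne: "[x..<Suc y] \<noteq> []" "x < Suc y" by simp_all
  have u: "hd u = i" "last u = k" "u \<noteq> []"
    unfolding u_def hd_map[OF ne(1)] last_map[OF ne(1)] hd_upt[OF ne(2)] last_upt[OF ne(2)]
    using x(1) y(1) ne(1) by (simp_all del: upt_Suc)
  have tri_u: "concat (map (tri n) u) = A"
    unfolding u_def using concat_tri_zz[OF n1, of x "Suc y"] \<open>x \<le> y\<close> y(2) A_t by simp
  have "length u \<noteq> 1"
  proof
    assume "length u = 1"
    then obtain a where "u = [a]" by (auto simp: length_Suc_conv)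
    hence "length A \<le> 1" using tri_u by (auto simp: tri_def)
    thus False using len by simp
  qed
  hence lu: "length u \<ge> 2" using u(3) by (cases u; cases "tl u") auto
  \<comment> \<open>The ends of \<open>u\<close> are \<open>i\<close> and \<open>k\<close>, so
    cancelling their triangles in \<open>A\<close> leaves \<open>T\<close>; as \<open>T\<close> has
    both colours, both walls are hit inside.\<close>
  have T_u: "concat (map (tri n) (butlast (tl u))) = T"
    using tri_word_split[OF lu, of n] tri_u unfolding A_def u(1,2) by simp
  have "{1, n + 1} \<subseteq> set (butlast (tl u))"
    using T(2) unfolding T_u[symmetric] by (auto simp: tri_def split: if_splits)
  hence "u \<in> zz_words n" unfolding zz_words_def u_def by blast
  moreover have "d = word_diag n u" unfolding word_diag_def T_u u(1,2) d ..
  ultimately show ?thesis using that by blast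
qed

theorem theorem8p11:
  fixes n :: nat
  assumes "n \<ge> 2"
  shows "dec_Z n ` (ZZ n \<union> PZZ n) = {d. Z_diagram n d \<and> in_D n d}"
proof -
  have "dec_Z n (cox_class {1..n+1} (m_C n) u) = word_diag n u" if u: "u \<in> zz_words n" for u
  proof -
    obtain a b where "u = map (zz_lab n) [a..<b]" using u by (auto simp: zz_words_def)
    from zz_word_FC(2)[OF assms this] show ?thesis
      by (rule dec_Z_path_word[OF assms _ zz_words_path[OF assms u] zz_words_length[OF u]])
  qed
  hence image: "dec_Z n ` (ZZ n \<union> PZZ n) = word_diag n ` zz_words n"
    unfolding ZZ_PZZ_eq[OF assms] image_image by (rule image_cong[OF HOL.refl])
  show ?thesis unfolding image
  proof (intro equalityI subsetI)
    fix d assume "d \<in> word_diag n ` zz_words n"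
    thus "d \<in> {d. Z_diagram n d \<and> in_D n d}"
      using Z_diagram_word_diag[OF assms] in_D_word_diag[OF assms] zz_words_path[OF assms] zz_words_length
      by auto
  next
    fix d assume "d \<in> {d. Z_diagram n d \<and> in_D n d}"
    thus "d \<in> word_diag n ` zz_words n"
      using Z_diagram_is_word_diag[OF assms, of d] by blast
  qed
qed

end
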